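(* For every complex number $t$, the following identity of formal power series in $x$ holds: \[ \prod_{n \geq 1}(1-x^n)^{2t^2+t} =\sum_{(\lambda,\mu)} \delta_\lambda \delta_\mu\, x^{|\lambda|+ |\mu|} \prod_{h \in \Delta} \left(1-\frac{2t+2}{h}\right)\left(1-\frac{t+1}{h}\right) \prod_{j=1}^{h-1} \left(1-\left(\frac{2t+2}{h + \tau_j j} \right)^2 \right), \] where the sum ranges over all pairs $(\lambda,\mu)$ with $\lambda$ a self-conjugate partition and $\mu$ a doubled distinct partition, $\Delta=\Delta(\lambda,\mu)$, and $\tau_j=1$ if $j\in\Delta$ and $\tau_j=-1$ otherwise.
   Context: A partition $\lambda=(\lambda_1\ge\dots\ge\lambda_\ell>0)$ has weight $|\lambda|=\sum\lambda_i$, conjugate $\lambda'$, hook lengths $h(i,j)=\lambda_i-j+\lambda'_j-i+1$; its principal hook lengths are $h(i,i)$ for the indices $i$ with $\lambda_i\ge i$; the number of such $i$ is $D(\lambda)$ and $\delta_\lambda=(-1)^{D(\lambda)}$. Self-conjugate: $\lambda=\lambda'$. A doubled distinct partition is either empty or, for integers $a_1>\dots>a_d\ge1$, the partition with $D(\lambda)=d$ and $\lambda_i-i=a_i$, $\lambda'_i-i=a_i-1$ for $i\le d$. For a pair $(\lambda,\mu)$, $\Delta$ is the set consisting of the principal hook lengths of $\lambda$ together with those of $\mu$. For complex $t$ the left side means $\exp\!\big(-(2t^2+t)\sum_{k\ge1}\frac{x^k}{k(1-x^k)}\big)$. *)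

theory Defs
  imports "HOL-Analysis.Analysis" "HOL-Computational_Algebra.Formal_Power_Series"
begin

text \<open>A partition is the weakly decreasing list of its (positive) parts.\<close>

definition is_partition :: "nat list \<Rightarrow> bool" where
  "is_partition l \<longleftrightarrow> sorted_wrt (\<ge>) l \<and> 0 \<notin> set l"

definition weight :: "nat list \<Rightarrow> nat" where
  "weight l = sum_list l"

text \<open>Parts are numbered from 1; parts beyond the length are 0.\<close>

definition part :: "nat list \<Rightarrow> nat \<Rightarrow> nat" where
  "part l i = (if 1 \<le> i \<and> i \<le> length l then l ! (i - 1) else 0)"

definition conjugate_partition :: "nat list \<Rightarrow> nat list" where
  "conjugate_partition l = map (\<lambda>j. card {i \<in> {1..length l}. j \<le> part l i}) [1..<Suc (part l 1)]"

text \<open>For a cell \<open>(i, j)\<close> of the diagram of \<open>l\<close>, that is \<open>1 \<le> i\<close> and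
  \<open>1 \<le> j \<le> part l i\<close>, neither subtraction is truncated.\<close>

definition hook_length :: "nat list \<Rightarrow> nat \<Rightarrow> nat \<Rightarrow> nat" where
  "hook_length l i j = (part l i - j) + (part (conjugate_partition l) j - i) + 1"

definition diagonal_indices :: "nat list \<Rightarrow> nat set" where
  "diagonal_indices l = {i. 1 \<le> i \<and> i \<le> part l i}"

definition principal_hooks :: "nat list \<Rightarrow> nat set" where
  "principal_hooks l = (\<lambda>i. hook_length l i i) ` diagonal_indices l"

definition diagonal_size :: "nat list \<Rightarrow> nat" where
  "diagonal_size l = card (diagonal_indices l)"

definition partition_sign :: "nat list \<Rightarrow> complex" where
  "partition_sign l = (- 1) ^ diagonal_size l"

definition self_conjugate :: "nat list \<Rightarrow> bool" where
  "self_conjugate l \<longleftrightarrow> is_partition l \<and> conjugate_partition l = l"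

definition doubled_distinct :: "nat list \<Rightarrow> bool" where
  "doubled_distinct l \<longleftrightarrow> is_partition l \<and>
     (l = [] \<or>
      (\<exists>(d::nat) (a :: nat \<Rightarrow> int).
         1 \<le> d \<and> (\<forall>i\<in>{1..d}. 1 \<le> a i) \<and> (\<forall>i\<in>{1..d}. \<forall>j\<in>{1..d}. i < j \<longrightarrow> a j < a i) \<and>
         diagonal_size l = d \<and>
         (\<forall>i\<in>{1..d}. int (part l i) - int i = a i \<and>
                     int (part (conjugate_partition l) i) - int i = a i - 1)))"

definition pair_hooks :: "nat list \<Rightarrow> nat list \<Rightarrow> nat set" where
  "pair_hooks l m = principal_hooks l \<union> principal_hooks m"

definition hook_sign :: "nat set \<Rightarrow> nat \<Rightarrow> complex" where
  "hook_sign \<Delta> j = (if j \<in> \<Delta> then 1 else - 1)"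

text \<open>The power \<open>\<Prod>n\<ge>1. (1 - x ^ n) powr c\<close> as a formal power series, i.e.\ the
  exponential of \<open>- c * (\<Sum>k\<ge>1. x ^ k / (k * (1 - x ^ k)))\<close>. Infinite sums of formal
  power series are taken in the \<open>x\<close>-adic topology, which is the topology given by the
  library metric on \<^typ>\<open>complex fps\<close>.\<close>

definition euler_log_series :: "complex fps" where
  "euler_log_series =
     (\<Sum>\<^sub>\<infinity>k\<in>{1::nat..}. fps_X ^ k / (of_nat k * (1 - fps_X ^ k)))"

text \<open>The sum converges, so \<open>euler_log_series\<close> is not the default value of
  \<^const>\<open>infsum\<close>.\<close>

lemma euler_log_series_has_sum:
  "((\<lambda>k. fps_X ^ k / (of_nat k * (1 - fps_X ^ k))) has_sum euler_log_series) {1::nat..}"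
proof -
  have z: "fps_nth (fps_X ^ k / (of_nat k * (1 - fps_X ^ k)) :: complex fps) n = 0"
    if "k \<ge> 1" "n < k" for k n
  proof -
    have "fps_nth (of_nat k * (1 - fps_X ^ k) :: complex fps) 0 \<noteq> 0"
      using that by (simp add: fps_mult_nth)
    then have "fps_X ^ k / (of_nat k * (1 - fps_X ^ k)) =
        fps_X ^ k * inverse (of_nat k * (1 - fps_X ^ k) :: complex fps)"
      by (rule fps_divide_unit)
    then show ?thesis using that by (simp add: fps_X_power_mult_nth)
  qed
  let ?S = "Abs_fps (\<lambda>n. \<Sum>k=1..n. fps_nth (fps_X ^ k / (of_nat k * (1 - fps_X ^ k))) n)
    :: complex fps"
  have "((\<lambda>k. fps_X ^ k / (of_nat k * (1 - fps_X ^ k))) has_sum ?S) {1..}"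
    unfolding has_sum_def
  proof (rule tendsto_fpsI)
    fix n
    show "eventually (\<lambda>A. fps_nth (\<Sum>k\<in>A. fps_X ^ k / (of_nat k * (1 - fps_X ^ k))) n =
        fps_nth ?S n) (finite_subsets_at_top {1..})"
      unfolding eventually_finite_subsets_at_top
      by (rule exI[of _ "{1..n}"]) (auto simp: fps_sum_nth intro!: sum.mono_neutral_right z)
  qed
  then show ?thesis
    unfolding euler_log_series_def using has_sum_imp_summable has_sum_infsum by blast
qed

definition euler_power :: "complex \<Rightarrow> complex fps" where
  "euler_power c = fps_exp 1 oo (fps_const (- c) * euler_log_series)"

end

theory Submission
  imports Defs "Jordan_Normal_Form.Determinant" "HOL-Computational_Algebra.Polynomial_FPS"
begin

text \<open>Self-conjugate and doubled distinct partitions are determined by their principal hooks,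
  which are arbitrary finite sets of odd, respectively even, positive integers. So the right-hand
  side is a sum over all finite sets \<open>\<Delta>\<close> of positive integers, with \<open>x\<close> raised to the sum
  of \<open>\<Delta>\<close>. Each coefficient of either side is a polynomial in \<open>t\<close>, hence it suffices to let
  \<open>t \<ge> 1\<close> be an integer. Then all but the sets that are cores modulo \<open>2t + 2\<close> have weight
  zero; the cores are indexed by \<open>\<int>\<^sup>t\<close>, their weights telescope to
  \<open>\<Prod> u\<^sub>i \<Prod> (u\<^sub>i\<^sup>2 - u\<^sub>j\<^sup>2)\<close> with \<open>u\<^sub>i \<equiv> i\<close> modulo \<open>2t + 2\<close>, up to a constant,
  and the claim becomes the Macdonald identity of type C for powers of Euler's product.

  That identity is the limit \<open>y \<rightarrow> 1\<close> of a theta function determinant at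
  \<open>z\<^sub>i = y\<^sup>i\<close>. As a function of one variable, the product side lies in the space spanned by the
  entries of the determinant and vanishes at the other variables; by Cramer's rule the ratio of
  determinant and product does not depend on that variable, and so it is constant. The constant
  is found at the \<open>(2t + 2)\<close>-th roots of unity, where Jacobi's triple product evaluates all
  entries.\<close>

subsection \<open>Infinite products of formal power series\<close>

text \<open>For a positive integer t a factor of the weight vanishes just when h = t + 1, h = 2t +
  2, or h + \<tau>_j j = 2t + 2 for some j < h. The last case means that h - (2t + 2) is positive
  and missing from \<Delta>, or that 2t + 2 - h is smaller than h and present. Forbidding all this
  leaves sets closed under subtraction of 2t + 2, with an antisymmetry between opposite residues;
  this antisymmetry is the source of type C.

  The number relating the theta determinant to the product is never computed. The evaluation at
  roots of unity shows that it does not involve x once powers of Euler's product are split off. At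
  z_i = y^i each coefficient of the determinant is a sum of determinants that, transposed, are
  constant coefficients of the same theta determinant at y^(u_j). The same number therefore stands
  on both sides and cancels.

  Variables are exchanged one at a time, so mixed points occur and must not make the product vanish.
  This is why y > 1 is taken first: the z_i then lie off the unit circle and cannot meet the roots
  of unity.\<close>

definition fps_cong_below :: "nat \<Rightarrow> 'a::comm_ring_1 fps \<Rightarrow> 'a fps \<Rightarrow> bool" where
  "fps_cong_below K F G \<longleftrightarrow> (\<forall>k<K. fps_nth F k = fps_nth G k)"

lemma fps_cong_below_refl [simp]: "fps_cong_below K F F"
  by (simp add: fps_cong_below_def)

lemma fps_cong_below_sym: "fps_cong_below K F G \<Longrightarrow> fps_cong_below K G F"
  by (simp add: fps_cong_below_def)

lemma fps_cong_below_trans [trans]: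
  "fps_cong_below K F G \<Longrightarrow> fps_cong_below K G H \<Longrightarrow> fps_cong_below K F H"
  by (simp add: fps_cong_below_def)

lemma fps_cong_below_mono: "fps_cong_below K F G \<Longrightarrow> L \<le> K \<Longrightarrow> fps_cong_below L F G"
  by (simp add: fps_cong_below_def)

lemma fps_cong_below_mult:
  assumes "fps_cong_below K F G" "fps_cong_below K F' G'"
  shows "fps_cong_below K (F * F') (G * G')"
  using assms unfolding fps_cong_below_def fps_mult_nth by (auto intro!: sum.cong)

lemma fps_cong_below_prod:
  "(\<And>i. i \<in> A \<Longrightarrow> fps_cong_below K (F i) (G i)) \<Longrightarrow> fps_cong_below K (\<Prod>i\<in>A. F i) (\<Prod>i\<in>A. G i)"
  by (induction A rule: infinite_finite_induct) (auto intro: fps_cong_below_mult)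

lemma fps_eqI_cong_below: "(\<And>K. fps_cong_below K F G) \<Longrightarrow> F = G"
  by (rule fps_ext) (metis fps_cong_below_def lessI)

lemma fps_cong_below_X_power_dvd:
  assumes "fps_X ^ K dvd F - G" shows "fps_cong_below K F G"
proof -
  obtain H where "F - G = fps_X ^ K * H" using assms by blast
  then have "fps_nth (F - G) k = 0" if "k < K" for k using that by (simp add: fps_X_power_mult_nth)
  then show ?thesis by (simp add: fps_cong_below_def)
qed

lemma fps_cong_below_dvd_trans:
  assumes "Q ^ K dvd F - G" "fps_X dvd Q" shows "fps_cong_below K F G"
  using assms by (meson dvd_power_same dvd_trans fps_cong_below_X_power_dvd)

lemma fps_nth_prod_0:
  "fps_nth (\<Prod>i\<in>A. F i) 0 = (\<Prod>i\<in>A. fps_nth (F i :: 'a::comm_ring_1 fps) 0)"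
  by (induction A rule: infinite_finite_induct) auto

text \<open>Stronger than convergence of the product: the factor with index n may only change
  coefficients from n on. Coefficient k is then settled by the first k factors, and
  \<open>iprod\<close> can be defined without a limit.\<close>

definition tame :: "(nat \<Rightarrow> complex fps) \<Rightarrow> bool" where
  "tame F \<longleftrightarrow> (\<forall>n\<ge>1. fps_cong_below n (F n) 1)"

definition iprod :: "(nat \<Rightarrow> complex fps) \<Rightarrow> complex fps" where
  "iprod F = Abs_fps (\<lambda>k. fps_nth (\<Prod>n=1..k. F n) k)"

lemma tameI: "(\<And>n k. 1 \<le> n \<Longrightarrow> k < n \<Longrightarrow> fps_nth (F n) k = fps_nth 1 k) \<Longrightarrow> tame F"
  by (simp add: tame_def fps_cong_below_def)

lemma tame_mult: "tame F \<Longrightarrow> tame G \<Longrightarrow> tame (\<lambda>n. F n * G n)"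
  unfolding tame_def by (metis fps_cong_below_mult mult_1)

lemma tame_one: "tame (\<lambda>n. 1)"
  by (simp add: tame_def)

lemma tame_prod: "(\<And>i. i \<in> A \<Longrightarrow> tame (F i)) \<Longrightarrow> tame (\<lambda>n. \<Prod>i\<in>A. F i n)"
  by (induction A rule: infinite_finite_induct) (auto intro: tame_mult tame_one)

lemma tame_power: "tame F \<Longrightarrow> tame (\<lambda>n. F n ^ k)"
  by (induction k) (auto intro: tame_mult tame_one)

lemma iprod_cong_below:
  assumes "tame F" "K \<le> M"
  shows "fps_cong_below (Suc K) (iprod F) (\<Prod>n=1..M. F n)"
  unfolding fps_cong_below_def
proof (intro allI impI)
  fix k assume "k < Suc K"
  with assms have "k \<le> M" by simp
  then have "fps_nth (\<Prod>n=1..M. F n) k = fps_nth (\<Prod>n=1..k. F n) k"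
  proof (induction M rule: dec_induct)
    case (step M)
    \<comment> \<open>The factor with index M + 1 leaves all coefficients up to M alone, so
      truncation at M is right up to and including degree M.\<close>
    have "fps_cong_below (Suc M) (F (Suc M)) 1" using assms by (simp add: tame_def)
    then have "fps_cong_below (Suc M) ((\<Prod>n=1..M. F n) * F (Suc M)) ((\<Prod>n=1..M. F n) * 1)"
      by (intro fps_cong_below_mult) auto
    then show ?case using step by (simp add: fps_cong_below_def)
  qed simp
  then show "fps_nth (iprod F) k = fps_nth (\<Prod>n=1..M. F n) k" by (simp add: iprod_def)
qed

lemma iprod_eqI:
  assumes "tame F" "\<And>K. \<exists>M\<ge>K. fps_cong_below K (\<Prod>n=1..M. F n) G"
  shows "iprod F = G"
proof (rule fps_eqI_cong_below)
  fix K
  obtain M where M: "M \<ge> K" "fps_cong_below K (\<Prod>n=1..M. F n) G" using assms by blast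
  have "fps_cong_below K (iprod F) (\<Prod>n=1..M. F n)"
    using iprod_cong_below[OF assms(1) M(1)] by (rule fps_cong_below_mono) simp
  then show "fps_cong_below K (iprod F) G" using M fps_cong_below_trans by blast
qed

lemma iprod_mult:
  assumes "tame F" "tame G" shows "iprod (\<lambda>n. F n * G n) = iprod F * iprod G"
proof (rule iprod_eqI[OF tame_mult[OF assms]])
  fix K
  have "fps_cong_below K ((\<Prod>n=1..K. F n) * (\<Prod>n=1..K. G n)) (iprod F * iprod G)"
    using iprod_cong_below[OF assms(1) order_refl, of K] iprod_cong_below[OF assms(2) order_refl, of K]
    by (meson fps_cong_below_mono fps_cong_below_mult fps_cong_below_sym lessI less_imp_le)
  then show "\<exists>M\<ge>K. fps_cong_below K (\<Prod>n=1..M. F n * G n) (iprod F * iprod G)"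
    by (auto simp: prod.distrib)
qed

lemma iprod_one [simp]: "iprod (\<lambda>n. 1) = 1"
  by (rule fps_ext) (simp add: iprod_def)

lemma iprod_prod:
  "(\<And>i. i \<in> A \<Longrightarrow> tame (F i)) \<Longrightarrow> iprod (\<lambda>n. \<Prod>i\<in>A. F i n) = (\<Prod>i\<in>A. iprod (F i))"
  by (induction A rule: infinite_finite_induct) (auto simp: iprod_mult tame_prod)

lemma iprod_power: "tame F \<Longrightarrow> iprod (\<lambda>n. F n ^ k) = iprod F ^ k"
  by (induction k) (auto simp: iprod_mult tame_power)

lemma iprod_cong: "(\<And>n. n \<ge> 1 \<Longrightarrow> F n = G n) \<Longrightarrow> iprod F = iprod G"
  unfolding iprod_def by (intro arg_cong[of _ _ Abs_fps] ext arg_cong2[of _ _ _ _ fps_nth] prod.cong) auto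

lemma fps_nth_iprod_0: "fps_nth (iprod F) 0 = 1"
  by (simp add: iprod_def)

lemma iprod_nonzero: "iprod F \<noteq> 0"
  using fps_nth_iprod_0[of F] by auto

lemma tame_linear: "(\<And>n. n \<ge> 1 \<Longrightarrow> e n \<ge> n) \<Longrightarrow> tame (\<lambda>n. 1 - fps_const a * fps_X ^ e n)"
proof (intro tameI)
  fix n k :: nat assume *: "\<And>n. n \<ge> 1 \<Longrightarrow> e n \<ge> n" "1 \<le> n" "k < n"
  then have "k \<noteq> e n" using *(1)[OF *(2)] by linarith
  then show "fps_nth (1 - fps_const a * fps_X ^ e n) k = fps_nth 1 k" by simp
qed

text \<open>Every positive integer is N n - r for exactly one n \<ge> 1 and r < N. Counting the
  residues downwards makes the first block 1, ..., N, so that index 0 never occurs and the regrouped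
  product is again tame.\<close>

lemma iprod_residues:
  assumes "tame F" "N > 0"
  shows "iprod (\<lambda>n. \<Prod>r<N. F (N * n - r)) = iprod F"
proof (rule iprod_eqI)
  show "tame (\<lambda>n. \<Prod>r<N. F (N * n - r))"
  proof (intro tame_prod)
    fix r assume "r \<in> {..<N}"
    then have r: "r < N" by simp
    have "n \<le> N * n - r" if n1: "n \<ge> 1" for n
    proof -
      obtain n' where n': "n = Suc n'" using n1 by (cases n) auto
      have "n' \<le> N * n'" "N * n = N + N * n'" using assms n' by simp_all
      then show ?thesis using r n' by linarith
    qed
    then show "tame (\<lambda>n. F (N * n - r))"
      using assms(1) unfolding tame_def by (meson fps_cong_below_mono order_trans)
  qed
  fix K
  have "(\<Prod>n=1..M. \<Prod>r<N. F (N * n - r)) = (\<Prod>n=1..N*M. F n)" for M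
  proof (induction M)
    case (Suc M)
    have "(\<Prod>r<N. F (N * Suc M - r)) = (\<Prod>n\<in>{N*M<..N*Suc M}. F n)"
      by (rule prod.reindex_bij_witness[of _ "\<lambda>n. N * Suc M - n" "\<lambda>r. N * Suc M - r"]) auto
    moreover have "{1..N * Suc M} = {1..N*M} \<union> {N*M<..N*Suc M}" by auto
    moreover have "{1..N*M} \<inter> {N*M<..N*Suc M} = {}" by auto
    ultimately show ?case using Suc by (simp add: prod.union_disjoint del: mult_Suc_right)
  qed simp
  moreover have "fps_cong_below (Suc K) (iprod F) (\<Prod>n=1..N*K. F n)"
    using assms(2) by (intro iprod_cong_below[OF assms(1)]) simp
  ultimately have "fps_cong_below (Suc K) (iprod F) (\<Prod>n=1..K. \<Prod>r<N. F (N * n - r))"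
    by simp
  then have "fps_cong_below K (\<Prod>n=1..K. \<Prod>r<N. F (N * n - r)) (iprod F)"
    by (simp add: fps_cong_below_def)
  then show "\<exists>M\<ge>K. fps_cong_below K (\<Prod>n=1..M. \<Prod>r<N. F (N * n - r)) (iprod F)" by blast
qed

subsection \<open>The triple product identity\<close>

text \<open>The q-Pochhammer symbol (Q; Q)_n.\<close>

definition qpoch :: "complex fps \<Rightarrow> nat \<Rightarrow> complex fps" where
  "qpoch Q n = (\<Prod>i=1..n. 1 - Q ^ i)"

text \<open>With the convention that the inverse is \<open>0\<close> at negative arguments, the recursion
  \<open>qpoch_inv_pred\<close> holds down to \<open>0\<close>.\<close>

definition qpoch_inv :: "complex fps \<Rightarrow> int \<Rightarrow> complex fps" where
  "qpoch_inv Q m = (if m < 0 then 0 else inverse (qpoch Q (nat m)))"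

text \<open>The Gaussian binomial coefficient "2n choose n + j", centred so that the finite triple
  product is a sum over -n, ..., n.\<close>

definition qbin :: "complex fps \<Rightarrow> nat \<Rightarrow> int \<Rightarrow> complex fps" where
  "qbin Q n j = qpoch Q (2 * n) * qpoch_inv Q (int n - j) * qpoch_inv Q (int n + j)"

lemma one_minus_zero_power_prod: "(\<Prod>i=1..n. 1 - (0::complex) ^ i) = 1"
  by (rule prod.neutral) auto

lemma qpoch_Suc: "qpoch Q (Suc n) = qpoch Q n * (1 - Q ^ Suc n)"
  by (simp add: qpoch_def)

lemma qpoch_unit:
  assumes "fps_nth Q 0 = 0" shows "fps_nth (qpoch Q n) 0 = 1"
  using assms one_minus_zero_power_prod[of n] by (simp add: qpoch_def fps_nth_prod_0 fps_nth_power_0)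

lemma qpoch_inverse: "fps_nth Q 0 = 0 \<Longrightarrow> qpoch Q n * inverse (qpoch Q n) = 1"
  by (intro inverse_mult_eq_1') (simp add: qpoch_unit)

lemma qpoch_inv_pred:
  assumes "fps_nth Q 0 = 0" "m \<ge> 0"
  shows "qpoch_inv Q (m - 1) = (1 - Q ^ nat m) * qpoch_inv Q m"
proof (cases "m = 0")
  case False
  obtain n where n: "m = int (Suc n)" using assms(2) False
    by (metis not0_implies_Suc of_nat_0 zero_le_imp_eq_int)
  have "qpoch Q n * inverse (qpoch Q n) = 1" "qpoch Q n * (1 - Q ^ Suc n) * inverse (qpoch Q (Suc n)) = 1"
    using qpoch_inverse[OF assms(1)] qpoch_Suc by metis+
  then have "inverse (qpoch Q n) * (qpoch Q n * (1 - Q ^ Suc n) * inverse (qpoch Q (Suc n)))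
      = inverse (qpoch Q n)" by simp
  then have "(qpoch Q n * inverse (qpoch Q n)) * ((1 - Q ^ Suc n) * inverse (qpoch Q (Suc n)))
      = inverse (qpoch Q n)" by (simp only: mult_ac)
  then have "inverse (qpoch Q n) = (1 - Q ^ Suc n) * inverse (qpoch Q (Suc n))"
    using qpoch_inverse[OF assms(1)] by (simp del: power_Suc)
  moreover have "nat m = Suc n" "nat (m - 1) = n" "m - 1 \<ge> 0" using n by auto
  ultimately show ?thesis using n assms(2) by (simp add: qpoch_inv_def del: power_Suc)
qed (simp add: qpoch_inv_def)

text \<open>The polynomial identity left over from \<open>qbin_rec\<close> after the common factor
  is removed, with A = Q^a, B = Q^b, x = Q^(a-1), y = Q^(b-1), P = Q^(a+b-1). The equation A y = P
  fails for the truncated exponent b - 1 at b = 0, but there B = 1; hence the hypotheses carry the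
  factors 1 - B and 1 - A.\<close>

lemma qbin_rec_aux:
  fixes A B P x y :: "'a::comm_ring_1"
  assumes "(1 - B) * (A * y) = (1 - B) * P" "(1 - A) * (B * x) = (1 - A) * P"
  shows "(1 + P) * (1 - A) * (1 - B) + A * (1 - y) * (1 - B) + B * (1 - x) * (1 - A) = (1 - P) * (1 - A * B)"
proof -
  have "(1 + P) * (1 - A) * (1 - B) + A * (1 - y) * (1 - B) + B * (1 - x) * (1 - A) =
    (1 + P) * (1 - A) * (1 - B) + A * (1 - B) + B * (1 - A) - (1 - B) * (A * y) - (1 - A) * (B * x)"
    by (simp add: algebra_simps)
  then show ?thesis unfolding assms by (simp add: algebra_simps)
qed

text \<open>Two steps of the q-Pascal rule at once, because the centred coefficient passes from 2n
  to 2n + 2. The bound on j makes both exponents on the right untruncated.\<close>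

lemma qbin_rec:
  assumes Q: "fps_nth Q 0 = 0" and j: "\<bar>j\<bar> \<le> int n + 1"
  shows "qbin Q (Suc n) j = (1 + Q ^ (2 * n + 1)) * qbin Q n j
    + Q ^ nat (int n - j + 1) * qbin Q n (j - 1) + Q ^ nat (int n + j + 1) * qbin Q n (j + 1)"
proof -
  define a b where "a = nat (int n + 1 - j)" and "b = nat (int n + 1 + j)"
  have ab: "int n + 1 - j = int a" "int n + 1 + j = int b" "a + b = 2 * n + 2"
    using j by (auto simp: a_def b_def)
  define A B where "A = Q ^ a" and "B = Q ^ b"
  \<comment> \<open>R contains the inverses with the largest indices, so
    \<open>qpoch_inv_pred\<close> writes all four coefficients as R times a polynomial in Q.\<close>
  define R where "R = qpoch Q (2 * n) * qpoch_inv Q (int a) * qpoch_inv Q (int b)"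
  have pa: "qpoch_inv Q (int a - 1) = (1 - A) * qpoch_inv Q (int a)"
    using qpoch_inv_pred[OF Q, of "int a"] by (simp add: A_def)
  have pb: "qpoch_inv Q (int b - 1) = (1 - B) * qpoch_inv Q (int b)"
    using qpoch_inv_pred[OF Q, of "int b"] by (simp add: B_def)
  have pa2: "B * qpoch_inv Q (int a - 2) = B * (1 - Q ^ (a - 1)) * (1 - A) * qpoch_inv Q (int a)"
  proof (cases a)
    case (Suc a')
    then show ?thesis using pa qpoch_inv_pred[OF Q, of "int a'"] by simp
  qed (simp add: qpoch_inv_def A_def)
  have pb2: "A * qpoch_inv Q (int b - 2) = A * (1 - Q ^ (b - 1)) * (1 - B) * qpoch_inv Q (int b)"
  proof (cases b)
    case (Suc b')
    then show ?thesis using pb qpoch_inv_pred[OF Q, of "int b'"] by simp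
  qed (simp add: qpoch_inv_def B_def)
  have AB: "A * B = Q ^ (2 * n + 2)" using ab by (simp add: A_def B_def power_add[symmetric])
  have "(1 - B) * (A * Q ^ (b - 1)) = (1 - B) * Q ^ (2 * n + 1)"
  proof (cases b)
    case (Suc b') then have "a + b' = 2 * n + 1" using ab by simp
    then show ?thesis using Suc by (simp add: A_def power_add[symmetric])
  qed (simp add: B_def)
  moreover have "(1 - A) * (B * Q ^ (a - 1)) = (1 - A) * Q ^ (2 * n + 1)"
  proof (cases a)
    case (Suc a') then have "b + a' = 2 * n + 1" using ab by simp
    then show ?thesis using Suc by (simp add: B_def power_add[symmetric])
  qed (simp add: A_def)
  ultimately have key: "(1 + Q ^ (2*n+1)) * (1 - A) * (1 - B) + A * (1 - Q ^ (b - 1)) * (1 - B)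
      + B * (1 - Q ^ (a - 1)) * (1 - A) = (1 - Q ^ (2*n+1)) * (1 - Q ^ (2*n+2))"
    unfolding AB[symmetric] by (rule qbin_rec_aux)
  have n0: "int (Suc n) - j = int a" "int (Suc n) + j = int b" "2 * Suc n = Suc (Suc (2 * n))"
    "int n - j = int a - 1" "int n + j = int b - 1" using ab by simp_all
  have e: "qbin Q (Suc n) j = (1 - Q ^ (2*n+1)) * (1 - Q ^ (2*n+2)) * R"
    unfolding qbin_def n0(1-3) R_def qpoch_Suc by (simp add: mult_ac)
  have e1: "qbin Q n j = (1 - A) * (1 - B) * R"
    unfolding qbin_def n0(4,5) R_def pa pb by (simp only: mult_ac)
  have n1: "int n - (j - 1) = int a" "int n + (j - 1) = int b - 2" "int n - (j + 1) = int a - 2"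
     "int n + (j + 1) = int b" using ab by linarith+
  have n2: "nat (int n - j + 1) = a" "nat (int n + j + 1) = b" using ab by linarith+
  have e2: "A * qbin Q n (j - 1) = A * (1 - Q ^ (b - 1)) * (1 - B) * R"
  proof -
    have "A * qbin Q n (j - 1) = qpoch Q (2 * n) * qpoch_inv Q (int a) * (A * qpoch_inv Q (int b - 2))"
      unfolding qbin_def n1 by (simp only: mult_ac)
    then show ?thesis unfolding pb2 R_def by (simp only: mult_ac)
  qed
  have e3: "B * qbin Q n (j + 1) = B * (1 - Q ^ (a - 1)) * (1 - A) * R"
  proof -
    have "B * qbin Q n (j + 1) = qpoch Q (2 * n) * qpoch_inv Q (int b) * (B * qpoch_inv Q (int a - 2))"
      unfolding qbin_def n1 by (simp only: mult_ac)
    then show ?thesis unfolding pa2 R_def by (simp only: mult_ac)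
  qed
  show ?thesis unfolding n2 A_def[symmetric] B_def[symmetric] e e1 e2 e3 key[symmetric]
    by (simp add: algebra_simps)
qed

lemma qbin_zero: "\<bar>j\<bar> > int n \<Longrightarrow> qbin Q n j = 0"
  by (auto simp: qbin_def qpoch_inv_def)

lemma qbin_0: "qbin Q 0 0 = 1"
  by (simp add: qbin_def qpoch_inv_def qpoch_def)

text \<open>The terms \<open>T j\<close> play the role of \<open>(-1)^j Q^{j(j-1)/2} X^j\<close>; the multiplied-out recursions
  avoid inverting \<open>X\<close> and \<open>Q\<close>.\<close>

lemma finite_triple_product:
  fixes T :: "int \<Rightarrow> complex fps"
  assumes Q: "fps_nth Q 0 = 0" and XY: "X * Y = Q" and T0: "T 0 = 1"
    and TX: "\<And>j a b. int b = int a - j \<Longrightarrow> Q ^ a * X * T j = - (Q ^ b * T (j + 1))"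
    and TY: "\<And>j a b. int b = int a + j \<Longrightarrow> Q ^ a * Y * T j = - (Q ^ b * T (j - 1))"
  shows "(\<Prod>i<n. (1 - X * Q ^ i) * (1 - Y * Q ^ i)) = (\<Sum>j=-int n..int n. qbin Q n j * T j)"
proof (induction n)
  case 0
  then show ?case by (simp add: qbin_0 T0)
next
  case (Suc n)
  define S where "S = {-int (Suc n)..int (Suc n)}"
  have ext: "(\<Sum>j=-int n..int n. qbin Q n j * T j) = (\<Sum>j\<in>S. qbin Q n j * T j)"
    by (rule sum.mono_neutral_left) (auto simp: S_def qbin_zero)
  have x: "(\<Sum>j=-int n..int n. Q ^ n * X * (qbin Q n j * T j))
     = - (\<Sum>j\<in>S. Q ^ nat (int n - j + 1) * qbin Q n (j - 1) * T j)"
  proof -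
    have "(\<Sum>j=-int n..int n. Q ^ n * X * (qbin Q n j * T j))
       = (\<Sum>j=-int n..int n. - (Q ^ nat (int n - j) * qbin Q n j * T (j + 1)))"
    proof (intro sum.cong refl)
      fix j assume "j \<in> {-int n..int n}"
      then have "Q ^ n * X * T j = - (Q ^ nat (int n - j) * T (j + 1))" by (intro TX) auto
      then have "qbin Q n j * (Q ^ n * X * T j) = qbin Q n j * - (Q ^ nat (int n - j) * T (j + 1))" by simp
      then show "Q ^ n * X * (qbin Q n j * T j) = - (Q ^ nat (int n - j) * qbin Q n j * T (j + 1))"
        by (simp add: mult_ac)
    qed
    also have "\<dots> = (\<Sum>j=1-int n..int n+1. - (Q ^ nat (int n - j + 1) * qbin Q n (j - 1) * T j))"
      by (rule sum.reindex_bij_witness[of _ "\<lambda>j. j - 1" "\<lambda>j. j + 1"]) auto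
    also have "\<dots> = (\<Sum>j\<in>S. - (Q ^ nat (int n - j + 1) * qbin Q n (j - 1) * T j))"
      by (rule sum.mono_neutral_left) (auto simp: S_def qbin_zero)
    finally show ?thesis by (simp add: sum_negf)
  qed
  have y: "(\<Sum>j=-int n..int n. Q ^ n * Y * (qbin Q n j * T j))
     = - (\<Sum>j\<in>S. Q ^ nat (int n + j + 1) * qbin Q n (j + 1) * T j)"
  proof -
    have "(\<Sum>j=-int n..int n. Q ^ n * Y * (qbin Q n j * T j))
       = (\<Sum>j=-int n..int n. - (Q ^ nat (int n + j) * qbin Q n j * T (j - 1)))"
    proof (intro sum.cong refl)
      fix j assume "j \<in> {-int n..int n}"
      then have "Q ^ n * Y * T j = - (Q ^ nat (int n + j) * T (j - 1))" by (intro TY) auto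
      then have "qbin Q n j * (Q ^ n * Y * T j) = qbin Q n j * - (Q ^ nat (int n + j) * T (j - 1))" by simp
      then show "Q ^ n * Y * (qbin Q n j * T j) = - (Q ^ nat (int n + j) * qbin Q n j * T (j - 1))"
        by (simp add: mult_ac)
    qed
    also have "\<dots> = (\<Sum>j=-int n-1..int n-1. - (Q ^ nat (int n + j + 1) * qbin Q n (j + 1) * T j))"
      by (rule sum.reindex_bij_witness[of _ "\<lambda>j. j + 1" "\<lambda>j. j - 1"]) (auto simp: algebra_simps)
    also have "\<dots> = (\<Sum>j\<in>S. - (Q ^ nat (int n + j + 1) * qbin Q n (j + 1) * T j))"
      by (rule sum.mono_neutral_left) (auto simp: S_def qbin_zero)
    finally show ?thesis by (simp add: sum_negf)
  qed
  \<comment> \<open>The new pair of factors produces the three coefficients of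
    \<open>qbin_rec\<close>: the constant part keeps j, multiplication by X raises it and
    multiplication by Y lowers it.\<close>
  have "(1 - X * Q ^ n) * (1 - Y * Q ^ n) = 1 + Q ^ (2 * n + 1) - Q ^ n * X - Q ^ n * Y"
    using XY by (simp add: algebra_simps power_add power_mult power2_eq_square mult_2)
  then have "(\<Prod>i<Suc n. (1 - X * Q ^ i) * (1 - Y * Q ^ i)) =
      (1 + Q ^ (2 * n + 1) - Q ^ n * X - Q ^ n * Y) * (\<Sum>j=-int n..int n. qbin Q n j * T j)"
    by (simp add: Suc mult.commute)
  also have "\<dots> = (1 + Q ^ (2 * n + 1)) * (\<Sum>j\<in>S. qbin Q n j * T j)
      + (\<Sum>j\<in>S. Q ^ nat (int n - j + 1) * qbin Q n (j - 1) * T j)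
      + (\<Sum>j\<in>S. Q ^ nat (int n + j + 1) * qbin Q n (j + 1) * T j)"
  proof -
    have dist: "(p - u - v) * (\<Sum>j=-int n..int n. qbin Q n j * T j) = p * (\<Sum>j=-int n..int n. qbin Q n j * T j)
      - (\<Sum>j=-int n..int n. u * (qbin Q n j * T j)) - (\<Sum>j=-int n..int n. v * (qbin Q n j * T j))" for p u v
      by (simp only: left_diff_distrib sum_distrib_left[symmetric])
    show ?thesis unfolding dist x y unfolding ext by simp
  qed
  also have "\<dots> = (\<Sum>j\<in>S. ((1 + Q ^ (2 * n + 1)) * qbin Q n j
      + Q ^ nat (int n - j + 1) * qbin Q n (j - 1) + Q ^ nat (int n + j + 1) * qbin Q n (j + 1)) * T j)"
    by (simp add: sum_distrib_left sum.distrib algebra_simps)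
  also have "\<dots> = (\<Sum>j\<in>S. qbin Q (Suc n) j * T j)"
    using qbin_rec[OF Q] by (intro sum.cong) (auto simp: S_def)
  finally show ?case by (simp add: S_def)
qed

lemma one_minus_prod_dvd:
  fixes Q :: "complex fps"
  assumes "\<And>i. i \<in> A \<Longrightarrow> i \<ge> m"
  shows "Q ^ m dvd (\<Prod>i\<in>A. 1 - Q ^ i) - 1"
  using assms
proof (induction A rule: infinite_finite_induct)
  case (insert x A)
  have "(\<Prod>i\<in>insert x A. 1 - Q ^ i) - 1 = ((\<Prod>i\<in>A. 1 - Q ^ i) - 1) - Q ^ x * (\<Prod>i\<in>A. 1 - Q ^ i)"
    using insert by (simp add: algebra_simps)
  moreover have "Q ^ m dvd Q ^ x * (\<Prod>i\<in>A. 1 - Q ^ i)" using insert by (simp add: le_imp_power_dvd)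
  ultimately show ?case using insert by (metis dvd_diff insertCI)
qed auto

lemma qpoch_quotient_dvd:
  assumes Q: "fps_nth Q 0 = 0" and "m \<le> n"
  shows "Q ^ Suc m dvd qpoch Q n * qpoch_inv Q (int m) - 1"
proof -
  have "{1..n} = {1..m} \<union> {m<..n}" using assms by auto
  then have "qpoch Q n = qpoch Q m * (\<Prod>i\<in>{m<..n}. 1 - Q ^ i)"
    unfolding qpoch_def by (simp add: prod.union_disjoint[of "{Suc 0..m}"] Int_def)
  then have "qpoch Q n * qpoch_inv Q (int m) = (\<Prod>i\<in>{m<..n}. 1 - Q ^ i)"
    using qpoch_inverse[OF Q, of m] by (simp add: qpoch_inv_def algebra_simps)
  then show ?thesis using one_minus_prod_dvd[of "{m<..n}" "Suc m" Q] by auto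
qed

text \<open>Multiplied by (Q; Q)_n the Gaussian binomial tends Q-adically to 1, but only to order n
  - |j| + 1. The loss of |j| is made up in \<open>triple_product_approx\<close>, where the term T j
  is itself divisible by Q^(|j|-1).\<close>

lemma qbin_limit_dvd:
  assumes Q: "fps_nth Q 0 = 0" and j: "\<bar>j\<bar> \<le> int n"
  shows "Q ^ Suc (n - nat \<bar>j\<bar>) dvd qpoch Q n * qbin Q n j - 1"
proof -
  define a where "a = nat \<bar>j\<bar>"
  have a: "a \<le> n" "\<bar>j\<bar> = int a" using j by (auto simp: a_def)
  define u v where "u = qpoch Q n * qpoch_inv Q (int (n - a))"
    and "v = qpoch Q (2 * n) * qpoch_inv Q (int (n + a))"
  have "qpoch Q n * qbin Q n j = u * v"
  proof (cases "j \<ge> 0")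
    case True then have e: "int n - j = int (n - a)" "int n + j = int (n + a)" using a by auto
    show ?thesis unfolding qbin_def u_def v_def e by (simp only: mult_ac)
  next
    case False then have e: "int n - j = int (n + a)" "int n + j = int (n - a)" using a by auto
    show ?thesis unfolding qbin_def u_def v_def e by (simp only: mult_ac)
  qed
  moreover have "Q ^ Suc (n - a) dvd u - 1" unfolding u_def by (rule qpoch_quotient_dvd[OF Q]) simp
  moreover have "Q ^ Suc (n + a) dvd v - 1" unfolding v_def by (rule qpoch_quotient_dvd[OF Q]) (use a in simp)
  then have "Q ^ Suc (n - a) dvd v - 1" by (rule dvd_trans[rotated]) (simp add: le_imp_power_dvd del: power_Suc)
  ultimately have "Q ^ Suc (n - a) dvd (u - 1) * v + (v - 1)" "qpoch Q n * qbin Q n j = u * v"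
    by (auto intro!: dvd_add dvd_mult2 simp del: power_Suc)
  then show ?thesis unfolding a_def[symmetric] by (simp add: algebra_simps)
qed

text \<open>The error is measured in powers of Q instead of \<open>fps_X\<close>, so that one
  statement serves both nome \<open>fps_X\<close> and nome \<open>fps_X ^ (2 * c)\<close>.\<close>

lemma triple_product_approx:
  fixes T :: "int \<Rightarrow> complex fps"
  assumes Q: "fps_nth Q 0 = 0" and XY: "X * Y = Q" and T0: "T 0 = 1"
    and TX: "\<And>j a b. int b = int a - j \<Longrightarrow> Q ^ a * X * T j = - (Q ^ b * T (j + 1))"
    and TY: "\<And>j a b. int b = int a + j \<Longrightarrow> Q ^ a * Y * T j = - (Q ^ b * T (j - 1))"
    and Tdvd: "\<And>j. Q ^ (nat \<bar>j\<bar> - 1) dvd T j"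
  shows "Q ^ n dvd qpoch Q n * (\<Prod>i<n. (1 - X * Q ^ i) * (1 - Y * Q ^ i)) - (\<Sum>j=-int n..int n. T j)"
proof -
  have "Q ^ n dvd (qpoch Q n * qbin Q n j - 1) * T j" if "j \<in> {-int n..int n}" for j
  proof -
    have j: "\<bar>j\<bar> \<le> int n" using that by auto
    have "Q ^ (Suc (n - nat \<bar>j\<bar>) + (nat \<bar>j\<bar> - 1)) dvd (qpoch Q n * qbin Q n j - 1) * T j"
      unfolding power_add by (intro mult_dvd_mono qbin_limit_dvd Q j Tdvd)
    then show ?thesis by (rule dvd_trans[rotated]) (use j in \<open>intro le_imp_power_dvd, linarith\<close>)
  qed
  then have "Q ^ n dvd (\<Sum>j=-int n..int n. (qpoch Q n * qbin Q n j - 1) * T j)" by (rule dvd_sum)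
  also have "\<dots> = qpoch Q n * (\<Sum>j=-int n..int n. qbin Q n j * T j) - (\<Sum>j=-int n..int n. T j)"
    by (simp add: sum_distrib_left sum_subtractf algebra_simps)
  finally show ?thesis using finite_triple_product[where T = T and X = X and Y = Y and Q = Q, OF Q XY T0 TX TY]
    by simp
qed

subsection \<open>Theta functions\<close>

text \<open>\<open>A k n\<close> is the coefficient of x^k z^n in a power series in x over Laurent
  polynomials in z. The index k is an integer, with entries 0 for k < 0, so that the shifts by
  quasi-periodicity need no case distinction.\<close>

definition coeff_array :: "(int \<Rightarrow> int \<Rightarrow> complex) \<Rightarrow> bool" where
  "coeff_array A \<longleftrightarrow> (\<forall>k n. k < 0 \<longrightarrow> A k n = 0) \<and> (\<forall>k. finite {n. A k n \<noteq> 0})"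

definition laurent_eval :: "(int \<Rightarrow> int \<Rightarrow> complex) \<Rightarrow> complex \<Rightarrow> complex fps" where
  "laurent_eval A z = Abs_fps (\<lambda>k. \<Sum>n | A (int k) n \<noteq> 0. A (int k) n * z powi n)"

text \<open>The recursion \<open>A (k + n + c) (n + r) = \<kappa> * A k n\<close> is the coefficient form of the
  quasi-periodicity \<open>F (q z) = \<kappa> q\<^sup>-\<^sup>c z\<^sup>-\<^sup>r F z\<close>.\<close>

definition theta_like :: "int \<Rightarrow> int \<Rightarrow> complex \<Rightarrow> (complex \<Rightarrow> complex fps) \<Rightarrow> bool" where
  "theta_like r c \<kappa> F \<longleftrightarrow> (\<exists>A. coeff_array A \<and> (\<forall>k n. A (k + n + c) (n + r) = \<kappa> * A k n) \<and>
     (\<forall>z. z \<noteq> 0 \<longrightarrow> F z = laurent_eval A z))"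

lemma laurent_eval_nth:
  assumes "finite S" "\<And>n. A (int k) n \<noteq> 0 \<Longrightarrow> n \<in> S"
  shows "fps_nth (laurent_eval A z) k = (\<Sum>n\<in>S. A (int k) n * z powi n)"
  unfolding laurent_eval_def using assms by (auto intro!: sum.mono_neutral_left)

lemma coeff_array_bound:
  assumes "coeff_array A"
  obtains L :: int where "L \<ge> 0" "\<And>i n. i \<le> k \<Longrightarrow> A i n \<noteq> 0 \<Longrightarrow> \<bar>n\<bar> \<le> L"
proof -
  define S where "S = (\<Union>i\<in>{0..k}. {n. A i n \<noteq> 0})"
  define L where "L = Max (insert 0 (abs ` S))"
  have S: "finite S" using assms by (auto simp: S_def coeff_array_def)
  have "0 \<le> L" unfolding L_def using S by (intro Max_ge) auto
  moreover have "\<bar>n\<bar> \<le> L" if "i \<le> k" "A i n \<noteq> 0" for i n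
  proof -
    have "i \<ge> 0" using assms that by (force simp: coeff_array_def)
    then have "n \<in> S" using that by (auto simp: S_def)
    then show ?thesis unfolding L_def using S by (intro Max_ge) auto
  qed
  ultimately show ?thesis using that by blast
qed

text \<open>Degrees add and multipliers multiply. On coefficients, the shift of the product acts on
  a term of the Cauchy product by shifting only its left index pair; the right pair, being a
  difference, is then shifted by the rule of the second factor. Nonzero multipliers make this a
  bijection of supports.\<close>

lemma theta_like_mult:
  assumes "theta_like r c \<kappa> F" "theta_like s d \<mu> G" "\<kappa> \<noteq> 0" "\<mu> \<noteq> 0"
  shows "theta_like (r + s) (c + d) (\<kappa> * \<mu>) (\<lambda>z. F z * G z)"
proof -
  obtain A where A: "coeff_array A" "\<And>k n. A (k + n + c) (n + r) = \<kappa> * A k n"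
    "\<And>z. z \<noteq> 0 \<Longrightarrow> F z = laurent_eval A z" using assms(1) unfolding theta_like_def by blast
  obtain B where B: "coeff_array B" "\<And>k n. B (k + n + d) (n + s) = \<mu> * B k n"
    "\<And>z. z \<noteq> 0 \<Longrightarrow> G z = laurent_eval B z" using assms(2) unfolding theta_like_def by blast
  define g where "g k n p = A (fst p) (snd p) * B (k - fst p) (n - snd p)" for k n p
  \<comment> \<open>Summing over the support, not over a box, makes the behaviour of C under the
    shift visible as a reindexing. \<open>Cbox\<close> supplies a finite rectangle where one is
    wanted.\<close>
  define C where "C k n = (\<Sum>p | g k n p \<noteq> 0. g k n p)" for k n
  have neg: "A k n = 0" "B k n = 0" if "k < 0" for k n
    using A(1) B(1) that by (auto simp: coeff_array_def)
  have Cneg: "C k n = 0" if "k < 0" for k n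
  proof -
    have "g k n p = 0" for p using neg[of "fst p"] neg[of "k - fst p"] that
      by (cases "fst p < 0") (auto simp: g_def)
    then show ?thesis by (simp add: C_def)
  qed
  have box: "\<exists>L\<ge>0. (\<forall>i\<le>k. \<forall>n. A i n \<noteq> 0 \<longrightarrow> \<bar>n\<bar> \<le> L) \<and> (\<forall>i\<le>k. \<forall>n. B i n \<noteq> 0 \<longrightarrow> \<bar>n\<bar> \<le> L)" for k
  proof -
    obtain L1 :: int where L1: "L1 \<ge> 0" "\<And>i n. i \<le> k \<Longrightarrow> A i n \<noteq> 0 \<Longrightarrow> \<bar>n\<bar> \<le> L1"
      using coeff_array_bound[OF A(1), of k] by blast
    obtain L2 :: int where L2: "L2 \<ge> 0" "\<And>i n. i \<le> k \<Longrightarrow> B i n \<noteq> 0 \<Longrightarrow> \<bar>n\<bar> \<le> L2"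
      using coeff_array_bound[OF B(1), of k] by blast
    show ?thesis using L1 L2 by (intro exI[of _ "max L1 L2"]) (auto simp: le_max_iff_disj)
  qed
  have Cbox: "C k n = (\<Sum>i=0..k. \<Sum>m=-L..L. A i m * B (k - i) (n - m))"
    if "\<forall>i\<le>k. \<forall>n. A i n \<noteq> 0 \<longrightarrow> \<bar>n\<bar> \<le> L" for k n L
  proof -
    have "C k n = sum (g k n) ({0..k} \<times> {-L..L})"
      unfolding C_def
    proof (rule sum.mono_neutral_left)
      show "{p. g k n p \<noteq> 0} \<subseteq> {0..k} \<times> {-L..L}"
      proof
        fix p assume "p \<in> {p. g k n p \<noteq> 0}"
        then have *: "A (fst p) (snd p) \<noteq> 0" "B (k - fst p) (n - snd p) \<noteq> 0" by (auto simp: g_def)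
        then have "\<not> fst p < 0" "\<not> k - fst p < 0" using neg by blast+
        moreover from this have "fst p \<le> k" by simp
        then have "\<bar>snd p\<bar> \<le> L" using that *(1) by blast
        ultimately show "p \<in> {0..k} \<times> {-L..L}" by (cases p) auto
      qed
    qed auto
    also have "\<dots> = (\<Sum>i=0..k. \<Sum>m=-L..L. A i m * B (k - i) (n - m))"
      by (simp add: sum.cartesian_product g_def case_prod_beta)
    finally show ?thesis .
  qed
  have Csupp: "\<bar>n\<bar> \<le> 2 * L" if "C k n \<noteq> 0" "\<forall>i\<le>k. \<forall>n. A i n \<noteq> 0 \<longrightarrow> \<bar>n\<bar> \<le> L"
    "\<forall>i\<le>k. \<forall>n. B i n \<noteq> 0 \<longrightarrow> \<bar>n\<bar> \<le> L" for k n L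
  proof -
    have "\<exists>p. g k n p \<noteq> 0"
    proof (rule ccontr)
      assume "\<not> ?thesis" then have "{p. g k n p \<noteq> 0} = {}" by blast
      then have "C k n = 0" by (simp only: C_def sum.empty)
      then show False using that by simp
    qed
    then obtain p where *: "A (fst p) (snd p) \<noteq> 0" "B (k - fst p) (n - snd p) \<noteq> 0" by (auto simp: g_def)
    then have "\<not> fst p < 0" "\<not> k - fst p < 0" using neg by blast+
    then have "fst p \<le> k" "k - fst p \<le> k" by simp_all
    then have "\<bar>snd p\<bar> \<le> L" "\<bar>n - snd p\<bar> \<le> L" using that(2,3) * by blast+
    then show ?thesis by linarith
  qed
  have "coeff_array C"
    unfolding coeff_array_def
  proof (intro conjI allI impI)
    fix k
    obtain L where L: "(\<forall>i\<le>k. \<forall>n. A i n \<noteq> 0 \<longrightarrow> \<bar>n\<bar> \<le> L)" "(\<forall>i\<le>k. \<forall>n. B i n \<noteq> 0 \<longrightarrow> \<bar>n\<bar> \<le> L)"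
      using box[of k] by blast
    have "{n. C k n \<noteq> 0} \<subseteq> {- (2 * L)..2 * L}"
    proof
      fix n assume "n \<in> {n. C k n \<noteq> 0}"
      then have "\<bar>n\<bar> \<le> 2 * L" using Csupp[OF _ L] by blast
      then show "n \<in> {- (2 * L)..2 * L}" by auto
    qed
    then show "finite {n. C k n \<noteq> 0}" by (rule finite_subset) simp
  qed (rule Cneg)
  moreover have "C (k + n + (c + d)) (n + (r + s)) = \<kappa> * \<mu> * C k n" for k n
  proof -
    have g: "g (k + n + (c + d)) (n + (r + s)) (i + m + c, m + r) = \<kappa> * \<mu> * g k n (i, m)" for i m
    proof -
      have "k + n + (c + d) - (i + m + c) = (k - i) + (n - m) + d" "n + (r + s) - (m + r) = (n - m) + s"
        by auto
      then show ?thesis unfolding g_def fst_conv snd_conv by (simp only: A(2) B(2)) simp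
    qed
    have "\<kappa> * \<mu> * C k n = (\<Sum>p | g k n p \<noteq> 0. \<kappa> * \<mu> * g k n p)"
      by (simp add: C_def sum_distrib_left)
    also have "\<dots> = C (k + n + (c + d)) (n + (r + s))"
      unfolding C_def
    proof (rule sum.reindex_bij_witness[of _ "\<lambda>(i, m). (i - (m - r) - c, m - r)" "\<lambda>(i, m). (i + m + c, m + r)"])
      fix p assume "p \<in> {p. g (k + n + (c + d)) (n + (r + s)) p \<noteq> 0}"
      then show "(case p of (i, m) \<Rightarrow> (i - (m - r) - c, m - r)) \<in> {p. g k n p \<noteq> 0}"
        using g[of "fst p - (snd p - r) - c" "snd p - r"] assms(3,4) by (cases p) auto
    qed (use g assms(3,4) in auto)
    finally show ?thesis by simp
  qed
  moreover have "F z * G z = laurent_eval C z" if z: "z \<noteq> 0" for z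
  proof (rule fps_ext)
    fix K :: nat
    obtain L where L: "L \<ge> 0" "\<forall>i\<le>int K. \<forall>n. A i n \<noteq> 0 \<longrightarrow> \<bar>n\<bar> \<le> L"
      "\<forall>i\<le>int K. \<forall>n. B i n \<noteq> 0 \<longrightarrow> \<bar>n\<bar> \<le> L" using box[of "int K"] by blast
    have sA: "n \<in> {-L..L}" if "A i n \<noteq> 0" "i \<le> int K" for i n
    proof -
      have "\<bar>n\<bar> \<le> L" using L(2) that by blast
      then show ?thesis by auto
    qed
    have sB: "n \<in> {-L..L}" if "B i n \<noteq> 0" "i \<le> int K" for i n
    proof -
      have "\<bar>n\<bar> \<le> L" using L(3) that by blast
      then show ?thesis by auto
    qed
    have sC: "n \<in> {-(2*L)..2*L}" if "C (int K) n \<noteq> 0" for n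
      using Csupp[OF that L(2,3)] by auto
    have eA: "fps_nth (laurent_eval A z) i = (\<Sum>n=-L..L. A (int i) n * z powi n)" if "i \<le> K" for i
      using sA that by (intro laurent_eval_nth) auto
    have eB: "fps_nth (laurent_eval B z) i = (\<Sum>n=-L..L. B (int i) n * z powi n)" if "i \<le> K" for i
      using sB that by (intro laurent_eval_nth) auto
    have eC: "fps_nth (laurent_eval C z) K = (\<Sum>n=-(2*L)..2*L. C (int K) n * z powi n)"
      using sC by (intro laurent_eval_nth) auto
    \<comment> \<open>For fixed m in -L, ..., L the window -2L, ..., 2L for n contains every n with
      n - m in -L, ..., L, so the sum over n splits off as a full factor.\<close>
    have inner: "(\<Sum>n=-(2*L)..2*L. A i m * B (int K - i) (n - m) * z powi n)
        = A i m * z powi m * (\<Sum>l=-L..L. B (int K - i) l * z powi l)"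
      if "i \<ge> 0" "m \<in> {-L..L}" for i m
    proof -
      have "(\<Sum>n=-(2*L)..2*L. A i m * B (int K - i) (n - m) * z powi n)
        = (\<Sum>l=-(2*L)-m..2*L-m. A i m * z powi m * (B (int K - i) l * z powi l))"
        by (rule sum.reindex_bij_witness[of _ "\<lambda>l. l + m" "\<lambda>n. n - m"])
           (use z in \<open>auto simp: power_int_diff\<close>)
      also have "\<dots> = (\<Sum>l=-L..L. A i m * z powi m * (B (int K - i) l * z powi l))"
      proof (rule sum.mono_neutral_right)
        show "\<forall>l\<in>{-(2*L)-m..2*L-m} - {-L..L}. A i m * z powi m * (B (int K - i) l * z powi l) = 0"
          using sB[of "int K - i"] that by auto
      qed (use that in auto)
      finally show ?thesis by (simp add: sum_distrib_left)
    qed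
    have "fps_nth (laurent_eval C z) K
        = (\<Sum>n=-(2*L)..2*L. \<Sum>i=0..int K. \<Sum>m=-L..L. A i m * B (int K - i) (n - m) * z powi n)"
      unfolding eC by (simp add: Cbox[OF L(2)] sum_distrib_right)
    also have "\<dots> = (\<Sum>i=0..int K. \<Sum>n=-(2*L)..2*L. \<Sum>m=-L..L. A i m * B (int K - i) (n - m) * z powi n)"
      by (rule sum.swap)
    also have "\<dots> = (\<Sum>i=0..int K. \<Sum>m=-L..L. \<Sum>n=-(2*L)..2*L. A i m * B (int K - i) (n - m) * z powi n)"
      by (intro sum.cong refl sum.swap)
    also have "\<dots> = (\<Sum>i=0..int K. (\<Sum>m=-L..L. A i m * z powi m) * (\<Sum>l=-L..L. B (int K - i) l * z powi l))"
      unfolding sum_distrib_right by (intro sum.cong refl inner) auto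
    also have "\<dots> = (\<Sum>i=0..K. (\<Sum>m=-L..L. A (int i) m * z powi m) * (\<Sum>l=-L..L. B (int (K - i)) l * z powi l))"
      by (rule sum.reindex_bij_witness[of _ int nat]) (auto simp: of_nat_diff)
    also have "\<dots> = fps_nth (F z * G z) K"
      unfolding fps_mult_nth A(3)[OF z] B(3)[OF z] by (intro sum.cong refl) (simp add: eA eB)
    finally show "fps_nth (F z * G z) K = fps_nth (laurent_eval C z) K" ..
  qed
  ultimately show ?thesis unfolding theta_like_def by blast
qed

lemma theta_like_divide:
  assumes "theta_like r c \<kappa> F"
  shows "theta_like r (c + 1) \<kappa> (\<lambda>z. fps_const (inverse z) * F z)"
proof -
  obtain A where A: "coeff_array A" "\<And>k n. A (k + n + c) (n + r) = \<kappa> * A k n"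
    "\<And>z. z \<noteq> 0 \<Longrightarrow> F z = laurent_eval A z" using assms(1) unfolding theta_like_def by blast
  define B where "B k n = A k (n + 1)" for k n
  have img: "{n. B k n \<noteq> 0} = (\<lambda>n. n - 1) ` {n. A k n \<noteq> 0}" for k
    unfolding B_def by (force simp: image_iff intro: exI[of _ "_ + 1"])
  then have "coeff_array B" using A(1) by (auto simp: coeff_array_def B_def)
  moreover have "B (k + n + (c + 1)) (n + r) = \<kappa> * B k n" for k n
    using A(2)[of k "n + 1"] by (simp add: B_def algebra_simps)
  moreover have "fps_const (inverse z) * F z = laurent_eval B z" if "z \<noteq> 0" for z
  proof (rule fps_ext)
    fix K
    have "fps_nth (laurent_eval B z) K = (\<Sum>n | A (int K) n \<noteq> 0. inverse z * (A (int K) n * z powi n))"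
      unfolding laurent_eval_def fps_nth_Abs_fps
      by (rule sum.reindex_bij_witness[of _ "\<lambda>n. n - 1" "\<lambda>n. n + 1"])
         (use that in \<open>auto simp: B_def power_int_add\<close>)
    then show "fps_nth (fps_const (inverse z) * F z) K = fps_nth (laurent_eval B z) K"
      using A(3)[OF that] by (simp add: laurent_eval_def sum_distrib_left)
  qed
  ultimately show ?thesis unfolding theta_like_def by blast
qed

section \<open>Jacobi's theta function and the root factors of type C\<close>

definition tri :: "int \<Rightarrow> int" where "tri m = m * (m - 1) div 2"

lemma two_tri: "2 * tri m = m * (m - 1)"
  by (simp add: tri_def)

lemma tri_add_1: "tri (m + 1) = tri m + m"
  using two_tri[of m] two_tri[of "m + 1"] by (simp add: algebra_simps)

lemma tri_reflect: "tri (1 - m) = tri m"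
  using two_tri[of m] two_tri[of "1 - m"] by (simp add: algebra_simps)

lemma tri_ge: "\<bar>m\<bar> \<le> tri m + 1" "tri m \<ge> 0"
proof -
  have "0 \<le> tri (int n) \<and> int n \<le> tri (int n) + 1" for n
  proof (induction n)
    case (Suc n)
    then show ?case using tri_add_1[of "int n"] by (cases n) (auto simp: algebra_simps)
  qed (simp add: tri_def)
  note * = this
  have "0 \<le> tri m \<and> \<bar>m\<bar> \<le> tri m + 1"
  proof (cases "m \<ge> 0")
    case True then show ?thesis using *[of "nat m"] by simp
  next
    case False then show ?thesis using *[of "nat (1 - m)"] by (simp add: tri_reflect)
  qed
  then show "\<bar>m\<bar> \<le> tri m + 1" "tri m \<ge> 0" by auto
qed

lemma finite_tri: "finite {m. tri m = k}"
proof (rule finite_subset)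
  show "{m. tri m = k} \<subseteq> {-(k+1)..k+1}"
  proof
    fix m assume "m \<in> {m. tri m = k}"
    then show "m \<in> {-(k+1)..k+1}" using tri_ge(1)[of m] by auto
  qed
qed simp

text \<open>Jacobi's theta function, the sum of (-x)^m X^(m(m-1)/2) over all integers m. Its zero at
  x = 1 makes the product side vanish when two variables coincide.\<close>

definition theta :: "complex \<Rightarrow> complex fps" where
  "theta x = Abs_fps (\<lambda>k. \<Sum>m | tri m = int k. (- x) powi m)"

lemma theta_like_theta_mult:
  assumes "w \<noteq> 0" shows "theta_like 1 0 (- w) (\<lambda>z. theta (z * w))"
proof -
  define A where "A k n = (if k = tri n then (- w) powi n else 0)" for k n
  have supp: "{n. A k n \<noteq> 0} = {n. tri n = k}" for k using assms by (auto simp: A_def)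
  have "coeff_array A" unfolding coeff_array_def supp using tri_ge(2) finite_tri
    by (auto simp: A_def not_le[symmetric])
  moreover have "A (k + n + 0) (n + 1) = - w * A k n" for k n
    using assms by (auto simp: A_def tri_add_1 power_int_add)
  moreover have "theta (z * w) = laurent_eval A z" if "z \<noteq> 0" for z
  proof -
    have "(- (z * w)) powi n = (- w) powi n * z powi n" for n
      by (metis mult.commute mult_minus_left power_int_mult_distrib)
    then show ?thesis
      unfolding theta_def laurent_eval_def supp
      by (intro arg_cong[of _ _ Abs_fps] ext sum.cong) (auto simp: A_def)
  qed
  ultimately show ?thesis unfolding theta_like_def by blast
qed

text \<open>Doubling the exponent of z multiplies the degree by four. With n = 2m the increment n
  required by the quasi-periodicity arises from m to m + 2, since
  \<open>tri (m + 2) = tri m + 2 * m + 1\<close>.\<close>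

lemma theta_like_theta_square: "theta_like 4 1 1 (\<lambda>z. theta (z\<^sup>2))"
proof -
  define A :: "int \<Rightarrow> int \<Rightarrow> complex"
    where "A k n = (if even n \<and> k = tri (n div 2) then (- 1) powi (n div 2) else 0)" for k n
  have supp: "{n. A k n \<noteq> 0} = (\<lambda>m. 2 * m) ` {m. tri m = k}" for k by (auto simp: A_def)
  have "coeff_array A" unfolding coeff_array_def supp using tri_ge(2) finite_tri
    by (auto simp: A_def not_le[symmetric])
  moreover have "A (k + n + 1) (n + 4) = 1 * A k n" for k n
  proof (cases "even n")
    case True
    then obtain m where m: "n = 2 * m" by blast
    have "tri (m + 2) = tri m + 2 * m + 1" using tri_add_1[of "m + 1"] tri_add_1[of m] by (simp add: algebra_simps)
    moreover have "(n + 4) div 2 = m + 2" "even (n + 4)" using m by auto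
    ultimately show ?thesis using m by (auto simp: A_def power_int_add)
  qed (auto simp: A_def)
  moreover have "theta (z\<^sup>2) = laurent_eval A z" if "z \<noteq> 0" for z
  proof -
    have p: "(- (z\<^sup>2)) powi m = (- 1) powi m * z powi (2 * m)" for m
      by (metis mult_minus1 power_int_mult power_int_mult_distrib power_int_of_nat of_nat_numeral)
    have "(\<Sum>m | tri m = int k. (- (z\<^sup>2)) powi m) = (\<Sum>n\<in>(\<lambda>m. 2 * m) ` {m. tri m = int k}. A (int k) n * z powi n)" for k
      by (subst sum.reindex) (auto simp: inj_on_def A_def p intro!: sum.cong)
    then show ?thesis unfolding theta_def laurent_eval_def supp by simp
  qed
  ultimately show ?thesis unfolding theta_like_def by blast
qed

lemma theta_reflect:
  assumes "x \<noteq> 0" shows "theta (inverse x) = - fps_const (inverse x) * theta x"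
proof (rule fps_ext)
  fix k
  have "(\<Sum>m | tri m = int k. (- inverse x) powi m) = (\<Sum>m | tri m = int k. - inverse x * (- x) powi m)"
  proof (rule sum.reindex_bij_witness[of _ "\<lambda>m. 1 - m" "\<lambda>m. 1 - m"])
    fix m assume "m \<in> {m. tri m = int k}"
    have "(- inverse x) powi m = (- x) powi (- m)"
      by (metis inverse_minus_eq power_int_inverse power_int_minus)
    moreover have "(- x) powi (1 - m) = - x * (- x) powi (- m)"
      using assms power_int_add[of "- x" 1 "- m"] by simp
    ultimately show "- inverse x * (- x) powi (1 - m) = (- inverse x) powi m" using assms by simp
  qed (auto simp: tri_reflect)
  then show "fps_nth (theta (inverse x)) k = fps_nth (- fps_const (inverse x) * theta x) k"
    by (simp add: theta_def sum_distrib_left sum_negf)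
qed

lemma theta_1: "theta 1 = 0"
  using theta_reflect[of 1] by simp

lemma theta_nth_0: "fps_nth (theta x) 0 = 1 - x"
proof -
  have "m = 0 \<or> m = 1" if "tri m = 0" for m using two_tri[of m] that by simp
  then have "{m. tri m = 0} = {0, 1}" by (auto simp: tri_def)
  then show ?thesis by (simp add: theta_def)
qed

text \<open>\<open>chi\<close> and \<open>psi\<close> are the theta analogues of the long and the
  short root factors of type C. The monomial 1/z makes \<open>chi\<close> odd under inversion, and
  \<open>psi\<close> even under inversion of z and antisymmetric in its two arguments.\<close>

definition chi :: "complex \<Rightarrow> complex fps" where
  "chi z = fps_const (inverse z) * theta (z\<^sup>2)"

definition psi :: "complex \<Rightarrow> complex \<Rightarrow> complex fps" where
  "psi z w = fps_const (inverse z) * (theta (z * w) * theta (z / w))"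

lemma theta_like_chi: "theta_like 4 2 1 chi"
  using theta_like_divide[OF theta_like_theta_square] unfolding chi_def[abs_def] by simp

lemma theta_like_psi: "w \<noteq> 0 \<Longrightarrow> theta_like 2 1 1 (\<lambda>z. psi z w)"
  using theta_like_divide[OF theta_like_mult[OF theta_like_theta_mult[of w] theta_like_theta_mult[of "inverse w"]]]
  unfolding psi_def[abs_def] by (simp add: divide_inverse)

lemma chi_inverse: "z \<noteq> 0 \<Longrightarrow> chi (inverse z) = - chi z"
proof -
  assume z: "z \<noteq> 0"
  have "theta ((inverse z)\<^sup>2) = - fps_const (inverse (z\<^sup>2)) * theta (z\<^sup>2)"
    using theta_reflect[of "z\<^sup>2"] z by (simp add: power_inverse)
  then have "chi (inverse z) = - (fps_const z * fps_const (inverse (z\<^sup>2))) * theta (z\<^sup>2)"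
    by (simp add: chi_def mult.assoc)
  also have "fps_const z * fps_const (inverse (z\<^sup>2)) = fps_const (inverse z)"
    using z by (simp add: power2_eq_square)
  finally show ?thesis unfolding chi_def by (simp only: mult_minus_left)
qed

lemma psi_inverse:
  assumes "z \<noteq> 0" "w \<noteq> 0" shows "psi (inverse z) w = psi z w"
proof -
  have a: "theta (inverse z * w) = - fps_const (inverse (z / w)) * theta (z / w)"
    using theta_reflect[of "z / w"] assms by (simp add: field_simps)
  have b: "theta (inverse z / w) = - fps_const (inverse (z * w)) * theta (z * w)"
    using theta_reflect[of "z * w"] assms by (simp add: field_simps)
  have "psi (inverse z) w = (fps_const z * fps_const (inverse (z / w)) * fps_const (inverse (z * w)))
     * (theta (z * w) * theta (z / w))"
    unfolding psi_def a b by (simp only: inverse_inverse_eq mult_minus_left mult_minus_right minus_minus mult_ac)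
  also have "fps_const z * fps_const (inverse (z / w)) * fps_const (inverse (z * w)) = fps_const (inverse z)"
    using assms by (simp add: field_simps)
  finally show ?thesis by (simp add: psi_def)
qed

lemma psi_swap:
  assumes "z \<noteq> 0" "w \<noteq> 0" shows "psi w z = - psi z w"
proof -
  have a: "theta (w / z) = - fps_const (inverse (z / w)) * theta (z / w)"
    using theta_reflect[of "z / w"] assms by (simp add: field_simps)
  have "psi w z = - (fps_const (inverse w) * fps_const (inverse (z / w))) * (theta (z * w) * theta (z / w))"
    unfolding psi_def a by (simp only: mult_minus_left mult_minus_right mult_ac)
  also have "fps_const (inverse w) * fps_const (inverse (z / w)) = fps_const (inverse z)"
    using assms by (simp add: field_simps)
  finally show ?thesis unfolding psi_def[of z w] by (simp only: mult_minus_left)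
qed

lemma psi_self: "w \<noteq> 0 \<Longrightarrow> psi w w = 0"
  by (simp add: psi_def theta_1)

text \<open>For |J| = t - 1 the degree is 2(t + 1) and the shift t + 1, the case c = t + 1 of
  \<open>odd_theta_basis\<close>.\<close>

lemma theta_like_chi_psi_prod:
  assumes "finite J" "\<And>j. j \<in> J \<Longrightarrow> w j \<noteq> 0"
  shows "theta_like (4 + 2 * int (card J)) (2 + int (card J)) 1 (\<lambda>z. chi z * (\<Prod>j\<in>J. psi z (w j)))"
  using assms
proof (induction J rule: finite_induct)
  case empty
  then show ?case using theta_like_chi by simp
next
  case (insert j J)
  then have "theta_like (4 + 2 * int (card J) + 2) (2 + int (card J) + 1) (1 * 1)
     (\<lambda>z. (chi z * (\<Prod>j\<in>J. psi z (w j))) * psi z (w j))"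
    by (intro theta_like_mult theta_like_psi) auto
  then show ?case using insert by (simp add: algebra_simps)
qed

subsection \<open>The theta determinant\<close>

text \<open>With n = 2cm + k the exponent of x is (n^2 - k^2)/(4c). So this is the odd theta
  function of degree 2c supported on the residues k and -k modulo 2c, normalised to start at
  x^0.\<close>

definition odd_theta :: "int \<Rightarrow> int \<Rightarrow> complex \<Rightarrow> complex fps" where
  "odd_theta c k z = Abs_fps (\<lambda>K. \<Sum>m | c * m\<^sup>2 + k * m = int K.
     z powi (2 * c * m + k) - z powi (- (2 * c * m + k)))"

text \<open>Makes the coefficient of x^K a finite sum over |m| \<le> K. The bound k < c is sharp:
  for k = c the term m = -1 would have exponent 0.\<close>

lemma quadratic_ge:
  fixes c k m :: int
  assumes "0 < k" "k < c" shows "\<bar>m\<bar> \<le> c * m\<^sup>2 + k * m"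
proof (cases "m = 0")
  case False
  have "\<bar>m\<bar> * 1 \<le> \<bar>m\<bar> * (c * \<bar>m\<bar> - k)"
  proof (intro mult_left_mono)
    have "c * 1 \<le> c * \<bar>m\<bar>" using assms False by (intro mult_left_mono) auto
    then show "1 \<le> c * \<bar>m\<bar> - k" using assms by linarith
  qed simp
  also have "\<dots> = c * m\<^sup>2 - k * \<bar>m\<bar>" by (simp add: algebra_simps power2_eq_square abs_mult[symmetric])
  also have "\<dots> \<le> c * m\<^sup>2 + k * m" using assms(1) by (auto simp: abs_if)
  finally show ?thesis by simp
qed simp

text \<open>Iterating the quasi-periodicity m times in either direction: a coefficient is determined
  by those whose n lies in a single period of length 2c.\<close>

lemma quadratic_shift:
  fixes A :: "int \<Rightarrow> int \<Rightarrow> complex"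
  assumes "\<And>k n. A (k + n + c) (n + 2 * c) = A k n"
  shows "A (j + (c * m\<^sup>2 + k * m)) (2 * c * m + k) = A j k"
proof (induction m rule: int_induct[of _ 0])
  case (step1 m)
  then show ?case using assms[of "j + (c * m\<^sup>2 + k * m)" "2 * c * m + k"]
    by (simp add: algebra_simps power2_eq_square)
next
  case (step2 m)
  then show ?case using assms[of "j + (c * (m - 1)\<^sup>2 + k * (m - 1))" "2 * c * (m - 1) + k"]
    by (simp add: algebra_simps power2_eq_square)
qed simp

lemma odd_theta_nth:
  assumes "0 < k" "k < c" "K \<le> L"
  shows "fps_nth (odd_theta c k z) K = (\<Sum>m\<in>{-int L..int L}.
    if c * m\<^sup>2 + k * m = int K then z powi (2 * c * m + k) - z powi (- (2 * c * m + k)) else 0)"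
proof -
  have "{m. c * m\<^sup>2 + k * m = int K} = {m \<in> {-int L..int L}. c * m\<^sup>2 + k * m = int K}"
  proof -
    have "m \<in> {-int L..int L}" if "c * m\<^sup>2 + k * m = int K" for m
      using quadratic_ge[OF assms(1,2), of m] assms(3) that by auto
    then show ?thesis by blast
  qed
  then show ?thesis unfolding odd_theta_def fps_nth_Abs_fps by (subst sum.inter_filter[symmetric]) auto
qed

text \<open>Apart from 0 and c, the residues modulo 2c fall into c - 1 pairs of opposite
  classes.\<close>

lemma residue_classes_cover:
  fixes c n :: int
  assumes c: "c > 0" and n: "n mod (2 * c) \<noteq> 0" "n mod (2 * c) \<noteq> c"
  shows "\<exists>m. \<exists>k\<in>{1..<c}. n = 2 * c * m + k \<or> n = - (2 * c * m + k)"
proof -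
  define r where "r = n mod (2 * c)"
  have r: "0 < r" "r < 2 * c" "r \<noteq> c" "n = 2 * c * (n div (2 * c)) + r"
    using c n by (auto simp: r_def order.not_eq_order_implies_strict)
  show ?thesis
  proof (cases "r < c")
    case True
    then show ?thesis using r by (intro exI[of _ "n div (2 * c)"] bexI[of _ r]) auto
  next
    case False
    then show ?thesis using r
      by (intro exI[of _ "- (n div (2 * c)) - 1"] bexI[of _ "2 * c - r"]) (auto simp: algebra_simps)
  qed
qed

lemma residue_classes_unique:
  fixes c m m' k k' :: int
  assumes "c > 0" "k \<in> {1..<c}" "k' \<in> {1..<c}"
  shows "2 * c * m + k = 2 * c * m' + k' \<Longrightarrow> m = m' \<and> k = k'"
    and "2 * c * m + k \<noteq> - (2 * c * m' + k')"
proof -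
  assume e: "2 * c * m + k = 2 * c * m' + k'"
  have "(2 * c * m + k) mod (2 * c) = k" "(2 * c * m' + k') mod (2 * c) = k'" using assms by auto
  then have "k = k'" using e by simp
  then show "m = m' \<and> k = k'" using e assms by simp
next
  show "2 * c * m + k \<noteq> - (2 * c * m' + k')"
  proof
    assume "2 * c * m + k = - (2 * c * m' + k')"
    then have e: "k + k' = 2 * c * (- m - m')" by (simp add: algebra_simps)
    then have "(k + k') mod (2 * c) = 0" by simp
    moreover have "(k + k') mod (2 * c) = k + k'" using assms by (intro mod_pos_pos_trivial) auto
    ultimately show False using assms by simp
  qed
qed

text \<open>Quasi-periodicity leaves free the coefficients with n in one period of 2c residues.
  Oddness kills the residues 0 and c and identifies n with -n up to sign, so c - 1 of them remain;
  they are the C k.\<close>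

lemma odd_theta_basis:
  assumes f: "theta_like (2 * c) c 1 f" and c: "c > 0"
    and odd: "\<And>z. z \<noteq> 0 \<Longrightarrow> f (inverse z) = - f z"
  shows "\<exists>C. \<forall>z. z \<noteq> 0 \<longrightarrow> f z = (\<Sum>k=1..<c. C k * odd_theta c k z)"
proof -
  obtain A0 where A0: "coeff_array A0" "\<And>k n. A0 (k + n + c) (n + 2 * c) = A0 k n"
    "\<And>z. z \<noteq> 0 \<Longrightarrow> f z = laurent_eval A0 z" using f unfolding theta_like_def by auto
  \<comment> \<open>\<open>A0\<close> is known only through the values of f, so its own oddness is
    not at hand; its odd part represents the same function.\<close>
  define A where "A k n = (A0 k n - A0 k (- n)) / 2" for k n
  have Aodd: "A k (- n) = - A k n" for k n by (simp add: A_def diff_divide_distrib)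
  have A0': "A0 (k + n + c) (- (n + 2 * c)) = A0 k (- n)" for k n
    using A0(2)[of "k + n + c" "- (n + 2 * c)"] by (simp add: algebra_simps)
  have Ashift: "A (k + n + c) (n + 2 * c) = A k n" for k n
    unfolding A_def A0' A0(2) ..
  have Aneg: "A k n = 0" if "k < 0" for k n using A0(1) that by (simp add: A_def coeff_array_def)
  note Aquad = quadratic_shift[of A, OF Ashift]
  have A_0: "A k 0 = 0" for k using Aodd[of k 0] by simp
  \<comment> \<open>The shift carries n = -c to n = c without changing k, and oddness gives the
    opposite sign.\<close>
  have A_c: "A k c = 0" for k using Aodd[of k c] Ashift[of k "- c"] by simp
  have A_res: "n mod (2 * c) \<noteq> 0 \<and> n mod (2 * c) \<noteq> c" if "A k n \<noteq> 0" for k n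
  proof -
    define m r where "m = n div (2 * c)" and "r = n mod (2 * c)"
    have "A (k - (c * m\<^sup>2 + r * m)) r = A k n"
      using Aquad[of "k - (c * m\<^sup>2 + r * m)" m r] by (simp add: m_def r_def)
    then have "r \<noteq> 0" "r \<noteq> c" using that A_0 A_c by auto
    then show ?thesis unfolding r_def by blast
  qed
  define C where "C k = Abs_fps (\<lambda>j. A (int j) k)" for k
  have "f z = (\<Sum>k=1..<c. C k * odd_theta c k z)" if z: "z \<noteq> 0" for z
  proof (rule fps_ext)
    fix K :: nat
    obtain L where L: "L \<ge> 0" "\<And>i n. i \<le> int K \<Longrightarrow> A0 i n \<noteq> 0 \<Longrightarrow> \<bar>n\<bar> \<le> L"
      using coeff_array_bound[OF A0(1), of "int K"] by blast
    define S where "S = {-L..L}"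
    have "fps_nth (laurent_eval A0 z) K = (\<Sum>n\<in>S. A0 (int K) n * z powi n)"
      using L by (intro laurent_eval_nth) (force simp: S_def)+
    moreover have "fps_nth (laurent_eval A0 (inverse z)) K = (\<Sum>n\<in>S. A0 (int K) n * inverse z powi n)"
      using L by (intro laurent_eval_nth) (force simp: S_def)+
    moreover have "(\<Sum>n\<in>S. A0 (int K) n * inverse z powi n) = (\<Sum>n\<in>S. A0 (int K) (- n) * z powi n)"
      by (rule sum.reindex_bij_witness[of _ uminus uminus])
         (auto simp: S_def power_int_minus power_int_inverse)
    moreover have "f z = fps_const (1/2) * (f z - f (inverse z))"
    proof -
      have "fps_const (1/2) * (f z - f (inverse z)) = fps_const (1/2) * (fps_const 2 * f z)"
        using odd[OF z] by (simp add: fps_numeral_fps_const[symmetric])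
      also have "\<dots> = fps_const (1/2 * 2) * f z" by (simp only: mult.assoc[symmetric] fps_const_mult)
      finally show ?thesis by simp
    qed
    ultimately have fK: "fps_nth (f z) K = (\<Sum>n\<in>S. A (int K) n * z powi n)"
    proof -
      assume h: "fps_nth (laurent_eval A0 z) K = (\<Sum>n\<in>S. A0 (int K) n * z powi n)"
        "fps_nth (laurent_eval A0 (inverse z)) K = (\<Sum>n\<in>S. A0 (int K) n * inverse z powi n)"
        "(\<Sum>n\<in>S. A0 (int K) n * inverse z powi n) = (\<Sum>n\<in>S. A0 (int K) (- n) * z powi n)"
        "f z = fps_const (1/2) * (f z - f (inverse z))"
      have "fps_nth (f z) K = fps_nth (fps_const (1/2) * (f z - f (inverse z))) K"
        using h(4) by (rule arg_cong)
      also have "\<dots> = 1/2 * (fps_nth (laurent_eval A0 z) K - fps_nth (laurent_eval A0 (inverse z)) K)"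
        using A0(3)[OF z] A0(3)[of "inverse z"] z by simp
      also have "\<dots> = (\<Sum>n\<in>S. A (int K) n * z powi n)"
        unfolding h(1-3) sum_subtractf[symmetric] sum_distrib_left
        by (intro sum.cong refl) (simp add: A_def field_simps)
      finally show ?thesis .
    qed
    define u where "u = (\<lambda>(m, k). 2 * c * m + k)"
    \<comment> \<open>By \<open>quadratic_ge\<close> a coefficient of x^K can only come from |m|
      \<le> K.\<close>
    define I where "I = {-int K..int K} \<times> {1..<c}"
    have supp: "n \<in> u ` I \<union> (\<lambda>p. - u p) ` I" if nz: "A (int K) n \<noteq> 0" for n
    proof -
      obtain m k where mk: "k \<in> {1..<c}" "n = 2 * c * m + k \<or> n = - (2 * c * m + k)"
        using residue_classes_cover[OF c] A_res[OF nz] by metis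
      then have "A (int K) (2 * c * m + k) \<noteq> 0" using nz mk(2) Aodd[of "int K" "2 * c * m + k"] by auto
      then have "A (int K - (c * m\<^sup>2 + k * m)) k \<noteq> 0"
        using Aquad[of "int K - (c * m\<^sup>2 + k * m)" m k] by simp
      then have "int K \<ge> c * m\<^sup>2 + k * m" using Aneg by force
      then have "\<bar>m\<bar> \<le> int K" using quadratic_ge[of k c m] mk by auto
      then have "(m, k) \<in> I" using mk by (auto simp: I_def)
      then show ?thesis using mk(2) unfolding u_def by (auto simp: image_iff intro!: bexI[of _ "(m, k)"])
    qed
    have finI: "finite I" by (simp add: I_def)
    have inj: "inj_on u I" 
    proof (rule inj_onI)
      fix p q assume pq: "p \<in> I" "q \<in> I" "u p = u q"
      have "fst p = fst q \<and> snd p = snd q"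
        by (rule residue_classes_unique(1)[OF c]) (use pq in \<open>auto simp: I_def u_def\<close>)
      then show "p = q" by (simp add: prod_eq_iff)
    qed
    have inj': "inj_on (\<lambda>p. - u p) I" using inj by (auto simp: inj_on_def)
    have disj: "u ` I \<inter> (\<lambda>p. - u p) ` I = {}"

    proof -
      have "u p \<noteq> - u q" if "p \<in> I" "q \<in> I" for p q
        using residue_classes_unique(2)[OF c, of "snd p" "snd q" "fst p" "fst q"] that
        by (auto simp: I_def u_def)
      then show ?thesis by blast
    qed
    have "n \<in> S" if "A (int K) n \<noteq> 0" for n
    proof -
      have "A0 (int K) n \<noteq> 0 \<or> A0 (int K) (- n) \<noteq> 0" using that by (auto simp: A_def)
      then have "\<bar>n\<bar> \<le> L" using L(2)[of "int K" n] L(2)[of "int K" "- n"] by auto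
      then show ?thesis by (auto simp: S_def)
    qed
    then have "fps_nth (f z) K = fps_nth (laurent_eval A z) K"
      unfolding fK by (intro laurent_eval_nth[symmetric]) (simp_all add: S_def)
    also have "\<dots> = (\<Sum>n\<in>u ` I \<union> (\<lambda>p. - u p) ` I. A (int K) n * z powi n)"
      using supp finI by (intro laurent_eval_nth) auto
    also have "\<dots> = (\<Sum>p\<in>I. A (int K) (u p) * z powi u p) + (\<Sum>p\<in>I. A (int K) (- u p) * z powi (- u p))"
      using finI disj by (simp add: sum.union_disjoint sum.reindex inj inj' o_def)
    also have "\<dots> = (\<Sum>p\<in>I. A (int K) (u p) * (z powi u p - z powi (- u p)))"
      by (simp add: Aodd sum_subtractf[symmetric] sum_negf right_diff_distrib)
    also have "\<dots> = (\<Sum>k=1..<c. \<Sum>m=-int K..int K. A (int K) (2 * c * m + k) *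
        (z powi (2 * c * m + k) - z powi (- (2 * c * m + k))))"
      unfolding I_def u_def by (subst sum.swap) (simp add: sum.cartesian_product case_prod_beta)
    also have "\<dots> = (\<Sum>k=1..<c. fps_nth (C k * odd_theta c k z) K)"
    proof (intro sum.cong refl)
      fix k assume k: "k \<in> {1..<c}"
      define g where "g m = z powi (2 * c * m + k) - z powi (- (2 * c * m + k))" for m
      have "fps_nth (C k * odd_theta c k z) K = (\<Sum>j=0..K. A (int j) k *
          (\<Sum>m=-int K..int K. if c * m\<^sup>2 + k * m = int (K - j) then g m else 0))"
        unfolding fps_mult_nth g_def using k
        by (intro sum.cong refl) (simp add: C_def odd_theta_nth[of _ _ _ K])
      also have "\<dots> = (\<Sum>m=-int K..int K. \<Sum>j=0..K. if c * m\<^sup>2 + k * m = int (K - j) then A (int j) k * g m else 0)"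
        unfolding sum_distrib_left by (subst sum.swap) (intro sum.cong refl, auto)
      also have "\<dots> = (\<Sum>m=-int K..int K. A (int K) (2 * c * m + k) * g m)"
      proof (intro sum.cong refl)
        fix m assume "m \<in> {-int K..int K}"
        define e where "e = c * m\<^sup>2 + k * m"
        have e0: "e \<ge> 0" using quadratic_ge[of k c m] k by (auto simp: e_def)
        have Ae: "A (int K) (2 * c * m + k) = A (int K - e) k"
          using Aquad[of "int K - e" m k] by (simp add: e_def)
        show "(\<Sum>j=0..K. if c * m\<^sup>2 + k * m = int (K - j) then A (int j) k * g m else 0)
            = A (int K) (2 * c * m + k) * g m"
        proof (cases "e \<le> int K")
          case True
          have "(\<Sum>j=0..K. if c * m\<^sup>2 + k * m = int (K - j) then A (int j) k * g m else 0)
            = (\<Sum>j=0..K. if j = nat (int K - e) then A (int j) k * g m else 0)"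
            unfolding e_def[symmetric] using True e0 by (intro sum.cong refl) auto
          also have "\<dots> = A (int K - e) k * g m" using True e0 by (subst sum.delta) auto
          finally show ?thesis using Ae by simp
        next
          case False
          then show ?thesis using Ae Aneg[of "int K - e" k] unfolding e_def[symmetric]
            by (auto intro!: sum.neutral)
        qed
      qed
      finally show "(\<Sum>m=-int K..int K. A (int K) (2 * c * m + k) *
        (z powi (2 * c * m + k) - z powi (- (2 * c * m + k)))) = fps_nth (C k * odd_theta c k z) K"
        by (simp add: g_def)
    qed
    finally show "fps_nth (f z) K = fps_nth (\<Sum>k=1..<c. C k * odd_theta c k z) K"
      by (simp add: fps_sum_nth)
  qed
  then show ?thesis by blast
qed

text \<open>Let F be the combination of the functions g with coefficients C. It vanishes at the
  points of all rows other than i, so Cramer's rule gives det (M y) C_k = cof_k F(y), where the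
  cofactors of row i do not depend on y. Inserting this into det (M x) F(y) and expanding along row
  i yields F(x) det (M y). Stating it with products avoids division by a determinant.\<close>

lemma det_replace_row:
  fixes g :: "nat \<Rightarrow> 'b \<Rightarrow> 'a::comm_ring_1"
  assumes i: "i < t" and zero: "\<And>r. r < t \<Longrightarrow> r \<noteq> i \<Longrightarrow> (\<Sum>k<t. C k * g k (z r)) = 0"
  defines "M \<equiv> \<lambda>x. mat t t (\<lambda>(r, k). g k ((z(i := x)) r))"
  shows "det (M x) * (\<Sum>k<t. C k * g k y) = det (M y) * (\<Sum>k<t. C k * g k x)"
proof -
  define cof where "cof k = cofactor (M x) i k" for k
  have M: "M x \<in> carrier_mat t t" for x by (simp add: M_def)
  have del: "mat_delete (M y) i k = mat_delete (M x) i k" for y k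
    by (rule eq_matI) (auto simp: mat_delete_def M_def)
  have cof: "cofactor (M y) i k = cof k" for y k
    unfolding cof_def cofactor_def del[of y k] ..
  have row: "(\<Sum>k<t. C k * M y $$ (r, k)) = (if r = i then \<Sum>k<t. C k * g k y else 0)" if "r < t" for r y
    using that zero[of r] by (auto simp: M_def)
  \<comment> \<open>Cramer's rule: the vector obtained by applying M y to C is concentrated in row
    i, so the adjugate returns only the cofactors of that row.\<close>
  have key: "det (M y) * C k = cof k * (\<Sum>k<t. C k * g k y)" if k: "k < t" for k y
  proof -
    have e: "(\<Sum>r<t. cofactor (M y) r k * M y $$ (r, l)) = (if k = l then det (M y) else 0)" if "l < t" for l
    proof -
      have "(adj_mat (M y) * M y) $$ (k, l) = (det (M y) \<cdot>\<^sub>m 1\<^sub>m t) $$ (k, l)"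
        using adj_mat(3)[OF M] by simp
      then show ?thesis using k that M[of y]
        by (auto simp: adj_mat_def scalar_prod_def lessThan_atLeast0 M_def intro!: sum.cong)
    qed
    have "det (M y) * C k = (\<Sum>l<t. C l * (if k = l then det (M y) else 0))"
      using k by (simp add: if_distrib sum.delta mult.commute cong: if_cong)
    also have "\<dots> = (\<Sum>l<t. \<Sum>r<t. cofactor (M y) r k * (C l * M y $$ (r, l)))"
    proof (intro sum.cong refl)
      fix l assume "l \<in> {..<t}"
      then show "C l * (if k = l then det (M y) else 0) = (\<Sum>r<t. cofactor (M y) r k * (C l * M y $$ (r, l)))"
        using e[of l, symmetric] by (simp only: lessThan_iff sum_distrib_left mult_ac)
    qed
    also have "\<dots> = (\<Sum>r<t. cofactor (M y) r k * (\<Sum>l<t. C l * M y $$ (r, l)))"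
      by (subst sum.swap) (simp add: sum_distrib_left)
    also have "\<dots> = (\<Sum>r<t. if r = i then cofactor (M y) r k * (\<Sum>k<t. C k * g k y) else 0)"
      by (intro sum.cong refl) (simp add: row)
    also have "\<dots> = cof k * (\<Sum>k<t. C k * g k y)" using i by (simp add: cof)
    finally show ?thesis .
  qed
  have "det (M x) * (\<Sum>k<t. C k * g k y) = (\<Sum>k<t. (det (M x) * C k) * g k y)"
    by (simp add: sum_distrib_left mult.assoc)
  also have "\<dots> = (\<Sum>k<t. (\<Sum>k<t. C k * g k x) * (cof k * g k y))"
  proof (intro sum.cong refl)
    fix k assume "k \<in> {..<t}"
    then have "det (M x) * C k * g k y = cof k * (\<Sum>k<t. C k * g k x) * g k y" using key[of k x] by simp
    then show "det (M x) * C k * g k y = (\<Sum>k<t. C k * g k x) * (cof k * g k y)" by (simp only: mult_ac)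
  qed
  also have "\<dots> = (\<Sum>k<t. C k * g k x) * (\<Sum>k<t. cof k * g k y)"
    by (rule sum_distrib_left[symmetric])
  also have "(\<Sum>k<t. cof k * g k y) = det (M y)"
    using laplace_expansion_row[OF M i, of y] cof by (simp add: M_def i mult.commute)
  finally show ?thesis by (simp add: mult.commute)
qed

definition theta_det :: "nat \<Rightarrow> (nat \<Rightarrow> complex) \<Rightarrow> complex fps" where
  "theta_det t z = det (mat t t (\<lambda>(i, j). odd_theta (int t + 1) (int j + 1) (z i)))"

definition theta_prod :: "nat \<Rightarrow> (nat \<Rightarrow> complex) \<Rightarrow> complex fps" where
  "theta_prod t z = (\<Prod>i<t. chi (z i)) * (\<Prod>i<t. \<Prod>j<i. psi (z i) (z j))"

text \<open>The constant coefficient of \<open>theta_prod\<close>: up to sign, the Weyl denominator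
  of type C.\<close>

definition weyl_prod :: "nat \<Rightarrow> (nat \<Rightarrow> complex) \<Rightarrow> complex" where
  "weyl_prod t z = (\<Prod>i<t. inverse (z i) * (1 - (z i)\<^sup>2)) *
     (\<Prod>i<t. \<Prod>j<i. inverse (z i) * ((1 - z i * z j) * (1 - z i / z j)))"

lemma theta_det_cong: "(\<And>i. i < t \<Longrightarrow> z i = w i) \<Longrightarrow> theta_det t z = theta_det t w"
  unfolding theta_det_def by (intro arg_cong[of _ _ det] eq_matI) auto

lemma theta_prod_cong: "(\<And>i. i < t \<Longrightarrow> z i = w i) \<Longrightarrow> theta_prod t z = theta_prod t w"
  unfolding theta_prod_def by (intro arg_cong2[of _ _ _ _ "(*)"] prod.cong) auto

lemma theta_prod_nth_0: "fps_nth (theta_prod t z) 0 = weyl_prod t z"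
  by (simp add: theta_prod_def weyl_prod_def fps_nth_prod_0 chi_def psi_def theta_nth_0)

text \<open>Isolates the variable with index i in a product of Vandermonde type. Pairs that have i
  in second place are turned round by antisymmetry, and the sign goes into R. Stated for arbitrary f
  and g because it is applied to \<open>theta_prod\<close> and again to
  \<open>weyl_dim\<close>.\<close>

lemma antisymmetric_prod_one_variable:
  fixes f :: "'b \<Rightarrow> 'a::comm_ring_1" and g :: "'b \<Rightarrow> 'b \<Rightarrow> 'a"
  assumes i: "i < (t :: nat)" and g: "\<And>x j. P x \<Longrightarrow> j < t \<Longrightarrow> g (z j) x = - g x (z j)"
  shows "\<exists>R. \<forall>x. P x \<longrightarrow> (\<Prod>a<t. f ((z(i := x)) a)) * (\<Prod>a<t. \<Prod>b<a. g ((z(i := x)) a) ((z(i := x)) b))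
    = R * (f x * (\<Prod>j\<in>{..<t} - {i}. g x (z j)))"
proof -
  define S where "S = (SIGMA a:{..<t}. {..<a})"
  define S0 where "S0 = {p \<in> S. fst p \<noteq> i \<and> snd p \<noteq> i}"
  define R where "R = (\<Prod>a\<in>{..<t} - {i}. f (z a)) * (\<Prod>p\<in>S0. g (z (fst p)) (z (snd p))) * (- 1) ^ card {i<..<t}"
  have "(\<Prod>a<t. f ((z(i := x)) a)) * (\<Prod>a<t. \<Prod>b<a. g ((z(i := x)) a) ((z(i := x)) b))
    = R * (f x * (\<Prod>j\<in>{..<t} - {i}. g x (z j)))" if x: "P x" for x
  proof -
    define w where "w = z(i := x)"
    have c: "(\<Prod>a<t. f (w a)) = f x * (\<Prod>a\<in>{..<t} - {i}. f (z a))"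
      using i by (subst prod.remove[of _ i]) (auto simp: w_def)
    have S: "S = S0 \<union> ({i} \<times> {..<i} \<union> {i<..<t} \<times> {i})" using i by (auto simp: S_def S0_def)
    have "finite S" by (simp add: S_def)
    then have fin: "finite S0" by (simp add: S0_def)
    have "(\<Prod>a<t. \<Prod>b<a. g (w a) (w b)) = (\<Prod>p\<in>S. g (w (fst p)) (w (snd p)))"
      unfolding S_def by (subst prod.Sigma) (auto simp: case_prod_beta)
    also have "\<dots> = (\<Prod>p\<in>S0. g (w (fst p)) (w (snd p))) *
        ((\<Prod>p\<in>{i} \<times> {..<i}. g (w (fst p)) (w (snd p))) * (\<Prod>p\<in>{i<..<t} \<times> {i}. g (w (fst p)) (w (snd p))))"
    proof -
      have "S0 \<inter> ({i} \<times> {..<i} \<union> {i<..<t} \<times> {i}) = {}" "({i} \<times> {..<i}) \<inter> ({i<..<t} \<times> {i}) = {}"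
        by (auto simp: S0_def)
      then show ?thesis unfolding S using fin by (simp only: prod.union_disjoint finite_Un finite_SigmaI
        finite_lessThan finite_greaterThanLessThan finite.intros simp_thms)
    qed
    also have "(\<Prod>p\<in>S0. g (w (fst p)) (w (snd p))) = (\<Prod>p\<in>S0. g (z (fst p)) (z (snd p)))"
      by (intro prod.cong) (auto simp: S0_def w_def)
    also have "(\<Prod>p\<in>{i} \<times> {..<i}. g (w (fst p)) (w (snd p))) = (\<Prod>j<i. g x (z j))"
      by (rule prod.reindex_bij_witness[of _ "\<lambda>j. (i, j)" snd]) (auto simp: w_def)
    also have "(\<Prod>p\<in>{i<..<t} \<times> {i}. g (w (fst p)) (w (snd p))) = (\<Prod>j\<in>{i<..<t}. - g x (z j))"
      by (rule prod.reindex_bij_witness[of _ "\<lambda>j. (j, i)" fst]) (use g[OF x] in \<open>auto simp: w_def\<close>)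
    also have "\<dots> = (- 1) ^ card {i<..<t} * (\<Prod>j\<in>{i<..<t}. g x (z j))"
      by (subst prod.distrib[of "\<lambda>_. - 1", simplified, symmetric]) simp
    finally have p: "(\<Prod>a<t. \<Prod>b<a. g (w a) (w b)) = (\<Prod>p\<in>S0. g (z (fst p)) (z (snd p))) *
      ((\<Prod>j<i. g x (z j)) * ((- 1) ^ card {i<..<t} * (\<Prod>j\<in>{i<..<t}. g x (z j))))" .
    have s: "{..<t} - {i} = {..<i} \<union> {i<..<t}" using i by auto
    have pr: "(\<Prod>j\<in>{..<t} - {i}. g x (z j)) = (\<Prod>j<i. g x (z j)) * (\<Prod>j\<in>{i<..<t}. g x (z j))"
      unfolding s by (rule prod.union_disjoint) auto
    show ?thesis unfolding w_def[symmetric] c p R_def pr by (simp only: mult_ac)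
  qed
  then show ?thesis by blast
qed

lemma theta_prod_one_variable:
  assumes i: "i < t" and z: "\<And>j. j < t \<Longrightarrow> z j \<noteq> 0"
  shows "\<exists>R. \<forall>x. x \<noteq> 0 \<longrightarrow> theta_prod t (z(i := x)) = R * (chi x * (\<Prod>j\<in>{..<t} - {i}. psi x (z j)))"
  unfolding theta_prod_def
  using psi_swap z by (intro antisymmetric_prod_one_variable[OF i]) blast

lemma theta_det_prod_exchange:
  assumes i: "i < t" and z: "\<And>j. j < t \<Longrightarrow> z j \<noteq> 0" and x: "x \<noteq> 0" and y: "y \<noteq> 0"
  shows "theta_det t (z(i := x)) * theta_prod t (z(i := y)) = theta_det t (z(i := y)) * theta_prod t (z(i := x))"
proof -
  define f where "f x = chi x * (\<Prod>j\<in>{..<t} - {i}. psi x (z j))" for x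
  obtain R where R: "\<And>x. x \<noteq> 0 \<Longrightarrow> theta_prod t (z(i := x)) = R * f x"
    using theta_prod_one_variable[of i t z, OF i z] unfolding f_def by blast
  have "theta_like (4 + 2 * int (card ({..<t} - {i}))) (2 + int (card ({..<t} - {i}))) 1 f"
    unfolding f_def using z by (intro theta_like_chi_psi_prod) auto
  \<comment> \<open>Degree count: 4 from \<open>chi\<close> and 2 from each of t - 1 factors
    \<open>psi\<close> give 2(t + 1), the degree of the entries in the determinant.\<close>
  then have tl: "theta_like (2 * (int t + 1)) (int t + 1) 1 f" using i by (simp add: algebra_simps of_nat_diff)
  have "f (inverse x) = - f x" if "x \<noteq> 0" for x
    unfolding f_def using that z by (simp add: chi_inverse psi_inverse)
  from odd_theta_basis[OF tl _ this] obtain C where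
    C: "\<And>x. x \<noteq> 0 \<Longrightarrow> f x = (\<Sum>k=1..<int t + 1. C k * odd_theta (int t + 1) k x)" by auto
  have C': "f x = (\<Sum>k<t. C (int k + 1) * odd_theta (int t + 1) (int k + 1) x)" if "x \<noteq> 0" for x
    unfolding C[OF that]
    by (rule sum.reindex_bij_witness[of _ "\<lambda>k. int k + 1" "\<lambda>k. nat (k - 1)"]) auto
  have "f (z r) = 0" if "r < t" "r \<noteq> i" for r
  proof -
    have "(\<Prod>j\<in>{..<t} - {i}. psi (z r) (z j)) = 0" using that psi_self[OF z[of r]] by (intro prod_zero) auto
    then show ?thesis by (simp add: f_def)
  qed
  then have "theta_det t (z(i := x)) * f y = theta_det t (z(i := y)) * f x"
    unfolding theta_det_def C'[OF x] C'[OF y] using C' z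
    by (intro det_replace_row[where g = "\<lambda>k x. odd_theta (int t + 1) (int k + 1) x" and z = z
         and C = "\<lambda>k. C (int k + 1)" and x = x and y = y, OF i]) simp
  then have "R * (theta_det t (z(i := x)) * f y) = R * (theta_det t (z(i := y)) * f x)" by simp
  then show ?thesis unfolding R[OF x] R[OF y] by (simp only: mult_ac)
qed

lemma weyl_prod_nonzero:
  assumes "\<And>i. i < t \<Longrightarrow> z i \<noteq> 0 \<and> (z i)\<^sup>2 \<noteq> 1"
    and "\<And>i j. j < i \<Longrightarrow> i < t \<Longrightarrow> z i * z j \<noteq> 1 \<and> z i \<noteq> z j"
  shows "weyl_prod t z \<noteq> 0"
proof -
  have "inverse (z i) * (1 - (z i)\<^sup>2) \<noteq> 0" if "i < t" for i using assms(1)[OF that] by auto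
  moreover have "inverse (z i) * ((1 - z i * z j) * (1 - z i / z j)) \<noteq> 0" if "j < i" "i < t" for i j
    using assms(1)[of i] assms(1)[of j] assms(2)[OF that] that by simp
  ultimately show ?thesis unfolding weyl_prod_def by auto
qed

text \<open>The inequalities under which the Weyl denominator, and with it
  \<open>theta_prod\<close>, is nonzero.\<close>

definition nondegenerate :: "nat \<Rightarrow> (nat \<Rightarrow> complex) \<Rightarrow> bool" where
  "nondegenerate t z \<longleftrightarrow> (\<forall>i<t. z i \<noteq> 0 \<and> (z i)\<^sup>2 \<noteq> 1) \<and> (\<forall>i<t. \<forall>j<i. z i * z j \<noteq> 1 \<and> z i \<noteq> z j)"

text \<open>Passes from z to w one coordinate at a time. Each step cancels \<open>theta_prod\<close>
  at the hybrid point \<open>h n\<close>, so the hybrids must be nondegenerate; this is what the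
  mixed condition on z and w provides.\<close>

lemma theta_det_prod_proportional:
  assumes z: "nondegenerate t z" and w: "nondegenerate t w"
    and zw: "\<And>i j. i < t \<Longrightarrow> j < t \<Longrightarrow> z i * w j \<noteq> 1 \<and> z i \<noteq> w j"
  shows "theta_det t z * theta_prod t w = theta_det t w * theta_prod t z"
proof -
  define h where "h n = (\<lambda>i. if i < n then w i else z i)" for n :: nat
  have h0: "h n j \<noteq> 0" if "j < t" for n j using z w that by (auto simp: h_def nondegenerate_def)
  have nz: "theta_prod t (h n) \<noteq> 0" if "n \<le> t" for n
  proof -
    have "weyl_prod t (h n) \<noteq> 0"
    proof (rule weyl_prod_nonzero)
      fix i j assume ij: "j < i" "i < t"
      show "h n i * h n j \<noteq> 1 \<and> h n i \<noteq> h n j"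
        using z w zw[of i j] ij by (auto simp: h_def nondegenerate_def)
    qed (use z w in \<open>auto simp: h_def nondegenerate_def\<close>)
    then show ?thesis using theta_prod_nth_0[of t "h n"] by auto
  qed
  have "theta_det t z * theta_prod t (h n) = theta_det t (h n) * theta_prod t z" if "n \<le> t" for n
    using that
  proof (induction n)
    case 0
    then show ?case by (simp add: h_def mult.commute)
  next
    case (Suc n)
    have e: "h n = (h n)(n := z n)" "h (Suc n) = (h n)(n := w n)" by (auto simp: h_def)
    have "theta_det t ((h n)(n := z n)) * theta_prod t ((h n)(n := w n))
        = theta_det t ((h n)(n := w n)) * theta_prod t ((h n)(n := z n))"
      using h0 Suc z w by (intro theta_det_prod_exchange) (auto simp: nondegenerate_def)
    then have ex: "theta_det t (h n) * theta_prod t (h (Suc n)) = theta_det t (h (Suc n)) * theta_prod t (h n)"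
      unfolding e[symmetric] .
    have "theta_prod t (h n) * (theta_det t z * theta_prod t (h (Suc n)))
        = (theta_det t z * theta_prod t (h n)) * theta_prod t (h (Suc n))" by (simp only: mult_ac)
    also have "\<dots> = theta_prod t z * (theta_det t (h n) * theta_prod t (h (Suc n)))"
      using Suc by (simp only: mult_ac Suc_leD)
    also have "\<dots> = theta_prod t (h n) * (theta_det t (h (Suc n)) * theta_prod t z)"
      unfolding ex by (simp only: mult_ac)
    finally have "theta_prod t (h n) * (theta_det t z * theta_prod t (h (Suc n)))
        = theta_prod t (h n) * (theta_det t (h (Suc n)) * theta_prod t z)" .
    then show ?case using nz[of n] Suc.prems by simp
  qed
  from this[of t] show ?thesis
    using theta_det_cong[of t "h t" w] theta_prod_cong[of t "h t" w] by (simp add: h_def)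
qed

section \<open>Product expansions of the theta series\<close>

definition euler_prod :: "complex fps" where
  "euler_prod = iprod (\<lambda>n. 1 - fps_X ^ n)"

text \<open>What the triple product for \<open>theta x\<close> leaves after 1 - x and Euler's
  product are split off. It depends symmetrically on x and 1/x and remains a unit at x = 1, so the
  zero sits in 1 - x alone.\<close>

definition theta_tail :: "complex \<Rightarrow> complex fps" where
  "theta_tail x = iprod (\<lambda>n. (1 - fps_const x * fps_X ^ n) * (1 - fps_const (inverse x) * fps_X ^ n))"

lemma tame_one_minus_X: "tame (\<lambda>n. 1 - fps_X ^ n)"
  using tame_linear[of id 1] by simp

lemma tame_theta_tail: "tame (\<lambda>n. (1 - fps_const x * fps_X ^ n) * (1 - fps_const y * fps_X ^ n))"
  by (intro tame_mult tame_linear) auto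

theorem theta_triple_product:
  assumes x: "x \<noteq> 0"
  shows "theta x = fps_const (1 - x) * euler_prod * theta_tail x"
proof (rule fps_eqI_cong_below)
  fix K
  define n where "n = Suc K"
  define T where "T j = fps_const ((- x) powi j) * fps_X ^ nat (tri j)" for j
  define tail where "tail n = (1 - fps_const x * fps_X ^ n) * (1 - fps_const (inverse x) * fps_X ^ n)" for n
  have Q0: "fps_nth (fps_X :: complex fps) 0 = 0" by simp
  have "fps_X ^ n dvd qpoch fps_X n * (\<Prod>i<n. (1 - fps_const x * fps_X ^ i) *
      (1 - (fps_const (inverse x) * fps_X) * fps_X ^ i)) - (\<Sum>j=-int n..int n. T j)"
  proof (rule triple_product_approx[where T = T, OF Q0])
    show "fps_const x * (fps_const (inverse x) * fps_X) = fps_X" 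
      using x by (simp add: mult.assoc[symmetric])
    show "T 0 = 1" by (simp add: T_def tri_def)
    show "fps_X ^ a * fps_const x * T j = - (fps_X ^ b * T (j + 1))" if "int b = int a - j" for j a b
    proof -
      have "int (a + nat (tri j)) = int (b + nat (tri (j + 1)))"
        using that tri_add_1[of j] tri_ge(2)[of j] tri_ge(2)[of "j + 1"] by simp
      then have "a + nat (tri j) = b + nat (tri (j + 1))" by (simp only: of_nat_eq_iff)
      then have e: "fps_X ^ a * fps_X ^ nat (tri j) = (fps_X ^ b * fps_X ^ nat (tri (j + 1)) :: complex fps)"
        by (simp add: power_add[symmetric])
      have "fps_X ^ a * fps_const x * T j = fps_const (x * (- x) powi j) * (fps_X ^ a * fps_X ^ nat (tri j))"
        by (simp add: T_def mult_ac flip: fps_const_mult)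
      also have "x * (- x) powi j = - ((- x) powi (j + 1))" using x by (simp add: power_int_add)
      finally show ?thesis unfolding e by (simp add: T_def mult_ac)
    qed
    show "fps_X ^ a * (fps_const (inverse x) * fps_X) * T j = - (fps_X ^ b * T (j - 1))"
      if "int b = int a + j" for j a b
    proof -
      have "int (a + 1 + nat (tri j)) = int (b + nat (tri (j - 1)))"
        using that tri_add_1[of "j - 1"] tri_ge(2)[of j] tri_ge(2)[of "j - 1"] by simp
      then have "a + 1 + nat (tri j) = b + nat (tri (j - 1))" by (simp only: of_nat_eq_iff)
      then have e: "fps_X ^ (a + 1) * fps_X ^ nat (tri j) = (fps_X ^ b * fps_X ^ nat (tri (j - 1)) :: complex fps)"
        by (simp only: power_add[symmetric])
      have "fps_X ^ a * (fps_const (inverse x) * fps_X) * T j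
         = fps_const (inverse x * (- x) powi j) * (fps_X ^ (a + 1) * fps_X ^ nat (tri j))"
        by (simp add: T_def mult_ac flip: fps_const_mult)
      also have "inverse x * (- x) powi j = - ((- x) powi (j - 1))"
        using x by (simp add: power_int_diff divide_inverse)
      finally show ?thesis unfolding e by (simp add: T_def mult_ac)
    qed
    show "fps_X ^ (nat \<bar>j\<bar> - 1) dvd T j" for j
      unfolding T_def using tri_ge[of j] by (intro dvd_mult le_imp_power_dvd) linarith
  qed
  then have "fps_cong_below n (qpoch fps_X n * (\<Prod>i<n. (1 - fps_const x * fps_X ^ i) *
      (1 - (fps_const (inverse x) * fps_X) * fps_X ^ i))) (\<Sum>j=-int n..int n. T j)"
    by (rule fps_cong_below_X_power_dvd)
  moreover have "fps_cong_below n (\<Sum>j=-int n..int n. T j) (theta x)"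
    unfolding fps_cong_below_def
  proof (intro allI impI)
    fix k assume k: "k < n"
    have s: "{m. tri m = int k} = {m \<in> {-int n..int n}. tri m = int k}"
    proof -
      have "m \<in> {-int n..int n}" if "tri m = int k" for m using tri_ge(1)[of m] that k by auto
      then show ?thesis by blast
    qed
    have "fps_nth (\<Sum>j=-int n..int n. T j) k = (\<Sum>j=-int n..int n. if tri j = int k then (- x) powi j else 0)"
      unfolding fps_sum_nth using tri_ge(2)
      by (intro sum.cong refl) (auto simp: T_def nat_eq_iff)
    also have "\<dots> = fps_nth (theta x) k"
      unfolding theta_def fps_nth_Abs_fps s by (subst sum.inter_filter[symmetric]) auto
    finally show "fps_nth (\<Sum>j=-int n..int n. T j) k = fps_nth (theta x) k" .
  qed
  \<comment> \<open>The two families of factors are offset by one: 1 - x pairs with 1 - X/x.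
    Regrouping by equal powers of X frees the first factor 1 - x and strands one factor with
    X^(k+1), which is invisible below degree n = K + 1.\<close>
  moreover have "(\<Prod>i<Suc k. (1 - fps_const x * fps_X ^ i) * (1 - (fps_const (inverse x) * fps_X) * fps_X ^ i))
      = fps_const (1 - x) * (\<Prod>i=1..k. tail i) * (1 - fps_const (inverse x) * fps_X ^ Suc k)" for k
  proof (induction k)
    case 0
    then show ?case by (simp flip: fps_const_sub)
  next
    case (Suc k)
    then show ?case by (subst prod.lessThan_Suc) (simp add: tail_def mult_ac)
  qed
  then have "qpoch fps_X n * (\<Prod>i<n. (1 - fps_const x * fps_X ^ i) *
      (1 - (fps_const (inverse x) * fps_X) * fps_X ^ i)) =
     qpoch fps_X n * (fps_const (1 - x) * (\<Prod>i=1..K. tail i) * (1 - fps_const (inverse x) * fps_X ^ Suc K))"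
    by (simp add: n_def)
  moreover have "fps_cong_below n (qpoch fps_X n * (fps_const (1 - x) * (\<Prod>i=1..K. tail i) *
       (1 - fps_const (inverse x) * fps_X ^ Suc K))) (euler_prod * (fps_const (1 - x) * theta_tail x * 1))"
  proof (intro fps_cong_below_mult fps_cong_below_refl)
    show "fps_cong_below n (qpoch fps_X n) euler_prod"
      using iprod_cong_below[OF tame_one_minus_X, of n n]
      unfolding euler_prod_def qpoch_def by (simp add: fps_cong_below_def)
    show "fps_cong_below n (\<Prod>i=1..K. tail i) (theta_tail x)"
      using iprod_cong_below[OF tame_theta_tail, of K K x "inverse x"]
      unfolding theta_tail_def tail_def n_def by (simp add: fps_cong_below_def)
    show "fps_cong_below n (1 - fps_const (inverse x) * fps_X ^ Suc K) 1"
      by (simp add: fps_cong_below_def n_def del: power_Suc)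
  qed
  ultimately have "fps_cong_below n (theta x) (euler_prod * (fps_const (1 - x) * theta_tail x * 1))"
    by (metis fps_cong_below_sym fps_cong_below_trans)
  then have "fps_cong_below n (theta x) (fps_const (1 - x) * euler_prod * theta_tail x)"
    by (simp add: mult_ac)
  then show "fps_cong_below K (theta x) (fps_const (1 - x) * euler_prod * theta_tail x)"
    by (simp add: fps_cong_below_def n_def)
qed

text \<open>The series of X^(c m^2 + k m) over all integers m, to which \<open>odd_theta\<close>
  reduces at roots of unity of order 2c.\<close>

definition quadratic_theta :: "nat \<Rightarrow> nat \<Rightarrow> complex fps" where
  "quadratic_theta c k = Abs_fps (\<lambda>K. of_nat (card {m. int c * m\<^sup>2 + int k * m = int K}))"

text \<open>The divisibility demanded by \<open>triple_product_approx\<close> for Q = X^(2c). It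
  rests on (|m| - 1)(|m| - 2) \<ge> 0, which holds for integers.\<close>

lemma quadratic_exponent_ge:
  fixes c k m :: int
  assumes "0 < k" "k < c" shows "2 * c * (\<bar>m\<bar> - 1) \<le> c * m\<^sup>2 + k * m"
proof -
  have "0 \<le> (\<bar>m\<bar> - 1) * (\<bar>m\<bar> - 2)"
    by (cases "\<bar>m\<bar> \<ge> 2") (auto simp: mult_nonneg_nonpos2 intro!: mult_nonpos_nonpos)
  then have "0 \<le> c * ((\<bar>m\<bar> - 1) * (\<bar>m\<bar> - 2))" using assms by simp
  also have "\<dots> = c * m\<^sup>2 - c * \<bar>m\<bar> - 2 * c * (\<bar>m\<bar> - 1)"
    by (simp add: algebra_simps power2_eq_square abs_mult[symmetric])
  finally have "2 * c * (\<bar>m\<bar> - 1) \<le> c * m\<^sup>2 - c * \<bar>m\<bar>" by simp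
  moreover have "k * \<bar>m\<bar> \<le> c * \<bar>m\<bar>" using assms by (intro mult_right_mono) auto
  moreover have "- (k * \<bar>m\<bar>) \<le> k * m" using assms(1) by (auto simp: abs_if)
  ultimately show ?thesis by linarith
qed

text \<open>The triple product with nome X^(2c) and arguments -X^(c+k), -X^(c-k). Exponents are
  counted down from 2cn to match the residues in \<open>iprod_residues\<close>.\<close>

lemma quadratic_theta_product:
  fixes c k :: nat
  assumes k: "0 < k" "k < c"
  defines "F \<equiv> \<lambda>n. (1 - fps_X ^ (2 * c * n)) * ((1 + fps_X ^ (2 * c * n - (c - k))) * (1 + fps_X ^ (2 * c * n - (c + k))))"
  shows "tame F" "quadratic_theta c k = iprod F"
proof -
  define G where "G a b n = 1 - fps_const a * fps_X ^ (2 * c * n - b)" for a :: complex and b n :: nat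
  have "n \<le> 2 * c * n - b" if n1: "n \<ge> 1" and b: "b < 2 * c" for b n
  proof -
    obtain n' where n': "n = Suc n'" using n1 by (cases n) auto
    have "n' \<le> 2 * c * n'" "2 * c * n = 2 * c + 2 * c * n'" using k n' by simp_all
    then show ?thesis using b n' by linarith
  qed
  then have tG: "tame (G a b)" if "b < 2 * c" for a b
    unfolding G_def using that by (intro tame_linear) auto
  have "F = (\<lambda>n. G 1 0 n * (G (- 1) (c - k) n * G (- 1) (c + k) n))"
    by (auto simp: F_def G_def)
  then show F: "tame F" using k by (auto intro!: tame_mult tG)
  show "quadratic_theta c k = iprod F"
  proof (rule iprod_eqI[OF F, symmetric])
    fix K
    define e where "e j = int c * j\<^sup>2 + int k * j" for j
    have e0: "\<bar>j\<bar> \<le> e j" for j using quadratic_ge[of "int k" "int c" j] k by (simp add: e_def)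
    then have e0': "e j \<ge> 0" for j by (meson abs_ge_zero order_trans)
    define T :: "int \<Rightarrow> complex fps" where "T j = fps_X ^ nat (e j)" for j
    define Q :: "complex fps" where "Q = fps_X ^ (2 * c)"
    have Q0: "fps_nth Q 0 = 0" using k by (simp add: Q_def)
    have X: "fps_X dvd Q" using k by (simp add: Q_def)
    have e1: "e (j + 1) = e j + 2 * int c * j + int c + int k" for j
      by (simp add: e_def algebra_simps power2_eq_square)
    have e2: "e (j - 1) = e j - 2 * int c * j + int c - int k" for j
      by (simp add: e_def algebra_simps power2_eq_square)
    have "Q ^ K dvd qpoch Q K * (\<Prod>i<K. (1 - (- (fps_X ^ (c + k))) * Q ^ i) * (1 - (- (fps_X ^ (c - k))) * Q ^ i))
       - (\<Sum>j=-int K..int K. T j)"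
    proof (rule triple_product_approx[where T = T, OF Q0])
      show "(- (fps_X ^ (c + k))) * (- (fps_X ^ (c - k))) = Q" using k by (simp add: Q_def power_add[symmetric])
      show "T 0 = 1" by (simp add: T_def e_def)
      show "Q ^ a * (- (fps_X ^ (c + k))) * T j = - (Q ^ b * T (j + 1))" if "int b = int a - j" for j a b
      proof -
        have "int (2 * c * a + (c + k) + nat (e j)) = int (2 * c * b + nat (e (j + 1)))"
        proof -
          have a: "int a = int b + j" using that by simp
          show ?thesis using e0'[of j] e0'[of "j + 1"] e1[of j] by (simp add: a algebra_simps)
        qed
        then have "2 * c * a + (c + k) + nat (e j) = 2 * c * b + nat (e (j + 1))" by (simp only: of_nat_eq_iff)
        then show ?thesis by (simp add: Q_def T_def power_mult[symmetric] power_add[symmetric] del: of_nat_add)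
      qed
      show "Q ^ a * (- (fps_X ^ (c - k))) * T j = - (Q ^ b * T (j - 1))" if "int b = int a + j" for j a b
      proof -
        have "int (2 * c * a + (c - k) + nat (e j)) = int (2 * c * b + nat (e (j - 1)))"
          using e0'[of j] e0'[of "j - 1"] that e2[of j] k by (simp add: algebra_simps of_nat_diff)
        then have "2 * c * a + (c - k) + nat (e j) = 2 * c * b + nat (e (j - 1))" by (simp only: of_nat_eq_iff)
        then show ?thesis by (simp add: Q_def T_def power_mult[symmetric] power_add[symmetric] del: of_nat_add)
      qed
      show "Q ^ (nat \<bar>j\<bar> - 1) dvd T j" for j
      proof -
        have "2 * int c * (\<bar>j\<bar> - 1) \<le> e j"
          using quadratic_exponent_ge[of "int k" "int c" j] k by (simp add: e_def)
        then have "int (2 * c * (nat \<bar>j\<bar> - 1)) \<le> int (nat (e j))"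
          using e0'[of j] by (cases "j = 0") (auto simp: of_nat_diff)
        then have "2 * c * (nat \<bar>j\<bar> - 1) \<le> nat (e j)" by (simp only: of_nat_le_iff)
        then show ?thesis unfolding Q_def T_def power_mult[symmetric] by (rule le_imp_power_dvd)
      qed
    qed
    then have "fps_cong_below K (qpoch Q K * (\<Prod>i<K. (1 - (- (fps_X ^ (c + k))) * Q ^ i) *
       (1 - (- (fps_X ^ (c - k))) * Q ^ i))) (\<Sum>j=-int K..int K. T j)"
      using X by (rule fps_cong_below_dvd_trans)
    moreover have "qpoch Q n * (\<Prod>i<n. (1 - (- (fps_X ^ (c + k))) * Q ^ i) *
       (1 - (- (fps_X ^ (c - k))) * Q ^ i)) = (\<Prod>n=1..n. F n)" for n
    proof (induction n)
      case (Suc n)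
      have ex: "2 * c * Suc n - (c - k) = c + k + 2 * c * n" "2 * c * Suc n - (c + k) = c - k + 2 * c * n"
        using k by auto
      have "F (Suc n) = (1 - Q ^ Suc n) * ((1 - (- (fps_X ^ (c + k))) * Q ^ n) * (1 - (- (fps_X ^ (c - k))) * Q ^ n))"
        unfolding F_def ex Q_def power_mult[symmetric] by (simp add: power_add)
      then show ?case using Suc by (simp add: qpoch_Suc mult_ac del: power_Suc)
    qed (simp add: qpoch_def)
    moreover have "fps_cong_below K (\<Sum>j=-int K..int K. T j) (quadratic_theta c k)"
      unfolding fps_cong_below_def
    proof (intro allI impI)
      fix n assume n: "n < K"
      have s: "{m. e m = int n} = {m \<in> {-int K..int K}. e m = int n}"
      proof -
        have "m \<in> {-int K..int K}" if "e m = int n" for m using e0[of m] that n by auto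
        then show ?thesis by blast
      qed
      have "fps_nth (\<Sum>j=-int K..int K. T j) n = (\<Sum>j=-int K..int K. if e j = int n then 1 else 0)"
        unfolding fps_sum_nth using e0'
        by (intro sum.cong refl) (auto simp: T_def nat_eq_iff)
      also have "\<dots> = (\<Sum>j | e j = int n. 1)" unfolding s by (subst sum.inter_filter[symmetric]) auto
      finally show "fps_nth (\<Sum>j=-int K..int K. T j) n = fps_nth (quadratic_theta c k) n"
        by (simp add: quadratic_theta_def e_def)
    qed
    ultimately have "fps_cong_below K (\<Prod>n=1..K. F n) (quadratic_theta c k)"
      by (metis fps_cong_below_trans)
    then show "\<exists>M\<ge>K. fps_cong_below K (\<Prod>n=1..M. F n) (quadratic_theta c k)" by blast
  qed
qed

subsection \<open>Roots of unity\<close>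

lemma prod_symmetric:
  fixes H :: "nat \<Rightarrow> nat \<Rightarrow> 'a::comm_monoid_mult"
  assumes "\<And>i j. H i j = H j i"
  shows "(\<Prod>i<t. \<Prod>j<t. H i j) = (\<Prod>i<t. H i i) * (\<Prod>i<t. \<Prod>j<i. H i j)\<^sup>2"
proof (induction t)
  case (Suc t)
  have "(\<Prod>i<t. H i t) = (\<Prod>j<t. H t j)" using assms by (intro prod.cong) auto
  then show ?case using Suc by (simp add: prod.distrib power2_eq_square mult_ac)
qed simp

text \<open>The difference has degree at most n, yet it vanishes at the n roots of unity and also at
  0, where both sides equal 1.\<close>

lemma roots_of_unity_prod_poly:
  assumes "n > 0"
  shows "(\<Prod>z | z ^ n = 1. [:1, - z :: complex:]) = 1 - monom 1 n"
proof (rule ccontr)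
  define R where "R = {z :: complex. z ^ n = 1}"
  define p where "p = (\<Prod>z\<in>R. [:1, - z:]) - (1 - monom 1 n)"
  assume "(\<Prod>z | z ^ n = 1. [:1, - z :: complex:]) \<noteq> 1 - monom 1 n"
  then have p: "p \<noteq> 0" by (simp add: p_def R_def)
  have R: "card R = n" "finite R" using card_roots_unity_eq[OF assms] assms
    by (auto simp: R_def intro: card_ge_0_finite)
  have "degree (\<Prod>z\<in>R. [:1, - z:]) \<le> (\<Sum>z\<in>R. degree [:1, - z:])" using degree_prod_sum_le[OF R(2), of "\<lambda>z. [:1, - z:]"] by (simp add: o_def)
  also have "\<dots> \<le> (\<Sum>z\<in>R. 1)" by (intro sum_mono) auto
  finally have "degree (\<Prod>z\<in>R. [:1, - z:]) \<le> n" using R by simp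
  moreover have "degree (1 - monom (1::complex) n) \<le> n" by (intro degree_diff_le) (auto simp: degree_monom_eq)
  ultimately have deg: "degree p \<le> n" unfolding p_def by (rule degree_diff_le)
  have "poly p x = 0" if "x \<in> insert 0 R" for x
  proof (cases "x = 0")
    case True
    then show ?thesis using assms by (simp add: p_def poly_prod poly_monom)
  next
    case False
    then have x: "x ^ n = 1" using that by (simp add: R_def)
    then have "inverse x \<in> R" by (simp add: R_def power_inverse)
    then have "(\<Prod>z\<in>R. poly [:1, - z:] x) = 0"
      using R False by (intro prod_zero) (auto intro!: bexI[of _ "inverse x"])
    then show ?thesis using x by (simp add: p_def poly_prod poly_monom)
  qed
  then have "card (insert 0 R) \<le> card {x. poly p x = 0}"
    using p by (intro card_mono) (auto simp: poly_roots_finite)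
  also have "\<dots> \<le> degree p" by (rule card_poly_roots_bound[OF p])
  finally show False using R deg assms by (simp add: card_insert_if R_def power_0_left)
qed

lemma roots_of_unity_prod_fps:
  fixes Y :: "complex fps"
  assumes "n > 0" "fps_nth Y 0 = 0"
  shows "(\<Prod>z | z ^ n = 1. 1 - fps_const z * Y) = 1 - Y ^ n"
proof -
  have l: "fps_of_poly [:1, - z:] = 1 - fps_const z * fps_X" for z :: complex
    using fps_of_poly_linear'[of "- z"] by (simp flip: fps_const_neg)
  have "fps_of_poly (\<Prod>z | z ^ n = 1. [:1, - z :: complex:]) = fps_of_poly (1 - monom 1 n)"
    using roots_of_unity_prod_poly[OF assms(1)] by simp
  then have "(\<Prod>z | z ^ n = 1. 1 - fps_const z * fps_X) = (1 - fps_X ^ n :: complex fps)"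
    by (simp only: fps_of_poly_prod l fps_of_poly_diff fps_of_poly_1 fps_of_poly_monom')
  then have "(\<Prod>z | z ^ n = 1. 1 - fps_const z * fps_X) oo Y = (1 - fps_X ^ n :: complex fps) oo Y" by simp
  then show ?thesis
    using assms(2) by (simp add: fps_compose_prod_distrib fps_compose_sub_distrib fps_compose_mult_distrib
        fps_compose_power[symmetric] fps_X_fps_compose_startby0)
qed

text \<open>For i < t these are the roots of unity of order 2(t + 1) in the open upper half-plane:
  one from each pair {z, 1/z} of nonreal roots.\<close>

definition root_points :: "nat \<Rightarrow> nat \<Rightarrow> complex" where
  "root_points t i = cis (2 * pi / real (2 * (t + 1))) ^ Suc i"

definition nonreal_roots :: "nat \<Rightarrow> complex set" where
  "nonreal_roots t = {z. z ^ (2 * (t + 1)) = 1} - {1, - 1}"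

lemma root_points_bij:
  "bij_betw (\<lambda>k. cis (2 * pi / real (2 * (t + 1))) ^ k) {..<2 * (t + 1)} {z. z ^ (2 * (t + 1)) = 1}"
proof -
  have "bij_betw (\<lambda>k. cis (2 * pi * real k / real (2 * (t + 1)))) {..<2 * (t + 1)} {z. z ^ (2 * (t + 1)) = 1}"
    using Complex.bij_betw_roots_unity[of "2 * (t + 1)"] by simp
  moreover have "cis (2 * pi * real k / real (2 * (t + 1))) = cis (2 * pi / real (2 * (t + 1))) ^ k" for k
    by (subst Complex.DeMoivre) (simp add: mult_ac)
  ultimately show ?thesis by simp
qed

lemma root_points_facts:
  shows "cis (2 * pi / real (2 * (t + 1))) ^ (2 * (t + 1)) = 1"
    and "cis (2 * pi / real (2 * (t + 1))) ^ (t + 1) = - 1"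
proof -
  show 1: "cis (2 * pi / real (2 * (t + 1))) ^ (t + 1) = - 1"
  proof -
    have "real (t + 1) * (2 * pi / real (2 * (t + 1))) = pi" by (simp add: field_simps)
    then show ?thesis by (simp only: Complex.DeMoivre cis_pi)
  qed
  then have "(cis (2 * pi / real (2 * (t + 1))) ^ (t + 1))\<^sup>2 = 1" by simp
  then show "cis (2 * pi / real (2 * (t + 1))) ^ (2 * (t + 1)) = 1"
    by (simp only: power_mult[symmetric] mult.commute)
qed

lemma nonreal_roots_eq:
  fixes t :: nat
  defines "w \<equiv> cis (2 * pi / real (2 * (t + 1)))"
  shows "nonreal_roots t = (\<lambda>k. w ^ k) ` ({..<2 * (t + 1)} - {0, t + 1})"
    and "inj_on (\<lambda>k. w ^ k) ({..<2 * (t + 1)} - {0, t + 1})"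
proof -
  note b = root_points_bij[of t, folded w_def]
  have inj: "inj_on (\<lambda>k. w ^ k) {..<2 * (t + 1)}" using b by (rule bij_betw_imp_inj_on)
  then show "inj_on (\<lambda>k. w ^ k) ({..<2 * (t + 1)} - {0, t + 1})" by (rule inj_on_subset) auto
  have "(\<lambda>k. w ^ k) ` {0, t + 1} = {1, - 1}" using root_points_facts(2)[of t] by (auto simp: w_def)
  moreover have "(\<lambda>k. w ^ k) ` ({..<2 * (t + 1)} - {0, t + 1}) = (\<lambda>k. w ^ k) ` {..<2 * (t + 1)} - (\<lambda>k. w ^ k) ` {0, t + 1}"
    by (rule inj_on_image_set_diff[OF inj]) auto
  moreover have "(\<lambda>k. w ^ k) ` {..<2 * (t + 1)} = {z. z ^ (2 * (t + 1)) = 1}"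
    using b by (rule bij_betw_imp_surj_on)
  ultimately show "nonreal_roots t = (\<lambda>k. w ^ k) ` ({..<2 * (t + 1)} - {0, t + 1})"
    by (simp add: nonreal_roots_def)
qed

lemma root_points_inverse:
  assumes "i < t"
  shows "inverse (root_points t i) = cis (2 * pi / real (2 * (t + 1))) ^ (2 * (t + 1) - Suc i)"
proof -
  define w where "w = cis (2 * pi / real (2 * (t + 1)))"
  have "w ^ (2 * (t + 1) - Suc i) * w ^ Suc i = w ^ (2 * (t + 1))"
    using assms by (simp only: power_add[symmetric]) (simp del: power_Suc)
  also have "\<dots> = 1" using root_points_facts(1)[of t] by (simp only: w_def)
  finally show ?thesis unfolding root_points_def w_def[symmetric]
    by (metis inverse_unique mult.commute)
qed

lemma nonreal_roots_prod:
  "(\<Prod>a\<in>nonreal_roots t. h a) = (\<Prod>i<t. h (root_points t i) * (h (inverse (root_points t i)) :: 'a::comm_monoid_mult))"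
proof -
  define w where "w = cis (2 * pi / real (2 * (t + 1)))"
  have s: "{..<2 * (t + 1)} - {0, t + 1} = {1..t} \<union> {t+2..2*t+1}" by auto
  have "(\<Prod>a\<in>nonreal_roots t. h a) = (\<Prod>k\<in>{1..t} \<union> {t+2..2*t+1}. h (w ^ k))"
    using nonreal_roots_eq[of t, folded w_def] unfolding s by (simp add: prod.reindex)
  also have "\<dots> = (\<Prod>k\<in>{1..t}. h (w ^ k)) * (\<Prod>k\<in>{t+2..2*t+1}. h (w ^ k))"
    by (rule prod.union_disjoint) auto
  also have "(\<Prod>k\<in>{1..t}. h (w ^ k)) = (\<Prod>i<t. h (root_points t i))"
    by (rule prod.reindex_bij_witness[of _ Suc "\<lambda>k. k - 1"]) (auto simp: root_points_def w_def)
  also have "(\<Prod>k\<in>{t+2..2*t+1}. h (w ^ k)) = (\<Prod>i<t. h (inverse (root_points t i)))"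
    by (rule prod.reindex_bij_witness[of _ "\<lambda>i. 2 * (t + 1) - Suc i" "\<lambda>k. 2 * t + 1 - k"])
       (auto simp: root_points_inverse w_def)
  finally show ?thesis by (simp add: prod.distrib)
qed

lemma card_nonreal_roots: "card (nonreal_roots t) = 2 * t" "finite (nonreal_roots t)"
proof -
  have "card ({..<2 * (t + 1)} - {0, t + 1}) = 2 * t" by (subst card_Diff_subset) auto
  then show "card (nonreal_roots t) = 2 * t" unfolding nonreal_roots_eq(1)
    by (subst card_image[OF nonreal_roots_eq(2)])
  show "finite (nonreal_roots t)" unfolding nonreal_roots_eq(1) by simp
qed

text \<open>The product of 1 - e^a Y over all roots a of type C, positive and negative, long roots
  first. At Y = X^n it is the n-th factor of \<open>tail_prod\<close>.\<close>

definition weyl_poly :: "nat \<Rightarrow> (nat \<Rightarrow> complex) \<Rightarrow> complex fps \<Rightarrow> complex fps" where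
  "weyl_poly t z Y =
    (\<Prod>i<t. (1 - fps_const ((z i)\<^sup>2) * Y) * (1 - fps_const (inverse ((z i)\<^sup>2)) * Y)) *
    (\<Prod>i<t. \<Prod>j<i. ((1 - fps_const (z i * z j) * Y) * (1 - fps_const (inverse (z i * z j)) * Y)) *
       ((1 - fps_const (z i / z j) * Y) * (1 - fps_const (inverse (z i / z j)) * Y)))"

lemma root_points_in:
  assumes "i < t"
  shows "root_points t i \<in> nonreal_roots t" "inverse (root_points t i) \<in> nonreal_roots t"
proof -
  show "root_points t i \<in> nonreal_roots t"
    unfolding root_points_def nonreal_roots_eq(1) using assms by (intro imageI) auto
  show "inverse (root_points t i) \<in> nonreal_roots t"
    unfolding root_points_inverse[OF assms] nonreal_roots_eq(1) using assms by (intro imageI) auto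
qed

lemma root_points_nondegenerate: "nondegenerate t (root_points t)"
proof -
  define w where "w = cis (2 * pi / real (2 * (t + 1)))"
  have inj: "inj_on (\<lambda>k. w ^ k) ({..<2 * (t + 1)} - {0, t + 1})"
    using nonreal_roots_eq(2)[of t] by (simp add: w_def)
  have 0: "root_points t i \<noteq> 0" for i by (simp add: root_points_def)
  have "root_points t i * root_points t j \<noteq> 1 \<and> (i \<noteq> j \<longrightarrow> root_points t i \<noteq> root_points t j)"
    if "i < t" "j < t" for i j
  proof
    show "root_points t i * root_points t j \<noteq> 1"
    proof
      assume "root_points t i * root_points t j = 1"
      then have "root_points t i = inverse (root_points t j)" using 0[of j] by (simp add: field_simps)
      then have "w ^ Suc i = w ^ (2 * (t + 1) - Suc j)"
        using root_points_inverse[OF that(2)] by (simp only: root_points_def w_def)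
      then have "Suc i = 2 * (t + 1) - Suc j"
        by (rule inj_onD[OF inj]) (use that in auto)
      then show False using that by simp
    qed
    show "i \<noteq> j \<longrightarrow> root_points t i \<noteq> root_points t j"
    proof (intro impI notI)
      assume "i \<noteq> j" "root_points t i = root_points t j"
      then have "w ^ Suc i = w ^ Suc j" by (simp only: root_points_def w_def)
      then have "Suc i = Suc j" by (rule inj_onD[OF inj]) (use that in auto)
      then show False using \<open>i \<noteq> j\<close> by simp
    qed
  qed
  then show ?thesis using 0 unfolding nondegenerate_def power2_eq_square by (metis less_trans nat_neq_iff)
qed

text \<open>Let W be the set of nonreal roots. The double product \<open>PW\<close> of
  \<open>u (a * b)\<close> over W contains each short-root factor twice, each long-root factor once
  and 1 - Y exactly 2t times. Both \<open>PW\<close> and the long-root product \<open>L\<close> can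
  be evaluated by completing W to the group of all roots, so the square of the left side is known;
  the constant coefficient 1 then picks the sign.\<close>

lemma weyl_poly_root_points:
  fixes Y :: "complex fps"
  assumes t: "t \<ge> 1" and Y: "fps_nth Y 0 = 0"
  shows "weyl_poly t (root_points t) Y * (1 - Y) ^ (t + 1)
    = (1 - Y ^ (2 * (t + 1))) ^ (t - 1) * (1 - Y\<^sup>2) * (1 - Y ^ (t + 1))"
proof -
  define N where "N = 2 * (t + 1)"
  define W where "W = nonreal_roots t"
  define z where "z = root_points t"
  define R where "R = {z :: complex. z ^ N = 1}"
  define u where "u a = 1 - fps_const a * Y" for a
  define L where "L = (\<Prod>a\<in>W. u (a\<^sup>2))"
  define S where "S = (\<Prod>i<t. \<Prod>j<i. (u (z i * z j) * u (inverse (z i * z j))) * (u (z i / z j) * u (inverse (z i / z j))))"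
  define PW where "PW = (\<Prod>a\<in>W. \<Prod>b\<in>W. u (a * b))"
  have unit: "1 - Z \<noteq> 0" if "fps_nth Z 0 = 0" for Z :: "complex fps"
  proof
    assume "1 - Z = 0" then have "fps_nth (1 - Z) 0 = 0" by simp
    then show False using that by simp
  qed
  have pw0: "fps_nth (Y ^ n) 0 = 0" if "n > 0" for n using Y that by (simp add: fps_nth_power_0)
  have z0: "z i \<noteq> 0" for i by (simp add: z_def root_points_def)
  have finR: "finite R" using card_nonreal_roots(2)[of t] unfolding nonreal_roots_def R_def N_def by simp
  have R_W: "R = insert 1 (insert (- 1) W)" "1 \<notin> W" "- 1 \<notin> W"
    by (auto simp: R_def W_def nonreal_roots_def N_def)
  have prodR: "(\<Prod>a\<in>R. h a) = h 1 * (h (- 1) * (\<Prod>a\<in>W. h a))" for h :: "complex \<Rightarrow> complex fps"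
    unfolding R_W(1) using finR R_W by (subst prod.insert) (auto simp: R_W(1))
  have root: "(\<Prod>a\<in>R. 1 - fps_const a * Z) = 1 - Z ^ N" if "fps_nth Z 0 = 0" for Z
    unfolding R_def by (rule roots_of_unity_prod_fps) (use that in \<open>auto simp: N_def\<close>)
  have f: "weyl_poly t z Y = L * S"
    unfolding weyl_poly_def L_def S_def W_def nonreal_roots_prod u_def z_def power_inverse ..
  have um1: "u (- a) = 1 + fps_const a * Y" for a
    by (simp add: u_def flip: fps_const_neg)
  have A: "(\<Prod>a\<in>W. u a) * (1 - Y\<^sup>2) = 1 - Y ^ N"
    using root[OF Y] unfolding prodR u_def by (simp add: algebra_simps power2_eq_square flip: fps_const_neg)
  have A': "(\<Prod>a\<in>W. u (- a)) * (1 - Y\<^sup>2) = 1 - Y ^ N"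
  proof -
    have "even N" by (simp add: N_def)
    then have "(\<Prod>a\<in>R. 1 - fps_const a * (- Y)) = 1 - Y ^ N" using root[of "- Y"] Y by simp
    then show ?thesis unfolding prodR um1 by (simp add: algebra_simps power2_eq_square flip: fps_const_neg)
  qed
  \<comment> \<open>Squaring maps the roots of order 2(t + 1) two-to-one onto those of order t + 1.
    The roots 1 and -1, missing from W, account for \<open>(1 - Y)\<^sup>2\<close>.\<close>
  have L: "L * (1 - Y)\<^sup>2 = (1 - Y ^ (t + 1))\<^sup>2"
  proof -
    have "(\<Prod>a\<in>R. u (a\<^sup>2)) = (1 - Y ^ (t + 1))\<^sup>2"
    proof -
      define w where "w = cis (2 * pi / real N)"
      have "(\<Prod>a\<in>R. u (a\<^sup>2)) = (\<Prod>k<N. u ((w ^ k)\<^sup>2))"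
        unfolding R_def N_def w_def by (rule prod.reindex_bij_betw[OF root_points_bij, symmetric])
      also have "{..<N} = {..<t+1} \<union> {t+1..<N}" by (auto simp: N_def)
      also have "(\<Prod>k\<in>{..<t+1} \<union> {t+1..<N}. u ((w ^ k)\<^sup>2)) = (\<Prod>k<t+1. u ((w ^ k)\<^sup>2)) * (\<Prod>k\<in>{t+1..<N}. u ((w ^ k)\<^sup>2))"
        by (rule prod.union_disjoint) auto
      also have "(\<Prod>k\<in>{t+1..<N}. u ((w ^ k)\<^sup>2)) = (\<Prod>k<t+1. u ((w ^ (k + (t + 1)))\<^sup>2))"
        by (rule prod.reindex_bij_witness[of _ "\<lambda>k. k + (t + 1)" "\<lambda>k. k - (t + 1)"]) (auto simp: N_def)
      also have "\<dots> = (\<Prod>k<t+1. u ((w ^ k)\<^sup>2))"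
      proof -
        have "w ^ (t + 1) = - 1" using root_points_facts(2)[of t] by (simp only: w_def N_def)
        then have "(w ^ (k + (t + 1)))\<^sup>2 = (w ^ k)\<^sup>2" for k
          unfolding power_add[of w k "t + 1"] by simp
        then show ?thesis by simp
      qed
      also have "(\<Prod>k<t+1. u ((w ^ k)\<^sup>2)) = (\<Prod>a | a ^ (t + 1) = 1. u a)"
      proof -
        have e: "(w ^ k)\<^sup>2 = cis (2 * pi * real k / real (t + 1))" for k
        proof -
          have "real 2 * (real k * (2 * pi / real (2 * (t + 1)))) = 2 * pi * real k / real (t + 1)"
            by (simp add: field_simps)
          then show ?thesis unfolding w_def N_def power_mult[symmetric] Complex.DeMoivre by (simp only:)
        qed
        show ?thesis unfolding e by (rule prod.reindex_bij_betw[OF Complex.bij_betw_roots_unity]) simp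
      qed
      also have "\<dots> = 1 - Y ^ (t + 1)" unfolding u_def by (rule roots_of_unity_prod_fps) (use Y in auto)
      finally show ?thesis by (simp add: power2_eq_square)
    qed
    then show ?thesis unfolding prodR L_def by (simp add: u_def power2_eq_square mult_ac)
  qed
  \<comment> \<open>Multiplication by an element of W permutes all roots, so each inner product is 1
    - Y^N once the factors for b = 1 and b = -1 are supplied.\<close>
  have PW: "PW * (1 - Y ^ N)\<^sup>2 = (1 - Y ^ N) ^ (2 * t) * (1 - Y\<^sup>2)\<^sup>2"
  proof -
    have "(\<Prod>b\<in>W. u (a * b)) * (u a * u (- a)) = 1 - Y ^ N" if a: "a \<in> W" for a
    proof -
      have aR: "a ^ N = 1" using a by (auto simp: W_def nonreal_roots_def N_def)
      then have a0: "a \<noteq> 0" by (auto simp: N_def)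
      have "(\<Prod>b\<in>R. u (a * b)) = (\<Prod>b\<in>R. u b)"
        by (rule prod.reindex_bij_witness[of _ "\<lambda>b. b / a" "\<lambda>b. a * b"])
           (use a0 aR in \<open>auto simp: R_def power_mult_distrib power_divide\<close>)
      also have "\<dots> = 1 - Y ^ N" using root[OF Y] by (simp add: u_def)
      finally show ?thesis unfolding prodR by (simp add: mult_ac)
    qed
    then have "(\<Prod>a\<in>W. (\<Prod>b\<in>W. u (a * b)) * (u a * u (- a))) = (1 - Y ^ N) ^ (2 * t)"
      using card_nonreal_roots(1)[of t] by (simp add: W_def)
    then have "PW * ((\<Prod>a\<in>W. u a) * (\<Prod>a\<in>W. u (- a))) = (1 - Y ^ N) ^ (2 * t)"
      by (simp add: PW_def prod.distrib)
    note e = this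
    have "PW * (1 - Y ^ N)\<^sup>2 = PW * (((\<Prod>a\<in>W. u a) * (1 - Y\<^sup>2)) * ((\<Prod>a\<in>W. u (- a)) * (1 - Y\<^sup>2)))"
      unfolding A A' power2_eq_square[of "1 - Y ^ N"] ..
    also have "\<dots> = PW * ((\<Prod>a\<in>W. u a) * (\<Prod>a\<in>W. u (- a))) * (1 - Y\<^sup>2)\<^sup>2"
      by (simp only: power2_eq_square mult_ac)
    finally show ?thesis unfolding e .
  qed
  have PW': "PW = (1 - Y ^ N) ^ (2 * (t - 1)) * (1 - Y\<^sup>2)\<^sup>2"
  proof -
    have "2 * t = 2 * (t - 1) + 2" using t by simp
    then have "PW * (1 - Y ^ N)\<^sup>2 = ((1 - Y ^ N) ^ (2 * (t - 1)) * (1 - Y\<^sup>2)\<^sup>2) * (1 - Y ^ N)\<^sup>2"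
      using PW by (simp only: power_add mult_ac)
    moreover have "(1 - Y ^ N)\<^sup>2 \<noteq> 0" using unit[OF pw0, of N] by (simp add: N_def)
    ultimately show ?thesis using mult_right_cancel by blast
  qed
  have PWS: "PW = L * ((1 - Y) ^ (2 * t) * S\<^sup>2)"
  proof -
    define H where "H i j = (u (z i * z j) * u (inverse (z i * z j))) * (u (z i / z j) * u (inverse (z i / z j)))" for i j
    have "PW = (\<Prod>i<t. (\<Prod>b\<in>W. u (z i * b)) * (\<Prod>b\<in>W. u (inverse (z i) * b)))"
      unfolding PW_def W_def nonreal_roots_prod[of "\<lambda>a. \<Prod>b\<in>nonreal_roots t. u (a * b)"] z_def ..
    also have "\<dots> = (\<Prod>i<t. \<Prod>j<t. H i j)"
    proof (intro prod.cong refl)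
      fix i
      have "(\<Prod>b\<in>W. u (z i * b)) * (\<Prod>b\<in>W. u (inverse (z i) * b)) =
        (\<Prod>j<t. (u (z i * z j) * u (z i * inverse (z j))) * (u (inverse (z i) * z j) * u (inverse (z i) * inverse (z j))))"
        unfolding W_def nonreal_roots_prod z_def by (simp only: prod.distrib)
      also have "\<dots> = (\<Prod>j<t. H i j)"
        unfolding H_def by (intro prod.cong refl) (simp add: divide_inverse mult_ac)
      finally show "(\<Prod>b\<in>W. u (z i * b)) * (\<Prod>b\<in>W. u (inverse (z i) * b)) = (\<Prod>j<t. H i j)" .
    qed
    also have "\<dots> = (\<Prod>i<t. H i i) * (\<Prod>i<t. \<Prod>j<i. H i j)\<^sup>2"
      by (rule prod_symmetric) (simp add: H_def mult_ac)
    also have "(\<Prod>i<t. \<Prod>j<i. H i j) = S" by (simp add: S_def H_def)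
    also have "(\<Prod>i<t. H i i) = (\<Prod>i<t. (u ((z i)\<^sup>2) * u ((inverse (z i))\<^sup>2)) * (1 - Y)\<^sup>2)"
      using z0 by (intro prod.cong refl) (simp add: H_def u_def power2_eq_square)
    also have "\<dots> = L * (1 - Y) ^ (2 * t)"
      unfolding L_def W_def nonreal_roots_prod z_def by (simp add: prod.distrib power_mult)
    finally show ?thesis by (simp add: mult_ac)
  qed
  define P where "P = weyl_poly t z Y * (1 - Y) ^ (t + 1)"
  define T where "T = (1 - Y ^ N) ^ (t - 1) * (1 - Y\<^sup>2) * (1 - Y ^ (t + 1))"
  have "P\<^sup>2 = (L * (1 - Y)\<^sup>2) * (L * ((1 - Y) ^ (2 * t) * S\<^sup>2))"
  proof -
    have "((1 - Y) ^ (t + 1))\<^sup>2 = (1 - Y)\<^sup>2 * (1 - Y) ^ (2 * t)"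
      by (simp only: power_mult[symmetric] power_add[symmetric]) (simp add: mult.commute)
    then show ?thesis unfolding P_def f power_mult_distrib by (simp only: power2_eq_square[of L] mult_ac)
  qed
  also have "\<dots> = (1 - Y ^ (t + 1))\<^sup>2 * ((1 - Y ^ N) ^ (2 * (t - 1)) * (1 - Y\<^sup>2)\<^sup>2)"
    unfolding L PWS[symmetric] PW' ..
  also have "\<dots> = T\<^sup>2" unfolding T_def power_mult_distrib by (simp add: mult_ac flip: power_mult)
  finally have "P = T \<or> P = - T" by (simp add: power2_eq_iff)
  moreover have "P \<noteq> - T"
  proof
    assume "P = - T"
    moreover have "fps_nth P 0 = 1"
      using Y by (simp add: P_def weyl_poly_def fps_nth_prod_0 fps_nth_power_0)
    moreover have "fps_nth T 0 = 1"
      using Y pw0[of N] pw0[of "t + 1"] by (simp add: T_def fps_nth_power_0 N_def del: power_Suc)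
    ultimately show False by simp
  qed
  ultimately show ?thesis by (simp add: P_def T_def z_def N_def)
qed

definition tail_prod :: "nat \<Rightarrow> (nat \<Rightarrow> complex) \<Rightarrow> complex fps" where
  "tail_prod t z = (\<Prod>i<t. theta_tail ((z i)\<^sup>2)) * (\<Prod>i<t. \<Prod>j<i. theta_tail (z i * z j) * theta_tail (z i / z j))"

lemma tail_prod_eq_iprod: "tail_prod t z = iprod (\<lambda>n. weyl_poly t z (fps_X ^ n))"
  and tame_weyl_poly: "tame (\<lambda>n. weyl_poly t z (fps_X ^ n))"
proof -
  show "tame (\<lambda>n. weyl_poly t z (fps_X ^ n))"
    unfolding weyl_poly_def by (intro tame_mult tame_prod tame_theta_tail)
  show "tail_prod t z = iprod (\<lambda>n. weyl_poly t z (fps_X ^ n))"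
    unfolding weyl_poly_def tail_prod_def theta_tail_def
    by (simp only: iprod_mult iprod_prod tame_mult tame_prod tame_theta_tail)
qed

lemma prod_fps_const: "(\<Prod>i\<in>A. fps_const (f i)) = fps_const (\<Prod>i\<in>A. f i :: 'a::comm_ring_1)"
  by (induction A rule: infinite_finite_induct) auto

lemma theta_prod_factored:
  assumes "\<And>i. i < t \<Longrightarrow> z i \<noteq> 0"
  shows "theta_prod t z = fps_const (weyl_prod t z) * euler_prod ^ (t * t) * tail_prod t z"
proof -
  have chi: "chi (z i) = fps_const (inverse (z i) * (1 - (z i)\<^sup>2)) * (euler_prod * theta_tail ((z i)\<^sup>2))" if "i < t" for i
    unfolding chi_def using assms[OF that] by (subst theta_triple_product) (auto simp: mult_ac simp flip: fps_const_mult)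
  have psi: "psi (z i) (z j) = fps_const (inverse (z i) * ((1 - z i * z j) * (1 - z i / z j))) *
      (euler_prod\<^sup>2 * (theta_tail (z i * z j) * theta_tail (z i / z j)))" if "j < i" "i < t" for i j
  proof -
    have "z i \<noteq> 0" "z j \<noteq> 0" using assms that by auto
    then have "theta (z i * z j) = fps_const (1 - z i * z j) * euler_prod * theta_tail (z i * z j)"
      "theta (z i / z j) = fps_const (1 - z i / z j) * euler_prod * theta_tail (z i / z j)"
      by (auto intro!: theta_triple_product)
    then show ?thesis unfolding psi_def fps_const_mult[symmetric] by (simp only: power2_eq_square mult_ac)
  qed
  \<comment> \<open>Each \<open>chi\<close> brings one Euler product and each \<open>psi\<close>
    two: t + 2 t(t - 1)/2 = t^2.\<close>
  have e: "(\<Prod>i<t. euler_prod) * (\<Prod>i<t. \<Prod>j<i. euler_prod\<^sup>2) = euler_prod ^ (t * t)"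
  proof -
    have "euler_prod ^ n * (\<Prod>i<n. \<Prod>j<i. euler_prod\<^sup>2) = euler_prod ^ (n * n)" for n
    proof (induction n)
      case (Suc n)
      have "euler_prod ^ Suc n * (\<Prod>i<Suc n. \<Prod>j<i. euler_prod\<^sup>2)
        = (euler_prod ^ n * (\<Prod>i<n. \<Prod>j<i. euler_prod\<^sup>2)) * (euler_prod * (euler_prod\<^sup>2) ^ n)" by (simp add: mult_ac)
      also have "\<dots> = euler_prod ^ (n * n + 1 + 2 * n)"
        unfolding Suc power_mult[symmetric] by (simp only: power_add power_one_right mult_ac)
      also have "n * n + 1 + 2 * n = Suc n * Suc n" by simp
      finally show ?case .
    qed simp
    then show ?thesis by simp
  qed
  have "theta_prod t z = (\<Prod>i<t. fps_const (inverse (z i) * (1 - (z i)\<^sup>2)) * (euler_prod * theta_tail ((z i)\<^sup>2))) *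
    (\<Prod>i<t. \<Prod>j<i. fps_const (inverse (z i) * ((1 - z i * z j) * (1 - z i / z j))) *
      (euler_prod\<^sup>2 * (theta_tail (z i * z j) * theta_tail (z i / z j))))"
    unfolding theta_prod_def by (intro arg_cong2[of _ _ _ _ "(*)"] prod.cong refl) (auto simp: chi psi)
  also have "\<dots> = fps_const (weyl_prod t z) * ((\<Prod>i<t. euler_prod) * (\<Prod>i<t. \<Prod>j<i. euler_prod\<^sup>2)) * tail_prod t z"
    unfolding prod.distrib prod_fps_const weyl_prod_def tail_prod_def fps_const_mult[symmetric] by (simp only: mult_ac)
  finally show ?thesis unfolding e .
qed

definition euler_prod_dilated :: "nat \<Rightarrow> complex fps" where
  "euler_prod_dilated m = iprod (\<lambda>n. 1 - fps_X ^ (m * n))"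

lemma tame_dilated: "m \<ge> 1 \<Longrightarrow> tame (\<lambda>n. 1 - fps_X ^ (m * n))"
  using tame_linear[of "\<lambda>n. m * n" 1] by simp

lemma tame_dilated_plus: "m \<ge> 1 \<Longrightarrow> tame (\<lambda>n. 1 + fps_X ^ (m * n))"
  using tame_linear[of "\<lambda>n. m * n" "- 1"] by (simp flip: fps_const_neg)

text \<open>Let c = t + 1. The residues c - k and c + k for 1 \<le> k \<le> t are all residues
  modulo 2c except 0 and c. After multiplication by the product of 1 + X^(cn), which supplies these
  two, the plus factors combine to the product of all 1 + X^n; then 1 + Y = (1 - Y^2)/(1 - Y)
  converts everything to dilated Euler products.\<close>

lemma quadratic_theta_prod:
  assumes t: "t \<ge> 1"
  shows "(\<Prod>k=1..t. quadratic_theta (t + 1) k) * euler_prod =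
    euler_prod_dilated (2 * (t + 1)) ^ (t - 1) * euler_prod_dilated 2 * euler_prod_dilated (t + 1)"
proof -
  define c where "c = t + 1"
  define F where "F k n = (1 - fps_X ^ (2 * c * n) :: complex fps) * ((1 + fps_X ^ (2 * c * n - (c - k))) * (1 + fps_X ^ (2 * c * n - (c + k))))"
    for k n :: nat
  define p where "p n = (1 + fps_X ^ n :: complex fps)" for n :: nat
  define \<Gamma> where "\<Gamma> = (\<Prod>k=1..t. quadratic_theta c k)"
  have tF: "tame (F k)" and qF: "quadratic_theta c k = iprod (F k)" if "k \<in> {1..t}" for k
    using quadratic_theta_product[of k c] that unfolding F_def[abs_def] c_def by auto
  have tp: "tame p" using tame_dilated_plus[of 1] by (simp add: p_def[abs_def])
  have tpc: "tame (\<lambda>n. p (c * n))" using tame_dilated_plus[of c] by (simp add: p_def c_def)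
  have \<Gamma>: "\<Gamma> = iprod (\<lambda>n. \<Prod>k=1..t. F k n)"
    unfolding \<Gamma>_def using qF tF iprod_prod[of "{1..t}" F] by simp
  \<comment> \<open>In blocks of two the exponents c(2n - r) are 2cn and 2cn - c, precisely the two
    missing residues.\<close>
  have Ec: "iprod (\<lambda>n. p (c * n)) = iprod (\<lambda>n. \<Prod>r<2. p (c * (2 * n - r)))"
    using iprod_residues[OF tpc, of 2] by simp
  have tEc: "tame (\<lambda>n. \<Prod>r<2. p (c * (2 * n - r)))"
  proof (intro tame_prod)
    fix r :: nat assume "r \<in> {..<2}"
    then have "n \<le> c * (2 * n - r)" if "n \<ge> 1" for n
    proof -
      have "n \<le> 2 * n - r" using \<open>r \<in> {..<2}\<close> \<open>n \<ge> 1\<close> by auto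
      also have "\<dots> \<le> c * (2 * n - r)" by (simp add: c_def)
      finally show ?thesis .
    qed
    then show "tame (\<lambda>n. p (c * (2 * n - r)))" unfolding p_def
      using tame_linear[of "\<lambda>n. c * (2 * n - r)" "- 1"] by (simp flip: fps_const_neg)
  qed
  have fac: "(\<Prod>k=1..t. F k n) * (\<Prod>r<2. p (c * (2 * n - r))) = (1 - fps_X ^ (2 * c * n)) ^ t * (\<Prod>r<2*c. p (2 * c * n - r))"
    if "n \<ge> 1" for n
  proof -
    have s: "{..<2 * c} = {0, c} \<union> ((\<lambda>k. c - k) ` {1..t} \<union> (\<lambda>k. c + k) ` {1..t})"
    proof
      show "{..<2 * c} \<subseteq> {0, c} \<union> ((\<lambda>k. c - k) ` {1..t} \<union> (\<lambda>k. c + k) ` {1..t})"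
      proof
        fix r assume r: "r \<in> {..<2 * c}"
        consider "r = 0" | "r = c" | "0 < r" "r < c" | "c < r" by linarith
        then show "r \<in> {0, c} \<union> ((\<lambda>k. c - k) ` {1..t} \<union> (\<lambda>k. c + k) ` {1..t})"
        proof cases
          case 3
          then have "r = c - (c - r)" "c - r \<in> {1..t}" by (auto simp: c_def)
          then show ?thesis by blast
        next
          case 4
          then have "r = c + (r - c)" "r - c \<in> {1..t}" using r by (auto simp: c_def)
          then show ?thesis by blast
        qed auto
      qed
    qed (auto simp: c_def)
    have d: "{0, c} \<inter> ((\<lambda>k. c - k) ` {1..t} \<union> (\<lambda>k. c + k) ` {1..t}) = {}"
      "(\<lambda>k. c - k) ` {1..t} \<inter> (\<lambda>k. c + k) ` {1..t} = {}" by (auto simp: c_def)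
    have "(\<Prod>r<2*c. p (2 * c * n - r)) = (\<Prod>r\<in>{0, c}. p (2 * c * n - r)) *
       ((\<Prod>r\<in>(\<lambda>k. c - k) ` {1..t}. p (2 * c * n - r)) * (\<Prod>r\<in>(\<lambda>k. c + k) ` {1..t}. p (2 * c * n - r)))"
      unfolding s using d by (simp only: prod.union_disjoint finite_imageI finite_atLeastAtMost finite_UnI finite.intros)
    also have "(\<Prod>r\<in>{0, c}. p (2 * c * n - r)) = p (2 * c * n) * p (2 * c * n - c)"
      by (subst prod.insert) (auto simp: c_def)
    also have "(\<Prod>r\<in>(\<lambda>k. c - k) ` {1..t}. p (2 * c * n - r)) = (\<Prod>k=1..t. p (2 * c * n - (c - k)))"
      by (subst prod.reindex) (auto simp: inj_on_def c_def)
    also have "(\<Prod>r\<in>(\<lambda>k. c + k) ` {1..t}. p (2 * c * n - r)) = (\<Prod>k=1..t. p (2 * c * n - (c + k)))"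
      by (subst prod.reindex) (auto simp: inj_on_def)
    finally have 1: "(\<Prod>r<2*c. p (2 * c * n - r)) = p (2 * c * n) * p (2 * c * n - c) *
      ((\<Prod>k=1..t. p (2 * c * n - (c - k))) * (\<Prod>k=1..t. p (2 * c * n - (c + k))))" .
    have "{..<2} = {0, 1::nat}" by auto
    then have 2: "(\<Prod>r<2. p (c * (2 * n - r))) = p (2 * c * n) * p (2 * c * n - c)"
      by (simp add: diff_mult_distrib2 mult_ac)
    have 3: "(\<Prod>k=1..t. F k n) = (1 - fps_X ^ (2 * c * n)) ^ t *
      ((\<Prod>k=1..t. p (2 * c * n - (c - k))) * (\<Prod>k=1..t. p (2 * c * n - (c + k))))"
      unfolding F_def p_def[symmetric] by (simp add: prod.distrib)
    show ?thesis unfolding 1 2 3 by (simp only: mult_ac)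
  qed
  have "\<Gamma> * iprod (\<lambda>n. p (c * n)) = iprod (\<lambda>n. (\<Prod>k=1..t. F k n) * (\<Prod>r<2. p (c * (2 * n - r))))"
    unfolding \<Gamma> Ec 
  proof (rule iprod_mult[symmetric])
    show "tame (\<lambda>n. \<Prod>k=1..t. F k n)" by (intro tame_prod tF)
    show "tame (\<lambda>n. \<Prod>r<2. p (c * (2 * n - r)))" by (rule tEc)
  qed
  also have "\<dots> = iprod (\<lambda>n. (1 - fps_X ^ (2 * c * n)) ^ t * (\<Prod>r<2*c. p (2 * c * n - r)))"
    by (rule iprod_cong) (rule fac)
  also have "\<dots> = iprod (\<lambda>n. (1 - fps_X ^ (2 * c * n)) ^ t) * iprod (\<lambda>n. \<Prod>r<2*c. p (2 * c * n - r))"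
  proof (rule iprod_mult)
    show "tame (\<lambda>n. (1 - fps_X ^ (2 * c * n)) ^ t)" by (intro tame_power tame_dilated) (simp add: c_def)
    show "tame (\<lambda>n. \<Prod>r<2*c. p (2 * c * n - r))"
    proof (intro tame_prod)
      fix r assume r: "r \<in> {..<2*c}"
      have "n \<le> 2 * c * n - r" if n1: "n \<ge> 1" for n
      proof -
        obtain n' where n': "n = Suc n'" using n1 by (cases n) auto
        have "n' \<le> 2 * c * n'" "2 * c * n = 2 * c + 2 * c * n'" using n' by (simp_all add: c_def)
        moreover have "r < 2 * c" using r by simp
        ultimately show ?thesis using n' by linarith
      qed
      then show "tame (\<lambda>n. p (2 * c * n - r))" unfolding p_def
        using tame_linear[of "\<lambda>n. 2 * c * n - r" "- 1"] by (simp flip: fps_const_neg)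
    qed
  qed
  also have "\<dots> = euler_prod_dilated (2 * c) ^ t * iprod p"
    using iprod_residues[OF tp, of "2 * c"] tame_dilated[of "2 * c"]
    by (simp add: iprod_power euler_prod_dilated_def c_def)
  finally have 1: "\<Gamma> * iprod (\<lambda>n. p (c * n)) = euler_prod_dilated (2 * c) ^ t * iprod p" .
  have sq: "(1 + Y) * (1 - Y) = 1 - Y * Y" for Y :: "complex fps" by (simp add: algebra_simps)
  have 2: "iprod p * euler_prod = euler_prod_dilated 2"
    unfolding euler_prod_def euler_prod_dilated_def using tp tame_one_minus_X
    by (subst iprod_mult[symmetric]) (auto simp: p_def sq mult_2 power_add)
  have 3: "iprod (\<lambda>n. p (c * n)) * euler_prod_dilated c = euler_prod_dilated (2 * c)"
  proof -
    have e: "fps_X ^ (c * n) * fps_X ^ (c * n) = (fps_X ^ (2 * c * n) :: complex fps)" for n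
      by (simp add: power_add[symmetric] mult_2 distrib_right)
    have "tame (\<lambda>n. 1 - fps_X ^ (c * n))" by (rule tame_dilated) (simp add: c_def)
    then show ?thesis
      unfolding euler_prod_dilated_def by (subst iprod_mult[OF tpc, symmetric]) (simp_all only: p_def sq e)
  qed
  have "(\<Gamma> * euler_prod) * euler_prod_dilated (2 * c)
      = (\<Gamma> * iprod (\<lambda>n. p (c * n))) * euler_prod * euler_prod_dilated c"
    unfolding 3[symmetric] by (simp only: mult_ac)
  also have "\<dots> = euler_prod_dilated (2 * c) ^ t * (iprod p * euler_prod) * euler_prod_dilated c"
    unfolding 1 by (simp only: mult_ac)
  also have "\<dots> = euler_prod_dilated (2 * c) ^ (t - 1) * euler_prod_dilated 2 * euler_prod_dilated c * euler_prod_dilated (2 * c)"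
  proof -
    have "euler_prod_dilated (2 * c) ^ t = euler_prod_dilated (2 * c) * euler_prod_dilated (2 * c) ^ (t - 1)"
      using t by (simp flip: power_Suc)
    then show ?thesis unfolding 2 by (simp only: mult_ac)
  qed
  finally have "\<Gamma> * euler_prod = euler_prod_dilated (2 * c) ^ (t - 1) * euler_prod_dilated 2 * euler_prod_dilated c"
    using mult_right_cancel iprod_nonzero unfolding euler_prod_dilated_def by blast
  then show ?thesis by (simp add: \<Gamma>_def c_def)
qed

text \<open>Multiplied by \<open>euler_prod\<close>, both sides equal the same product of dilated
  Euler products: the left one by \<open>quadratic_theta_prod\<close>, the right one by applying
  \<open>weyl_poly_root_points\<close> to Y = X^n for every n.\<close>

lemma quadratic_theta_prod_eq:
  assumes t: "t \<ge> 1"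
  shows "(\<Prod>k=1..t. quadratic_theta (t + 1) k) = euler_prod ^ t * tail_prod t (root_points t)"
proof -
  have "euler_prod ^ (t + 1) * tail_prod t (root_points t)
      = iprod (\<lambda>n. weyl_poly t (root_points t) (fps_X ^ n) * (1 - fps_X ^ n) ^ (t + 1))"
    unfolding tail_prod_eq_iprod euler_prod_def
    using tame_weyl_poly tame_one_minus_X
    by (subst iprod_mult) (auto intro: tame_power simp: iprod_power mult.commute simp del: power_Suc)
  also have "\<dots> = iprod (\<lambda>n. (1 - fps_X ^ (2 * (t + 1) * n)) ^ (t - 1) * (1 - fps_X ^ (2 * n)) * (1 - fps_X ^ ((t + 1) * n)))"
  proof (rule iprod_cong)
    fix n :: nat assume n: "n \<ge> 1"
    have e: "(fps_X ^ n) ^ m = (fps_X ^ (m * n) :: complex fps)" for m by (simp add: power_mult[symmetric] mult.commute)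
    show "weyl_poly t (root_points t) (fps_X ^ n) * (1 - fps_X ^ n) ^ (t + 1)
      = (1 - fps_X ^ (2 * (t + 1) * n)) ^ (t - 1) * (1 - fps_X ^ (2 * n)) * (1 - fps_X ^ ((t + 1) * n))"
      using weyl_poly_root_points[OF t, of "fps_X ^ n"] n unfolding e by simp
  qed
  also have "\<dots> = euler_prod_dilated (2 * (t + 1)) ^ (t - 1) * euler_prod_dilated 2 * euler_prod_dilated (t + 1)"
  proof -
    have "tame (\<lambda>n. 1 - fps_X ^ (2 * (t + 1) * n))" "tame (\<lambda>n. 1 - fps_X ^ (2 * n))" "tame (\<lambda>n. 1 - fps_X ^ ((t + 1) * n))"
      by (intro tame_dilated; simp)+
    then show ?thesis unfolding euler_prod_dilated_def
      by (simp only: iprod_mult tame_mult tame_power iprod_power)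
  qed
  also have "\<dots> = (\<Prod>k=1..t. quadratic_theta (t + 1) k) * euler_prod"
    by (rule quadratic_theta_prod[OF t, symmetric])
  finally have "(\<Prod>k=1..t. quadratic_theta (t + 1) k) * euler_prod = (euler_prod ^ t * tail_prod t (root_points t)) * euler_prod"
    by (simp only: power_add power_one_right mult_ac)
  moreover have "euler_prod \<noteq> 0" unfolding euler_prod_def by (rule iprod_nonzero)
  ultimately show ?thesis using mult_right_cancel by blast
qed

section \<open>The theta determinant at the roots of unity\<close>

lemma det_scale_columns:
  "det (mat n n (\<lambda>(i, j). A i j * g j :: 'a::comm_ring_1)) = det (mat n n (\<lambda>(i, j). A i j)) * (\<Prod>j<n. g j)"
proof -
  have "det (mat n n (\<lambda>(i, j). A i j * g j)) = (\<Sum>p | p permutes {0..<n}. signof p * (\<Prod>i=0..<n. A i (p i) * g (p i)))"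
    by (subst det_def'[of _ n]) (auto intro!: sum.cong prod.cong simp: permutes_in_image)
  also have "\<dots> = (\<Sum>p | p permutes {0..<n}. signof p * (\<Prod>i=0..<n. A i (p i)) * (\<Prod>j<n. g j))"
  proof (intro sum.cong refl)
    fix p assume "p \<in> {p. p permutes {0..<n}}"
    then have "(\<Prod>i=0..<n. g (p i)) = (\<Prod>j=0..<n. g j)"
      using prod.permute[of p "{0..<n}" g] by (simp add: o_def)
    then show "signof p * (\<Prod>i=0..<n. A i (p i) * g (p i)) = signof p * (\<Prod>i=0..<n. A i (p i)) * (\<Prod>j<n. g j)"
      by (simp add: prod.distrib mult.assoc lessThan_atLeast0)
  qed
  also have "\<dots> = det (mat n n (\<lambda>(i, j). A i j)) * (\<Prod>j<n. g j)"
    by (subst det_def'[of _ n]) (auto intro!: sum.cong prod.cong simp: permutes_in_image sum_distrib_right)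
  finally show ?thesis .
qed

lemma det_fps_const:
  "det (mat n n (\<lambda>(i, j). fps_const (A i j :: 'a::comm_ring_1))) = fps_const (det (mat n n (\<lambda>(i, j). A i j)))"
proof -
  interpret comm_ring_hom "fps_const :: 'a \<Rightarrow> 'a fps" by unfold_locales auto
  have "mat n n (\<lambda>(i, j). fps_const (A i j)) = map_mat fps_const (mat n n (\<lambda>(i, j). A i j))"
    by (intro eq_matI) auto
  then show ?thesis by (simp only: hom_det)
qed

text \<open>The sum of u^k over a full period is 0 or 2(t + 1). The terms k = 0 and k = t + 1 are
  subtracted, and the upper half of the period is rewritten with inverses.\<close>

lemma root_of_unity_power_sum:
  fixes u :: complex
  assumes "u ^ (2 * (t + 1)) = 1"
  shows "(\<Sum>k=1..t. u ^ k + inverse u ^ k) = (if u = 1 then 2 * of_nat (t + 1) else 0) - 1 - u ^ (t + 1)"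
proof -
  have u0: "u \<noteq> 0" using assms by auto
  have "(\<Sum>k<2*(t+1). u ^ k) = (if u = 1 then 2 * of_nat (t + 1) else 0)"
  proof (cases "u = 1")
    case False
    then show ?thesis using geometric_sum[of u "2 * (t + 1)"] by (simp only: assms) simp
  qed simp
  moreover have "{..<2*(t+1)} = {0, t + 1} \<union> ({1..t} \<union> {t+2..2*t+1})" by auto
  then have "(\<Sum>k<2*(t+1). u ^ k) = (\<Sum>k\<in>{0, t + 1} \<union> ({1..t} \<union> {t+2..2*t+1}). u ^ k)" by simp
  moreover have "(\<Sum>k\<in>{0, t + 1} \<union> ({1..t} \<union> {t+2..2*t+1}). u ^ k)
      = (1 + u ^ (t + 1)) + ((\<Sum>k=1..t. u ^ k) + (\<Sum>k=t+2..2*t+1. u ^ k))"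
    by (subst sum.union_disjoint, simp, simp, force, subst sum.union_disjoint, auto)
  moreover have "(\<Sum>k=t+2..2*t+1. u ^ k) = (\<Sum>k=1..t. inverse u ^ k)"
  proof (rule sum.reindex_bij_witness[of _ "\<lambda>k. 2 * (t + 1) - k" "\<lambda>k. 2 * (t + 1) - k"])
    fix k assume k: "k \<in> {t+2..2*t+1}"
    then have "u ^ (2 * (t + 1) - k) * u ^ k = 1" using assms by (simp only: power_add[symmetric]) simp
    then show "inverse u ^ (2 * (t + 1) - k) = u ^ k" using u0 by (metis inverse_unique power_inverse)
  qed auto
  ultimately show ?thesis by (simp add: sum.distrib algebra_simps)
qed

text \<open>Up to the factor 2i in each entry this is the matrix of the discrete sine transform.
  Orthogonality makes its square the scalar matrix -2(t + 1).\<close>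

lemma root_points_det_nonzero:
  "det (mat t t (\<lambda>(i, j). root_points t i ^ Suc j - inverse (root_points t i) ^ Suc j)) \<noteq> 0"
proof -
  define z where "z = root_points t"
  define S where "S = mat t t (\<lambda>(i, j). z i ^ Suc j - inverse (z i) ^ Suc j)"
  define N where "N = (2 * of_nat (t + 1) :: complex)"
  have nd: "nondegenerate t z" unfolding z_def by (rule root_points_nondegenerate)
  have zN: "z i ^ (2 * (t + 1)) = 1" if "i < t" for i
    using root_points_in(1)[OF that] by (simp add: z_def nonreal_roots_def)
  have z0: "z i \<noteq> 0" for i by (simp add: z_def root_points_def)
  \<comment> \<open>Both sides are the ((k + 1)(j + 1))-th power of one primitive root; this turns
    column powers into row powers, as orthogonality requires.\<close>
  have sym: "z k ^ Suc j = z j ^ Suc k" for k j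
    unfolding z_def root_points_def power_mult[symmetric] by (simp only: mult.commute)
  have "S * S = (- N) \<cdot>\<^sub>m 1\<^sub>m t"
  proof (rule eq_matI)
    fix i j assume "i < dim_row ((- N) \<cdot>\<^sub>m 1\<^sub>m t)" "j < dim_col ((- N) \<cdot>\<^sub>m 1\<^sub>m t)"
    then have ij: "i < t" "j < t" by auto
    define a b where "a = z i" and "b = z j"
    have ab0: "a \<noteq> 0" "b \<noteq> 0" using z0 by (auto simp: a_def b_def)
    have "(S * S) $$ (i, j) = (\<Sum>k<t. (a ^ Suc k - inverse a ^ Suc k) * (z k ^ Suc j - inverse (z k) ^ Suc j))"
      using ij by (simp add: S_def scalar_prod_def a_def lessThan_atLeast0)
    also have "\<dots> = (\<Sum>k<t. (a ^ Suc k - inverse a ^ Suc k) * (b ^ Suc k - inverse b ^ Suc k))"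
      unfolding b_def power_inverse sym[of _ j] ..
    also have "\<dots> = (\<Sum>k=1..t. (a ^ k - inverse a ^ k) * (b ^ k - inverse b ^ k))"
      by (rule sum.reindex_bij_witness[of _ "\<lambda>k. k - 1" Suc]) auto
    also have "\<dots> = (\<Sum>k=1..t. (a * b) ^ k + inverse (a * b) ^ k) - (\<Sum>k=1..t. (a / b) ^ k + inverse (a / b) ^ k)"
      unfolding sum_subtractf[symmetric] using ab0
      by (intro sum.cong refl) (simp add: power_mult_distrib power_divide field_simps)
    also have "\<dots> = ((if a * b = 1 then N else 0) - 1 - (a * b) ^ (t + 1)) - ((if a / b = 1 then N else 0) - 1 - (a / b) ^ (t + 1))"
    proof -
      have "(a * b) ^ (2 * (t + 1)) = 1" "(a / b) ^ (2 * (t + 1)) = 1"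
        using zN ij by (simp_all only: power_mult_distrib power_divide a_def b_def div_by_1 mult_1)
      then show ?thesis unfolding N_def by (simp only: root_of_unity_power_sum)
    qed
    \<comment> \<open>The power b^(t+1) squares to 1, hence is its own inverse; the two end terms
      therefore cancel.\<close>
    also have "(a * b) ^ (t + 1) = (a / b) ^ (t + 1)"
    proof -
      have "b ^ (t + 1) * b ^ (t + 1) = 1" using zN[OF ij(2)] by (simp only: power_add[symmetric] b_def mult_2)
      then have be: "b ^ (t + 1) = inverse (b ^ (t + 1))" by (metis inverse_unique)
      have "(a * b) ^ (t + 1) = a ^ (t + 1) * b ^ (t + 1)" by (rule power_mult_distrib)
      also have "\<dots> = a ^ (t + 1) * inverse (b ^ (t + 1))" using be by (rule arg_cong)
      finally show ?thesis by (simp only: power_divide divide_inverse[of "a ^ _"])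
    qed
    also have "(if a * b = 1 then N else 0) = 0"
    proof -
      have "z i * z j \<noteq> 1"
        using nd ij unfolding nondegenerate_def power2_eq_square by (metis mult.commute nat_neq_iff)
      then show ?thesis by (simp add: a_def b_def)
    qed
    also have "(if a / b = 1 then N else 0) = (if i = j then N else 0)"
      using nd ij ab0 unfolding nondegenerate_def a_def b_def by (metis divide_eq_1_iff nat_neq_iff)
    finally show "(S * S) $$ (i, j) = ((- N) \<cdot>\<^sub>m 1\<^sub>m t) $$ (i, j)" using ij by simp
  qed (auto simp: S_def)
  moreover have "S \<in> carrier_mat t t" by (simp add: S_def)
  ultimately have "det S * det S = (- N) ^ t" using det_mult[of S t S] by (simp add: det_smult)
  moreover have "N \<noteq> 0" unfolding N_def by (simp del: of_nat_Suc)
  ultimately show ?thesis unfolding S_def z_def by auto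
qed

text \<open>At such a root z^n depends only on n modulo 2c, so the antisymmetric factor leaves the
  sum over m.\<close>

lemma odd_theta_root:
  assumes z: "z ^ (2 * c) = 1" and c: "c > 0"
  shows "odd_theta (int c) (int k) z = fps_const (z ^ k - inverse z ^ k) * quadratic_theta c k"
proof -
  have z0: "z \<noteq> 0" using z c by (cases "z = 0") (auto simp: power_0_left)
  have p: "z powi (2 * int c * m) = 1" for m
  proof -
    have "z powi (int (2 * c) * m) = (z powi int (2 * c)) powi m" by (rule power_int_mult)
    also have "z powi int (2 * c) = 1" using z by (simp only: power_int_of_nat)
    finally show ?thesis by simp
  qed
  have "z powi (2 * int c * m + int k) - z powi (- (2 * int c * m + int k)) = z ^ k - inverse z ^ k" for m
    unfolding power_int_minus using z0 p[of m] by (simp add: power_int_add power_inverse)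
  then show ?thesis unfolding odd_theta_def quadratic_theta_def by (intro fps_ext) (simp add: mult.commute)
qed

text \<open>Comparison of z with the roots of unity, where the determinant factors by columns. The
  condition on the norms keeps z apart from these roots and their inverses. The existential \<kappa>
  suffices because it cancels in \<open>weyl_prod_expansion\<close>; what counts is that it is a
  nonzero number, the same for all z.\<close>

theorem theta_det_formula:
  assumes t: "t \<ge> 1"
  shows "\<exists>\<kappa>. \<kappa> \<noteq> 0 \<and> (\<forall>z. nondegenerate t z \<and> (\<forall>i<t. norm (z i) \<noteq> 1) \<longrightarrow>
     theta_det t z = fps_const (\<kappa> * weyl_prod t z) * (euler_prod ^ t * tail_prod t z))"
proof -
  define w where "w = root_points t"
  define \<delta> where "\<delta> = det (mat t t (\<lambda>(i, j). w i ^ Suc j - inverse (w i) ^ Suc j))"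
  have \<delta>: "\<delta> \<noteq> 0" unfolding \<delta>_def w_def by (rule root_points_det_nonzero)
  have w: "nondegenerate t w" unfolding w_def by (rule root_points_nondegenerate)
  have w0: "w i \<noteq> 0" for i by (simp add: w_def root_points_def)
  have normw: "norm (w i) = 1" for i by (simp add: w_def root_points_def norm_power norm_mult)
  have weyl0: "weyl_prod t w \<noteq> 0" using w by (intro weyl_prod_nonzero) (auto simp: nondegenerate_def)
  have "theta_det t w = det (mat t t (\<lambda>(i, j). fps_const (w i ^ Suc j - inverse (w i) ^ Suc j) * quadratic_theta (t + 1) (Suc j)))"
    unfolding theta_det_def
  proof (intro arg_cong[of _ _ det] eq_matI)
    fix i j assume "i < dim_row (mat t t (\<lambda>(i, j). fps_const (w i ^ Suc j - inverse (w i) ^ Suc j) * quadratic_theta (t + 1) (Suc j)))"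
      "j < dim_col (mat t t (\<lambda>(i, j). fps_const (w i ^ Suc j - inverse (w i) ^ Suc j) * quadratic_theta (t + 1) (Suc j)))"
    then have ij: "i < t" "j < t" by auto
    have "w i ^ (2 * (t + 1)) = 1" using root_points_in(1)[OF ij(1)] by (simp add: w_def nonreal_roots_def)
    from odd_theta_root[OF this, of "Suc j"]
    have "odd_theta (int t + 1) (int j + 1) (w i) = fps_const (w i ^ Suc j - inverse (w i) ^ Suc j) * quadratic_theta (t + 1) (Suc j)"
      by (simp add: add.commute)
    then show "mat t t (\<lambda>(i, j). odd_theta (int t + 1) (int j + 1) (w i)) $$ (i, j)
       = mat t t (\<lambda>(i, j). fps_const (w i ^ Suc j - inverse (w i) ^ Suc j) * quadratic_theta (t + 1) (Suc j)) $$ (i, j)"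
      using ij by simp
  qed auto
  also have "\<dots> = fps_const \<delta> * (\<Prod>j<t. quadratic_theta (t + 1) (Suc j))"
    unfolding \<delta>_def det_fps_const[symmetric] by (rule det_scale_columns)
  also have "(\<Prod>j<t. quadratic_theta (t + 1) (Suc j)) = (\<Prod>k=1..t. quadratic_theta (t + 1) k)"
    by (rule prod.reindex_bij_witness[of _ "\<lambda>k. k - 1" Suc]) auto
  finally have Dw: "theta_det t w = fps_const \<delta> * (euler_prod ^ t * tail_prod t w)"
    unfolding quadratic_theta_prod_eq[OF t] w_def .
  define X where "X = euler_prod ^ (t * t) * tail_prod t w"
  have X0: "X \<noteq> 0"
    unfolding X_def tail_prod_eq_iprod euler_prod_def using iprod_nonzero by simp
  have "theta_det t z = fps_const (\<delta> / weyl_prod t w * weyl_prod t z) * (euler_prod ^ t * tail_prod t z)"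
    if z: "nondegenerate t z" "\<forall>i<t. norm (z i) \<noteq> 1" for z
  proof -
    have z0: "z i \<noteq> 0" if "i < t" for i using z(1) that by (auto simp: nondegenerate_def)
    have zw: "z i * w j \<noteq> 1 \<and> z i \<noteq> w j" if "i < t" "j < t" for i j
    proof -
      have "norm (z i * w j) \<noteq> 1" "norm (z i) \<noteq> norm (w j)" using z(2) that by (auto simp: norm_mult normw)
      then show ?thesis by auto
    qed
    have fz: "theta_prod t z = fps_const (weyl_prod t z) * euler_prod ^ (t * t) * tail_prod t z"
      by (rule theta_prod_factored) (rule z0)
    have "theta_det t z * theta_prod t w = theta_det t w * theta_prod t z"
      using theta_det_prod_proportional[OF z(1) w zw] by blast
    then have "(theta_det t z * fps_const (weyl_prod t w)) * X
       = (fps_const \<delta> * fps_const (weyl_prod t z) * (euler_prod ^ t * tail_prod t z)) * X"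
      unfolding Dw theta_prod_factored[of t w, OF w0] fz X_def by (simp only: mult_ac)
    then have "theta_det t z * fps_const (weyl_prod t w) = fps_const \<delta> * fps_const (weyl_prod t z) * (euler_prod ^ t * tail_prod t z)"
      using X0 mult_right_cancel by blast
    then have "theta_det t z * (fps_const (weyl_prod t w) * fps_const (inverse (weyl_prod t w)))
       = fps_const (inverse (weyl_prod t w)) * fps_const \<delta> * fps_const (weyl_prod t z) * (euler_prod ^ t * tail_prod t z)"
      by (metis (no_types, opaque_lifting) mult.assoc mult.commute)
    then show ?thesis using weyl0 by (simp add: divide_inverse mult_ac)
  qed
  then show ?thesis using \<delta> weyl0 by (intro exI[of _ "\<delta> / weyl_prod t w"]) auto
qed

subsection \<open>The Macdonald identity of type C\<close>

definition residue_shift :: "nat \<Rightarrow> (nat \<Rightarrow> int) \<Rightarrow> nat \<Rightarrow> int" where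
  "residue_shift t m k = 2 * (int t + 1) * m k + (int k + 1)"

text \<open>With u_k = \<open>residue_shift t m k\<close> the summand is (u_k^2 - (k + 1)^2)/(4(t +
  1)), the exponent of x that goes with u_k in the theta series.\<close>

definition shift_weight :: "nat \<Rightarrow> (nat \<Rightarrow> int) \<Rightarrow> int" where
  "shift_weight t m = (\<Sum>k<t. (int t + 1) * (m k)\<^sup>2 + (int k + 1) * m k)"

text \<open>The box excludes no vector of this weight, since every summand of the weight is at least
  |m k| by \<open>quadratic_ge\<close>. Extensionality makes the set finite.\<close>

definition shift_vectors :: "nat \<Rightarrow> nat \<Rightarrow> (nat \<Rightarrow> int) set" where
  "shift_vectors t K = {m \<in> {..<t} \<rightarrow>\<^sub>E {-int K..int K}. shift_weight t m = int K}"

lemma fps_nth_signof_mult: "fps_nth (signof p * F) K = signof p * fps_nth (F :: complex fps) K"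
  by (simp add: sign_def)

lemma theta_det_nth:
  "fps_nth (theta_det t z) K = (\<Sum>m\<in>shift_vectors t K.
     det (mat t t (\<lambda>(i, j). z i powi residue_shift t m j - z i powi (- residue_shift t m j))))"
proof -
  define h where "h j m x = x powi (2 * (int t + 1) * m + (int j + 1)) - x powi (- (2 * (int t + 1) * m + (int j + 1)))"
    for j :: nat and m :: int and x :: complex
  define e where "e j m = (int t + 1) * m\<^sup>2 + (int j + 1) * m" for j :: nat and m
  have e0: "\<bar>m\<bar> \<le> e j m" if "j < t" for j m
    unfolding e_def using that by (intro quadratic_ge) auto
  have e0': "0 \<le> e j m" if "j < t" for j m using e0[OF that, of m] by linarith
  define S where "S = {-int K..int K}"
  define T where "T j x = (\<Sum>m\<in>S. fps_const (h j m x) * fps_X ^ nat (e j m))" for j x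
  have T: "fps_cong_below (Suc K) (odd_theta (int t + 1) (int j + 1) x) (T j x)" if j: "j < t" for j x
    unfolding fps_cong_below_def
  proof (intro allI impI)
    fix k assume "k < Suc K"
    then have "fps_nth (odd_theta (int t + 1) (int j + 1) x) k = (\<Sum>m\<in>S. if e j m = int k then h j m x else 0)"
      unfolding S_def e_def h_def using j by (intro odd_theta_nth) auto
    also have "\<dots> = fps_nth (T j x) k"
      unfolding T_def fps_sum_nth using e0'[OF j] by (intro sum.cong refl) (auto simp: nat_eq_iff)
    finally show "fps_nth (odd_theta (int t + 1) (int j + 1) x) k = fps_nth (T j x) k" .
  qed
  define P where "P = {p. p permutes {0..<t}}"
  \<comment> \<open>With the permutation acting on row indices, column j stays attached to m j, the
    summation variable of its theta series.\<close>
  have det: "det (mat t t (\<lambda>(i, j). A i j)) = (\<Sum>p\<in>P. signof p * (\<Prod>j<t. A (p j) j))"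
    for A :: "nat \<Rightarrow> nat \<Rightarrow> 'a::comm_ring_1"
    unfolding P_def
    by (subst det_col[of _ t]) (auto intro!: sum.cong prod.cong simp: permutes_in_image)
  have perm_term: "fps_nth (\<Prod>j<t. odd_theta (int t + 1) (int j + 1) (z (p j))) K
      = (\<Sum>m\<in>shift_vectors t K. \<Prod>j<t. h j (m j) (z (p j)))" for p
  proof -
    have "fps_cong_below (Suc K) (\<Prod>j<t. odd_theta (int t + 1) (int j + 1) (z (p j))) (\<Prod>j<t. T j (z (p j)))"
      by (intro fps_cong_below_prod T) auto
    then have "fps_nth (\<Prod>j<t. odd_theta (int t + 1) (int j + 1) (z (p j))) K = fps_nth (\<Prod>j<t. T j (z (p j))) K"
      by (simp add: fps_cong_below_def)
    also have "(\<Prod>j<t. T j (z (p j))) = (\<Sum>m\<in>{..<t} \<rightarrow>\<^sub>E S. \<Prod>j<t. fps_const (h j (m j) (z (p j))) * fps_X ^ nat (e j (m j)))"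
      unfolding T_def by (rule prod_sum_PiE) (auto simp: S_def)
    also have "\<dots> = (\<Sum>m\<in>{..<t} \<rightarrow>\<^sub>E S. fps_const (\<Prod>j<t. h j (m j) (z (p j))) * fps_X ^ nat (shift_weight t m))"
    proof (intro sum.cong refl)
      fix m
      have "int (\<Sum>j<t. nat (e j (m j))) = (\<Sum>j<t. e j (m j))"
        unfolding of_nat_sum using e0' by (intro sum.cong) auto
      then have "(\<Sum>j<t. nat (e j (m j))) = nat (shift_weight t m)"
        unfolding shift_weight_def e_def by linarith
      then show "(\<Prod>j<t. fps_const (h j (m j) (z (p j))) * fps_X ^ nat (e j (m j)))
        = fps_const (\<Prod>j<t. h j (m j) (z (p j))) * fps_X ^ nat (shift_weight t m)"
        by (simp add: prod.distrib prod_fps_const power_sum[symmetric])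
    qed
    also have "fps_nth \<dots> K = (\<Sum>m\<in>{..<t} \<rightarrow>\<^sub>E S. if shift_weight t m = int K then \<Prod>j<t. h j (m j) (z (p j)) else 0)"
      unfolding fps_sum_nth
    proof (intro sum.cong refl)
      fix m
      have "0 \<le> shift_weight t m" unfolding shift_weight_def using e0' by (intro sum_nonneg) (auto simp: e_def)
      then show "fps_nth (fps_const (\<Prod>j<t. h j (m j) (z (p j))) * fps_X ^ nat (shift_weight t m)) K
         = (if shift_weight t m = int K then \<Prod>j<t. h j (m j) (z (p j)) else 0)"
        by (auto simp: nat_eq_iff)
    qed
    also have "\<dots> = (\<Sum>m\<in>shift_vectors t K. \<Prod>j<t. h j (m j) (z (p j)))"
      unfolding shift_vectors_def S_def by (subst sum.inter_filter) (auto simp: finite_PiE)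
    finally show ?thesis .
  qed
  have "fps_nth (theta_det t z) K = (\<Sum>p\<in>P. signof p * (\<Sum>m\<in>shift_vectors t K. \<Prod>j<t. h j (m j) (z (p j))))"
    unfolding theta_det_def det fps_sum_nth fps_nth_signof_mult perm_term ..
  also have "\<dots> = (\<Sum>m\<in>shift_vectors t K. \<Sum>p\<in>P. signof p * (\<Prod>j<t. h j (m j) (z (p j))))"
    unfolding sum_distrib_left by (rule sum.swap)
  also have "\<dots> = (\<Sum>m\<in>shift_vectors t K.
     det (mat t t (\<lambda>(i, j). z i powi residue_shift t m j - z i powi (- residue_shift t m j))))"
    unfolding det by (simp add: h_def residue_shift_def)
  finally show ?thesis .
qed

lemma theta_det_nth_0:
  "fps_nth (theta_det t z) 0 = det (mat t t (\<lambda>(i, j). z i powi (int j + 1) - z i powi (- (int j + 1))))"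
proof -
  have "shift_vectors t 0 = {restrict (\<lambda>_. 0) {..<t}}"
  proof -
    have "m \<in> shift_vectors t 0 \<longleftrightarrow> m = restrict (\<lambda>_. 0) {..<t}" for m
    proof
      assume "m \<in> shift_vectors t 0"
      then have m: "m \<in> {..<t} \<rightarrow>\<^sub>E {0}" by (simp add: shift_vectors_def)
      show "m = restrict (\<lambda>_. 0) {..<t}"
        by (rule extensionalityI[of _ "{..<t}"]) (use m in \<open>auto simp: PiE_def\<close>)
    next
      assume "m = restrict (\<lambda>_. 0) {..<t}"
      then show "m \<in> shift_vectors t 0" by (auto simp: shift_vectors_def shift_weight_def)
    qed
    then show ?thesis by auto
  qed
  moreover have "mat t t (\<lambda>(i, j). z i powi residue_shift t (restrict (\<lambda>_. 0) {..<t}) j - z i powi (- residue_shift t (restrict (\<lambda>_. 0) {..<t}) j))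
    = mat t t (\<lambda>(i, j). z i powi (int j + 1) - z i powi (- (int j + 1)))"
    by (intro eq_matI) (auto simp: residue_shift_def)
  ultimately show ?thesis by (simp add: theta_det_nth)
qed

lemma residue_shift_facts:
  assumes "i < t"
  shows "residue_shift t m i \<noteq> 0"
    and "j < t \<Longrightarrow> i \<noteq> j \<Longrightarrow> residue_shift t m i \<noteq> residue_shift t m j"
    and "j < t \<Longrightarrow> residue_shift t m i \<noteq> - residue_shift t m j"
proof -
  have *: "residue_shift t m i \<noteq> - residue_shift t m j" if "j < t" for j
    unfolding residue_shift_def using assms that by (intro residue_classes_unique(2)) auto
  then show "j < t \<Longrightarrow> residue_shift t m i \<noteq> - residue_shift t m j" .
  show "residue_shift t m i \<noteq> 0" using *[OF assms] by auto
  assume "j < t" "i \<noteq> j"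
  then show "residue_shift t m i \<noteq> residue_shift t m j"
    unfolding residue_shift_def using assms
      residue_classes_unique(1)[of "int t + 1" "int i + 1" "int j + 1" "m i" "m j"] by auto
qed

lemma power_int_eq_one_iff:
  fixes y :: real assumes "y > 1" shows "y powi n = 1 \<longleftrightarrow> n = 0"
  using power_int_strict_increasing[of 0 n y] power_int_strict_increasing[of n 0 y] assms
  by (cases "n = 0") (auto simp: neq_iff)

lemma nondegenerate_powers:
  fixes y :: real and u :: "nat \<Rightarrow> int"
  assumes y: "y > 1" and u0: "\<And>i. i < t \<Longrightarrow> u i \<noteq> 0"
    and u: "\<And>i j. i < t \<Longrightarrow> j < i \<Longrightarrow> u i \<noteq> u j \<and> u i \<noteq> - u j"
  defines "z \<equiv> \<lambda>i. complex_of_real y powi u i"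
  shows "nondegenerate t z" "\<forall>i<t. norm (z i) \<noteq> 1"
proof -
  have r: "complex_of_real y powi n = of_real (y powi n)" for n by simp
  have one: "complex_of_real y powi n = 1 \<longleftrightarrow> n = 0" for n
    unfolding r of_real_eq_1_iff using power_int_eq_one_iff[OF y] .
  have y0: "complex_of_real y \<noteq> 0" using y by simp
  show "\<forall>i<t. norm (z i) \<noteq> 1"
    using u0 y by (auto simp: z_def norm_power_int power_int_eq_one_iff)
  have "(z i)\<^sup>2 \<noteq> 1" if "i < t" for i
  proof -
    have "(z i)\<^sup>2 = complex_of_real y powi (u i + u i)" by (simp only: z_def power2_eq_square power_int_add[OF disjI1[OF y0]])
    then show ?thesis using one[of "u i + u i"] u0[OF that] by simp
  qed
  moreover have "z i * z j \<noteq> 1" "z i \<noteq> z j" if "i < t" "j < i" for i j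
  proof -
    have "z i * z j = complex_of_real y powi (u i + u j)" using y0 by (simp add: z_def power_int_add)
    then show "z i * z j \<noteq> 1" using one[of "u i + u j"] u[OF that] by simp
    have "z i / z j = complex_of_real y powi (u i - u j)" using y0 by (simp add: z_def power_int_diff)
    moreover have "z j \<noteq> 0" using y0 by (simp add: z_def)
    ultimately show "z i \<noteq> z j" using one[of "u i - u j"] u[OF that] by auto
  qed
  ultimately show "nondegenerate t z" using y0 by (auto simp: nondegenerate_def z_def)
qed

text \<open>Both sides are coefficient K of the theta determinant at the points y^(i+1), divided by
  \<kappa>: once expanded column by column, once taken from the product formula.\<close>

lemma weyl_prod_expansion:
  fixes y :: real
  assumes t: "t \<ge> 1" and y: "y > 1"
  shows "(\<Sum>m\<in>shift_vectors t K. weyl_prod t (\<lambda>i. complex_of_real y powi residue_shift t m i)) =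
    weyl_prod t (\<lambda>i. complex_of_real y powi (int i + 1)) *
      fps_nth (euler_prod ^ t * tail_prod t (\<lambda>i. complex_of_real y powi (int i + 1))) K"
proof -
  define Y where "Y = complex_of_real y"
  obtain \<kappa> where \<kappa>: "\<kappa> \<noteq> 0" and form: "\<And>z. nondegenerate t z \<Longrightarrow> \<forall>i<t. norm (z i) \<noteq> 1 \<Longrightarrow>
     theta_det t z = fps_const (\<kappa> * weyl_prod t z) * (euler_prod ^ t * tail_prod t z)"
    using theta_det_formula[OF t] by blast
  have const: "fps_nth (theta_det t z) 0 = \<kappa> * weyl_prod t z" if "nondegenerate t z" "\<forall>i<t. norm (z i) \<noteq> 1" for z
    using form[OF that]
    by (simp add: tail_prod_eq_iprod euler_prod_def fps_nth_iprod_0 fps_nth_power_0)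
  define z where "z = (\<lambda>i::nat. Y powi (int i + 1))"
  have z: "nondegenerate t z" "\<forall>i<t. norm (z i) \<noteq> 1"
    unfolding z_def Y_def by (rule nondegenerate_powers[OF y]; simp)+
  have "det (mat t t (\<lambda>(i, j). z i powi residue_shift t m j - z i powi (- residue_shift t m j)))
      = \<kappa> * weyl_prod t (\<lambda>i. Y powi residue_shift t m i)" for m
  proof -
    define w where "w = (\<lambda>i. Y powi residue_shift t m i)"
    have w: "nondegenerate t w" "\<forall>i<t. norm (w i) \<noteq> 1"
      unfolding w_def Y_def
      by (rule nondegenerate_powers[OF y]; use residue_shift_facts in auto)+
    \<comment> \<open>Raising y^(i+1) to the power u_j is raising y^(u_j) to the power i + 1.
      Transposed, the matrix is the one for the constant coefficient of the theta determinant at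
      w.\<close>
    have "mat t t (\<lambda>(i, j). z i powi residue_shift t m j - z i powi (- residue_shift t m j))
      = (mat t t (\<lambda>(i, j). w i powi (int j + 1) - w i powi (- (int j + 1))))\<^sup>T"
    proof (rule eq_matI)
      fix i j assume "i < dim_row (mat t t (\<lambda>(i, j). w i powi (int j + 1) - w i powi (- (int j + 1))))\<^sup>T"
        "j < dim_col (mat t t (\<lambda>(i, j). w i powi (int j + 1) - w i powi (- (int j + 1))))\<^sup>T"
      then have ij: "i < t" "j < t" by auto
      have "z i powi n = Y powi ((int i + 1) * n)" for n by (simp add: z_def power_int_mult)
      moreover have "w j powi n = Y powi (residue_shift t m j * n)" for n by (simp add: w_def power_int_mult)
      ultimately show "mat t t (\<lambda>(i, j). z i powi residue_shift t m j - z i powi (- residue_shift t m j)) $$ (i, j)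
        = (mat t t (\<lambda>(i, j). w i powi (int j + 1) - w i powi (- (int j + 1))))\<^sup>T $$ (i, j)"
        using ij by (simp add: algebra_simps)
    qed auto
    then have "det (mat t t (\<lambda>(i, j). z i powi residue_shift t m j - z i powi (- residue_shift t m j)))
      = det (mat t t (\<lambda>(i, j). w i powi (int j + 1) - w i powi (- (int j + 1))))"
      by (simp add: det_transpose[of _ t])
    also have "\<dots> = \<kappa> * weyl_prod t w" using const[OF w] by (simp add: theta_det_nth_0)
    finally show ?thesis by (simp add: w_def)
  qed
  then have "\<kappa> * (\<Sum>m\<in>shift_vectors t K. weyl_prod t (\<lambda>i. Y powi residue_shift t m i)) = fps_nth (theta_det t z) K"
    by (simp add: theta_det_nth sum_distrib_left)
  also have "\<dots> = \<kappa> * (weyl_prod t z * fps_nth (euler_prod ^ t * tail_prod t z) K)"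
    unfolding form[OF z] by (simp add: mult.assoc)
  finally show ?thesis using \<kappa> by (simp add: z_def Y_def)
qed

section \<open>The limit y to 1, taken coefficientwise in the complex numbers\<close>

definition fps_tendsto :: "('b \<Rightarrow> complex fps) \<Rightarrow> complex fps \<Rightarrow> 'b filter \<Rightarrow> bool" where
  "fps_tendsto F L A \<longleftrightarrow> (\<forall>k. ((\<lambda>x. fps_nth (F x) k) \<longlongrightarrow> fps_nth L k) A)"

lemma fps_tendsto_const: "fps_tendsto (\<lambda>x. F) F A"
  by (simp add: fps_tendsto_def)

lemma fps_tendsto_mult:
  "fps_tendsto F L A \<Longrightarrow> fps_tendsto G M A \<Longrightarrow> fps_tendsto (\<lambda>x. F x * G x) (L * M) A"
  unfolding fps_tendsto_def fps_mult_nth by (auto intro!: tendsto_intros)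

lemma fps_tendsto_prod:
  "(\<And>i. i \<in> I \<Longrightarrow> fps_tendsto (F i) (L i) A) \<Longrightarrow> fps_tendsto (\<lambda>x. \<Prod>i\<in>I. F i x) (\<Prod>i\<in>I. L i) A"
  by (induction I rule: infinite_finite_induct) (auto intro!: fps_tendsto_mult fps_tendsto_const)

lemma fps_tendsto_theta_tail:
  assumes f: "(f \<longlongrightarrow> 1) A" shows "fps_tendsto (\<lambda>x. theta_tail (f x)) (euler_prod\<^sup>2) A"
proof -
  have 1: "theta_tail 1 = euler_prod\<^sup>2"
    unfolding theta_tail_def euler_prod_def
    using iprod_power[OF tame_one_minus_X, of 2] by (simp add: power2_eq_square)
  have lin: "fps_tendsto (\<lambda>x. 1 - fps_const (g x) * fps_X ^ n) (1 - fps_const 1 * fps_X ^ n) A"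
    if "(g \<longlongrightarrow> 1) A" for g n
    unfolding fps_tendsto_def
  proof
    fix k
    have "((\<lambda>x. fps_nth 1 k - g x * (if k = n then 1 else 0)) \<longlongrightarrow> fps_nth 1 k - 1 * (if k = n then 1 else 0)) A"
      by (intro tendsto_intros that)
    then show "((\<lambda>x. fps_nth (1 - fps_const (g x) * fps_X ^ n) k) \<longlongrightarrow> fps_nth (1 - fps_const 1 * fps_X ^ n) k) A"
      by (simp only: fps_sub_nth fps_mult_left_const_nth fps_X_power_nth)
  qed
  have "fps_tendsto (\<lambda>x. theta_tail (f x)) (theta_tail 1) A"
    unfolding fps_tendsto_def
  proof
    fix k
    have inv: "((\<lambda>x. inverse (f x)) \<longlongrightarrow> 1) A" using tendsto_inverse[OF f] by simp
    have "fps_tendsto (\<lambda>x. \<Prod>n=1..k. (1 - fps_const (f x) * fps_X ^ n) * (1 - fps_const (inverse (f x)) * fps_X ^ n))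
       (\<Prod>n=1..k. (1 - fps_const 1 * fps_X ^ n) * (1 - fps_const 1 * fps_X ^ n)) A"
      by (intro fps_tendsto_prod fps_tendsto_mult lin f inv)
    then show "((\<lambda>x. fps_nth (theta_tail (f x)) k) \<longlongrightarrow> fps_nth (theta_tail 1) k) A"
      by (simp add: fps_tendsto_def theta_tail_def iprod_def)
  qed
  then show ?thesis by (simp only: 1)
qed

lemma sinh_quotient_limit:
  fixes n :: int
  defines "s \<equiv> \<lambda>n (x::real). complex_of_real x powi n - complex_of_real x powi (- n)"
  shows "((\<lambda>x. s n x / s 1 x) \<longlongrightarrow> of_int n) (at_right 1)"
proof -
  define g where "g n w = w powi n - w powi (- n)" for n :: int and w :: complex
  have "((\<lambda>w. g n w / (w - 1)) \<longlongrightarrow> 2 * of_int n) (at 1)" for n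
  proof -
    have "(g n has_field_derivative (of_int n * 1 powi (n - 1) * 1 - of_int (- n) * 1 powi (- n - 1) * 1)) (at 1)"
      unfolding g_def by (auto intro!: derivative_eq_intros)
    then have "(g n has_field_derivative (2 * of_int n)) (at 1)" by simp
    then have "((\<lambda>w. (g n w - g n 1) / (w - 1)) \<longlongrightarrow> 2 * of_int n) (at 1)"
      by (simp add: has_field_derivative_iff)
    then show ?thesis by (simp add: g_def)
  qed
  note lim = this
  have "((\<lambda>w. (g n w / (w - 1)) / (g 1 w / (w - 1))) \<longlongrightarrow> (2 * of_int n) / (2 * of_int 1)) (at 1)"
    by (intro tendsto_divide lim) simp
  then have "((\<lambda>w. (g n w / (w - 1)) / (g 1 w / (w - 1))) \<longlongrightarrow> of_int n) (at 1)" by simp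
  then have "((\<lambda>w. g n w / g 1 w) \<longlongrightarrow> of_int n) (at 1)"
    by (rule Lim_transform_eventually) (auto simp: eventually_at_filter)
  moreover have "filterlim complex_of_real (at 1) (at_right 1)"
    unfolding filterlim_at
    by (auto simp: eventually_at_filter intro!: tendsto_eq_intros)
  ultimately have "((\<lambda>x. g n (complex_of_real x) / g 1 (complex_of_real x)) \<longlongrightarrow> of_int n) (at_right 1)"
    by (rule filterlim_compose)
  then show ?thesis by (simp add: s_def g_def)
qed

text \<open>The numerator of the Weyl dimension formula of type C. Up to a power of -2 it is what
  remains of \<open>weyl_prod\<close> at the points y^(u_i) when the zero at y = 1 is divided
  out.\<close>

definition weyl_dim :: "nat \<Rightarrow> (nat \<Rightarrow> int) \<Rightarrow> complex" where
  "weyl_dim t u = (\<Prod>i<t. of_int (u i)) * (\<Prod>i<t. \<Prod>j<i. of_int ((u i)\<^sup>2 - (u j)\<^sup>2))"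

theorem macdonald_type_C:
  assumes t: "t \<ge> 1"
  shows "(\<Sum>m\<in>shift_vectors t K. weyl_dim t (residue_shift t m)) =
    weyl_dim t (\<lambda>i. int i + 1) * fps_nth (euler_prod ^ (2 * t\<^sup>2 + t)) K"
proof -
  define s where "s n x = complex_of_real x powi n - complex_of_real x powi (- n)" for n :: int and x :: real
  \<comment> \<open>One factor vanishing at x = 1 for each positive root: t long and t(t - 1) short
    ones. It is the same for every exponent vector u and so cancels.\<close>
  define D where "D x = (\<Prod>i<t. s 1 x) * (\<Prod>i<t. \<Prod>j<i. s 1 x * s 1 x)" for x
  define R where "R u x = (\<Prod>i<t. - (s (2 * u i) x / s 1 x)) * (\<Prod>i<t. \<Prod>j<i. (s (u i + u j) x / s 1 x) * (s (u i - u j) x / s 1 x))"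
    for u :: "nat \<Rightarrow> int" and x
  have s1: "s 1 x \<noteq> 0" if "x > 1" for x
  proof -
    have "x * x \<noteq> 1" using that by (metis less_1_mult less_irrefl)
    then have "complex_of_real x * complex_of_real x \<noteq> 1" by (metis of_real_eq_1_iff of_real_mult)
    then show ?thesis using that by (auto simp: s_def power_int_minus field_simps)
  qed
  \<comment> \<open>Taking y = x^2 gives square roots of all powers of y; each factor of the Weyl
    denominator then becomes, monomial included, a product of differences
    \<open>s n x\<close>.\<close>
  have weyl: "weyl_prod t (\<lambda>i. complex_of_real (x\<^sup>2) powi u i) = D x * R u x" if x: "x > 1" for x u
  proof -
    define X where "X = complex_of_real x"
    have X0: "X \<noteq> 0" using x by (simp add: X_def)
    have p: "complex_of_real (x\<^sup>2) powi n = X powi n * X powi n" for n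
      by (simp add: X_def power2_eq_square power_int_mult_distrib)
    have inv: "X powi (- n) = inverse (X powi n)" for n by (rule power_int_minus)
    have a: "inverse (complex_of_real (x\<^sup>2) powi u i) * (1 - (complex_of_real (x\<^sup>2) powi u i)\<^sup>2) = s 1 x * - (s (2 * u i) x / s 1 x)" for i
    proof -
      define A where "A = X powi u i"
      have A: "A \<noteq> 0" using X0 by (simp add: A_def)
      have "2 * u i = u i + u i" by simp
      then have AA: "X powi (2 * u i) = A * A" using X0 by (simp only: A_def power_int_add simp_thms)
      have "s 1 x * - (s (2 * u i) x / s 1 x) = - s (2 * u i) x" using s1[OF x] by simp
      also have "\<dots> = inverse (A * A) - A * A"
        unfolding s_def X_def[symmetric] inv AA by simp
      also have "\<dots> = inverse (A * A) * (1 - (A * A)\<^sup>2)"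
        using A by (simp add: field_simps power2_eq_square)
      finally show ?thesis unfolding p A_def by simp
    qed
    have b: "inverse (complex_of_real (x\<^sup>2) powi u i) * ((1 - complex_of_real (x\<^sup>2) powi u i * complex_of_real (x\<^sup>2) powi u j) *
       (1 - complex_of_real (x\<^sup>2) powi u i / complex_of_real (x\<^sup>2) powi u j))
       = (s 1 x * s 1 x) * ((s (u i + u j) x / s 1 x) * (s (u i - u j) x / s 1 x))" for i j
    proof -
      define A B where "A = X powi u i" and "B = X powi u j"
      have AB: "A \<noteq> 0" "B \<noteq> 0" using X0 by (auto simp: A_def B_def)
      have "(s 1 x * s 1 x) * ((s (u i + u j) x / s 1 x) * (s (u i - u j) x / s 1 x)) = s (u i + u j) x * s (u i - u j) x"
        using s1[OF x] by simp
      also have "\<dots> = (A * B - inverse (A * B)) * (A / B - inverse (A / B))"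
        unfolding s_def X_def[symmetric] inv using X0 by (simp add: A_def B_def power_int_add power_int_diff)
      also have "\<dots> = inverse (A * A) * ((1 - (A * A) * (B * B)) * (1 - (A * A) / (B * B)))"
        using AB by (simp add: divide_simps) (simp add: algebra_simps)
      finally show ?thesis unfolding p A_def B_def by simp
    qed
    show ?thesis unfolding weyl_prod_def D_def R_def a b by (simp only: prod.distrib mult_ac)
  qed
  have D0: "D x \<noteq> 0" if "x > 1" for x using s1[OF that] by (simp add: D_def)
  define Q where "Q x = euler_prod ^ t * tail_prod t (\<lambda>i. complex_of_real (x\<^sup>2) powi (int i + 1))" for x :: real
  have id: "(\<Sum>m\<in>shift_vectors t K. R (residue_shift t m) x) = R (\<lambda>i. int i + 1) x * fps_nth (Q x) K" if x: "x > 1" for x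
  proof -
    have "x\<^sup>2 > 1" using x by (simp add: one_less_power)
    from weyl_prod_expansion[OF t this, of K]
    have "D x * (\<Sum>m\<in>shift_vectors t K. R (residue_shift t m) x) = D x * (R (\<lambda>i. int i + 1) x * fps_nth (Q x) K)"
      unfolding weyl[OF x] Q_def by (simp only: sum_distrib_left mult.assoc)
    then show ?thesis using D0[OF x] by simp
  qed
  define V where "V u = (\<Prod>i<t. - of_int (2 * u i)) * (\<Prod>i<t. \<Prod>j<i. of_int (u i + u j) * (of_int (u i - u j) :: complex))"
    for u :: "nat \<Rightarrow> int"
  have R: "((\<lambda>x. R u x) \<longlongrightarrow> V u) (at_right 1)" for u
    unfolding R_def V_def s_def by (intro tendsto_intros sinh_quotient_limit)
  have V: "V u = (- 2) ^ t * weyl_dim t u" for u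
  proof -
    have "(\<Prod>i<t. - of_int (2 * u i)) = (- 2 :: complex) ^ t * (\<Prod>i<t. of_int (u i))"
    proof -
      have "(\<Prod>i<t. - of_int (2 * u i)) = (\<Prod>i<t. (- 2) * (of_int (u i) :: complex))"
        by (intro prod.cong) auto
      then show ?thesis by (simp only: prod.distrib prod_constant card_lessThan)
    qed
    moreover have "of_int (u i + u j) * (of_int (u i - u j) :: complex) = of_int ((u i)\<^sup>2 - (u j)\<^sup>2)" for i j
      by (simp add: power2_eq_square algebra_simps)
    ultimately show ?thesis by (simp only: V_def weyl_dim_def mult.assoc)
  qed
  have y1: "((\<lambda>x. complex_of_real (x\<^sup>2)) \<longlongrightarrow> 1) (at_right 1)"
    by (auto intro!: tendsto_eq_intros)
  have yn: "((\<lambda>x. complex_of_real (x\<^sup>2) powi n) \<longlongrightarrow> 1) (at_right 1)" for n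
    using tendsto_power_int[OF y1, of n] by simp
  have lim: "fps_tendsto Q (euler_prod ^ t * ((\<Prod>i<t. euler_prod\<^sup>2) * (\<Prod>i<t. \<Prod>j<i. euler_prod\<^sup>2 * euler_prod\<^sup>2))) (at_right 1)"
    unfolding Q_def tail_prod_def
  proof (intro fps_tendsto_mult fps_tendsto_const fps_tendsto_prod fps_tendsto_theta_tail)
    fix i j :: nat
    show "((\<lambda>x. (complex_of_real (x\<^sup>2) powi (int i + 1))\<^sup>2) \<longlongrightarrow> 1) (at_right 1)"
      using tendsto_power[OF yn, of _ 2] by simp
    show "((\<lambda>x. complex_of_real (x\<^sup>2) powi (int i + 1) * complex_of_real (x\<^sup>2) powi (int j + 1)) \<longlongrightarrow> 1) (at_right 1)"
      using tendsto_mult[OF yn yn] by simp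
    show "((\<lambda>x. complex_of_real (x\<^sup>2) powi (int i + 1) / complex_of_real (x\<^sup>2) powi (int j + 1)) \<longlongrightarrow> 1) (at_right 1)"
      using tendsto_divide[OF yn yn] by simp
  qed
  \<comment> \<open>Exponent count: t + 2t + 4 t(t - 1)/2 = 2t^2 + t, the dimension of the
    symplectic Lie algebra of rank t.\<close>
  have "euler_prod ^ t * ((\<Prod>i<t. euler_prod\<^sup>2) * (\<Prod>i<t. \<Prod>j<i. euler_prod\<^sup>2 * euler_prod\<^sup>2)) = euler_prod ^ (2 * t\<^sup>2 + t)"
  proof -
    have "euler_prod ^ n * ((\<Prod>i<n. euler_prod\<^sup>2) * (\<Prod>i<n. \<Prod>j<i. euler_prod\<^sup>2 * euler_prod\<^sup>2)) = euler_prod ^ (2 * n\<^sup>2 + n)" for n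
    proof (induction n)
      case (Suc n)
      have "euler_prod ^ Suc n * ((\<Prod>i<Suc n. euler_prod\<^sup>2) * (\<Prod>i<Suc n. \<Prod>j<i. euler_prod\<^sup>2 * euler_prod\<^sup>2))
        = (euler_prod ^ n * ((\<Prod>i<n. euler_prod\<^sup>2) * (\<Prod>i<n. \<Prod>j<i. euler_prod\<^sup>2 * euler_prod\<^sup>2))) * (euler_prod ^ 3 * (euler_prod ^ 4) ^ n)"
        by (simp add: mult_ac power_add[symmetric] numeral_3_eq_3 power2_eq_square power4_eq_xxxx)
      also have "\<dots> = euler_prod ^ (2 * n\<^sup>2 + n + (3 + 4 * n))" unfolding Suc by (simp only: power_add power_mult)
      also have "2 * n\<^sup>2 + n + (3 + 4 * n) = 2 * (Suc n)\<^sup>2 + Suc n" by (simp add: power2_eq_square)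
      finally show ?case .
    qed simp
    then show ?thesis .
  qed
  then have "fps_tendsto Q (euler_prod ^ (2 * t\<^sup>2 + t)) (at_right 1)" using lim by simp
  then have Q: "((\<lambda>x. fps_nth (Q x) K) \<longlongrightarrow> fps_nth (euler_prod ^ (2 * t\<^sup>2 + t)) K) (at_right 1)"
    by (simp add: fps_tendsto_def)
  have "((\<lambda>x. R (\<lambda>i. int i + 1) x * fps_nth (Q x) K) \<longlongrightarrow> V (\<lambda>i. int i + 1) * fps_nth (euler_prod ^ (2 * t\<^sup>2 + t)) K) (at_right 1)"
    by (intro tendsto_mult R Q)
  moreover have "((\<lambda>x. R (\<lambda>i. int i + 1) x * fps_nth (Q x) K) \<longlongrightarrow> (\<Sum>m\<in>shift_vectors t K. V (residue_shift t m))) (at_right 1)"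
  proof (rule Lim_transform_eventually)
    show "((\<lambda>x. \<Sum>m\<in>shift_vectors t K. R (residue_shift t m) x) \<longlongrightarrow> (\<Sum>m\<in>shift_vectors t K. V (residue_shift t m))) (at_right 1)"
      by (intro tendsto_sum R)
    show "eventually (\<lambda>x. (\<Sum>m\<in>shift_vectors t K. R (residue_shift t m) x) = R (\<lambda>i. int i + 1) x * fps_nth (Q x) K) (at_right 1)"
      unfolding eventually_at_filter by (rule always_eventually) (use id in auto)
  qed
  ultimately have "(\<Sum>m\<in>shift_vectors t K. V (residue_shift t m)) = V (\<lambda>i. int i + 1) * fps_nth (euler_prod ^ (2 * t\<^sup>2 + t)) K"
    using tendsto_unique[OF trivial_limit_at_right_real] by blast
  then have "(- 2) ^ t * (\<Sum>m\<in>shift_vectors t K. weyl_dim t (residue_shift t m))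
    = (- 2) ^ t * (weyl_dim t (\<lambda>i. int i + 1) * fps_nth (euler_prod ^ (2 * t\<^sup>2 + t)) K)"
    unfolding V by (simp only: sum_distrib_left mult.assoc)
  then show ?thesis by simp
qed

subsection \<open>Hook weights of cores\<close>

lemma weyl_dim_cong: "(\<And>i. i < t \<Longrightarrow> u i = v i) \<Longrightarrow> weyl_dim t u = weyl_dim t v"
  unfolding weyl_dim_def by (intro arg_cong2[of _ _ _ _ "(*)"] prod.cong) auto

text \<open>Isolates one coordinate, because removing a hook from a core changes exactly
  one.\<close>

lemma weyl_dim_update:
  assumes k: "k < t"
  shows "\<exists>R. \<forall>x. weyl_dim t (u(k := x)) = R * (of_int x * (\<Prod>l\<in>{..<t} - {k}. of_int (x\<^sup>2 - (u l)\<^sup>2)))"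
  using antisymmetric_prod_one_variable[OF k, of "\<lambda>_. True" "\<lambda>a b. of_int (a\<^sup>2 - b\<^sup>2)" u of_int]
  unfolding weyl_dim_def by simp

text \<open>Coordinate m k gives the height of the runner with residue t + 2 + k and, negated, that
  of the opposite residue t - k. The residues 0 and t + 1 are their own opposites and get height
  0.\<close>

definition runner :: "nat \<Rightarrow> (nat \<Rightarrow> int) \<Rightarrow> int \<Rightarrow> int" where
  "runner t m r = (if r > int t + 1 then m (nat (r - int t - 2))
     else if 0 < r \<and> r < int t + 1 then - m (nat (int t - r)) else 0)"

text \<open>A set of positive integers is encoded by the Maya diagram containing \<open>h\<close> for members,
  \<open>-h\<close> for positive non-members; \<open>runner\<close> counts beads on the runner of each residue
  modulo \<open>2t + 2\<close> relative to the empty set.\<close>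

definition bead :: "nat \<Rightarrow> (nat \<Rightarrow> int) \<Rightarrow> int \<Rightarrow> bool" where
  "bead t m s \<longleftrightarrow> s div (2 * (int t + 1)) < runner t m (s mod (2 * (int t + 1)))"

definition core_set :: "nat \<Rightarrow> (nat \<Rightarrow> int) \<Rightarrow> nat set" where
  "core_set t m = {h. bead t m (int h)}"

lemma runner_zero [simp]: "runner t m 0 = 0" "runner t m (int t + 1) = 0"
  by (simp_all add: runner_def)

lemma runner_reflect:
  assumes "0 < x" "x < 2 * (int t + 1)" shows "runner t m (2 * (int t + 1) - x) = - runner t m x"
proof -
  consider "x > int t + 1" | "x = int t + 1" | "x < int t + 1" by linarith
  then show ?thesis
  proof cases
    case 1
    then show ?thesis using assms by (simp add: runner_def algebra_simps)
  next
    case 3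
    then show ?thesis using assms by (simp add: runner_def algebra_simps)
  qed simp
qed

lemma runner_right: "l < t \<Longrightarrow> runner t m (int t + 1 + (int l + 1)) = m l"
  by (simp add: runner_def)

lemma runner_left: "l < t \<Longrightarrow> runner t m (int t + 1 - (int l + 1)) = - m l"
  by (simp add: runner_def)

text \<open>Of h and -h exactly one is a bead, which is what makes the diagram that of a set of
  positive integers. It follows from the opposite heights of opposite runners.\<close>

lemma bead_uminus:
  assumes "s \<noteq> 0" shows "bead t m (- s) \<longleftrightarrow> \<not> bead t m s"
proof -
  define N where "N = 2 * (int t + 1)"
  have N: "N > 0" by (simp add: N_def)
  show ?thesis
  proof (cases "s mod N = 0")
    case True
    then have s: "s = N * (s div N)" by auto
    then have "- s = N * (- (s div N))" by simp
    then have "(- s) div N = - (s div N)" "(- s) mod N = 0" using N by (metis nonzero_mult_div_cancel_left less_irrefl, metis mod_mult_self1_is_0)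
    moreover have "s div N \<noteq> 0" using s assms by auto
    ultimately show ?thesis using True unfolding bead_def N_def[symmetric] by auto
  next
    case False
    then have "(- s) div N = - (s div N) - 1" "(- s) mod N = N - s mod N"
      using N by (simp_all add: zdiv_zminus1_eq_if zmod_zminus1_eq_if)
    moreover have "0 < s mod N" "s mod N < N"
      using False pos_mod_sign[OF N, of s] pos_mod_bound[OF N, of s] by linarith+
    then have "runner t m (N - s mod N) = - runner t m (s mod N)"
      unfolding N_def by (rule runner_reflect)
    ultimately show ?thesis unfolding bead_def N_def[symmetric] by auto
  qed
qed

lemma not_bead_0 [simp]: "\<not> bead t m 0"
  by (simp add: bead_def)

lemma zero_notin_core_set [simp]: "0 \<notin> core_set t m"
  by (simp add: core_set_def)

lemma finite_core_set [simp]: "finite (core_set t m)"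
proof -
  define N where "N = 2 * (int t + 1)"
  have N: "N > 0" by (simp add: N_def)
  have "core_set t m \<subseteq> (\<Union>r\<in>{0..<N}. (\<lambda>i. nat (N * i + r)) ` {0..<runner t m r})"
  proof
    fix h assume "h \<in> core_set t m"
    then have b: "int h div N < runner t m (int h mod N)" by (simp add: core_set_def bead_def N_def)
    have "h = nat (N * (int h div N) + int h mod N)" by simp
    moreover have "int h mod N \<in> {0..<N}" "int h div N \<in> {0..<runner t m (int h mod N)}"
      using b N by (auto simp: pos_imp_zdiv_nonneg_iff)
    ultimately show "h \<in> (\<Union>r\<in>{0..<N}. (\<lambda>i. nat (N * i + r)) ` {0..<runner t m r})" by blast
  qed
  then show ?thesis by (rule finite_subset) auto
qed

definition hook_factor :: "complex \<Rightarrow> nat set \<Rightarrow> nat \<Rightarrow> complex" where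
  "hook_factor t \<Delta> h = (1 - (2 * t + 2) / of_nat h) * (1 - (t + 1) / of_nat h) *
     (\<Prod>j=1..h - 1. 1 - ((2 * t + 2) / (of_nat h + hook_sign \<Delta> j * of_nat j))\<^sup>2)"

definition hook_weight :: "complex \<Rightarrow> nat set \<Rightarrow> complex" where
  "hook_weight t \<Delta> = (- 1) ^ card \<Delta> * (\<Prod>h\<in>\<Delta>. hook_factor t \<Delta> h)"

text \<open>The factor of a hook depends only on which smaller numbers belong to \<Delta>, so
  removing the largest hook leaves all other factors alone.\<close>

lemma hook_weight_remove_Max:
  assumes "finite \<Delta>" "\<Delta> \<noteq> {}"
  defines "h \<equiv> Max \<Delta>"
  shows "hook_weight t \<Delta> = - hook_factor t \<Delta> h * hook_weight t (\<Delta> - {h})"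
proof -
  have h: "h \<in> \<Delta>" "\<And>x. x \<in> \<Delta> \<Longrightarrow> x \<le> h" using assms by auto
  have "hook_factor t (\<Delta> - {h}) x = hook_factor t \<Delta> x" if "x \<in> \<Delta> - {h}" for x
  proof -
    have "x < h" using h that by force
    then have "hook_sign (\<Delta> - {h}) j = hook_sign \<Delta> j" if "j \<in> {1..x-1}" for j
      using that by (auto simp: hook_sign_def)
    then show ?thesis unfolding hook_factor_def by (intro arg_cong2[of _ _ _ _ "(*)"] prod.cong) auto
  qed
  then have "(\<Prod>x\<in>\<Delta> - {h}. hook_factor t (\<Delta> - {h}) x) = (\<Prod>x\<in>\<Delta> - {h}. hook_factor t \<Delta> x)" by (rule prod.cong[OF refl])
  moreover have "(\<Prod>x\<in>\<Delta>. hook_factor t \<Delta> x) = hook_factor t \<Delta> h * (\<Prod>x\<in>\<Delta> - {h}. hook_factor t \<Delta> x)"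
    using assms(1) h by (subst prod.remove[of _ h]) auto
  moreover have "card \<Delta> = Suc (card (\<Delta> - {h}))" using assms(1) h by (metis card.remove)
  ultimately show ?thesis by (simp add: hook_weight_def)
qed

text \<open>With a_i = \<rho> + N i the factor is a_(i+1) a_(i-1) / a_i^2, so two telescoping
  products, one up and one down, are superposed.\<close>

lemma prod_telescope_step:
  fixes \<rho> N :: complex
  assumes "\<And>i :: nat. \<rho> + N * of_nat i \<noteq> 0" "\<rho> - N \<noteq> 0"
  shows "(\<Prod>i<n. ((\<rho> + N * of_nat i)\<^sup>2 - N\<^sup>2) / (\<rho> + N * of_nat i)\<^sup>2) =
    ((\<rho> + N * of_nat n) * (\<rho> - N)) / (\<rho> * (\<rho> + N * of_nat n - N))"
proof (induction n)
  case 0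
  then show ?case using assms(1)[of 0] assms(2) by simp
next
  case (Suc n)
  define a where "a = \<rho> + N * of_nat n"
  have a: "a \<noteq> 0" "a + N \<noteq> 0" "\<rho> \<noteq> 0" using assms(1)[of n] assms(1)[of "Suc n"] assms(1)[of 0]
    by (auto simp: a_def algebra_simps)
  have aN: "a - N \<noteq> 0"
  proof (cases n)
    case 0 then show ?thesis using assms(2) by (simp add: a_def)
  next
    case (Suc n') then show ?thesis using assms(1)[of n'] by (simp add: a_def algebra_simps)
  qed
  have "(\<Prod>i<Suc n. ((\<rho> + N * of_nat i)\<^sup>2 - N\<^sup>2) / (\<rho> + N * of_nat i)\<^sup>2)
     = (a * (\<rho> - N)) / (\<rho> * (a - N)) * ((a\<^sup>2 - N\<^sup>2) / a\<^sup>2)" using Suc by (simp add: a_def)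
  also have "a\<^sup>2 - N\<^sup>2 = (a + N) * (a - N)" by (simp add: power2_eq_square algebra_simps)
  also have "(a * (\<rho> - N)) / (\<rho> * (a - N)) * (((a + N) * (a - N)) / a\<^sup>2) = ((a + N) * (\<rho> - N)) / (\<rho> * a)"
    using a aN by (simp add: divide_simps power2_eq_square)
  also have "a + N = \<rho> + N * of_nat (Suc n)" by (simp add: a_def algebra_simps)
  also have "a = \<rho> + N * of_nat (Suc n) - N" by (simp add: a_def algebra_simps)
  finally show ?case .
qed

lemma prod_minus_reflect:
  assumes "N \<ge> 1"
  shows "(\<Prod>\<rho>=1..N - 1. (of_nat \<rho> - of_nat N) / of_nat \<rho>) = (- 1 :: complex) ^ (N - 1)"
proof -
  have "(\<Prod>\<rho>=1..N - 1. (of_nat \<rho> - of_nat N :: complex)) = (\<Prod>\<rho>=1..N - 1. (- 1) * of_nat \<rho>)"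
    by (rule prod.reindex_bij_witness[of _ "\<lambda>\<rho>. N - \<rho>" "\<lambda>\<rho>. N - \<rho>"]) (auto simp: of_nat_diff)
  also have "\<dots> = (- 1) ^ (N - 1) * (\<Prod>\<rho>=1..N - 1. of_nat \<rho>)" by (simp only: prod.distrib prod_constant) simp
  finally show ?thesis by (simp add: prod_dividef)
qed

text \<open>Here h is added above all elements of a core. The numbers h + \<tau>_j j are the
  positive a for which a - h is a bead. Sorted by residue modulo N the factors telescope, and only
  the ends of the runners survive. After centring at c, opposite runners end at u_l and -u_l, which
  gives the differences of squares; the runners 0, c and that of h supply the rest.\<close>

lemma hook_factor_core_set:
  fixes t k h :: nat and m :: "nat \<Rightarrow> int"
  defines "N \<equiv> 2 * (int t + 1)" and "c \<equiv> int t + 1"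
  defines "r \<equiv> int h mod N"
  assumes h: "h \<notin> core_set t m" "\<And>x. x \<in> core_set t m \<Longrightarrow> x < h"
    and row_r: "runner t m r = int h div N"
    and k: "k < t" "r = c + (int k + 1) \<or> r = c - (int k + 1)"
  shows "hook_factor (of_nat t) (insert h (core_set t m)) h =
    - ((of_int (int h + c) / of_int (int h - c)) *
      (\<Prod>l\<in>{..<t} - {k}. of_int ((int h + c)\<^sup>2 - (residue_shift t m l)\<^sup>2) / of_int ((int h - c)\<^sup>2 - (residue_shift t m l)\<^sup>2)))"
proof -
  define \<Delta> where "\<Delta> = insert h (core_set t m)"
  define q where "q = int h div N"
  define F where "F a = (of_int (a\<^sup>2 - N\<^sup>2) / of_int (a\<^sup>2) :: complex)" for a :: int
  \<comment> \<open>A member j < h puts a bead at j and gives a = h + j; a non-member puts a bead at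
    -j and gives a = h - j.\<close>
  define A where "A = {a :: int. 0 < a \<and> bead t m (a - int h)}"
  have Nc: "N = 2 * c" "c \<ge> 1" "N > 0" by (auto simp: N_def c_def)
  have r: "0 < r" "r < N" "r \<noteq> c" using k by (auto simp: c_def N_def)
  have hqr: "int h = N * q + r" by (simp add: q_def r_def)
  have q0: "q \<ge> 0" unfolding q_def using Nc(3) by (simp add: pos_imp_zdiv_nonneg_iff)
  have h0: "h > 0" using hqr q0 r Nc by (cases h) (auto simp: r_def)
  have mem: "x \<in> core_set t m \<longleftrightarrow> bead t m (int x)" for x by (simp add: core_set_def)

  have step1: "(\<Prod>j=1..h - 1. 1 - ((2 * of_nat t + 2) / (of_nat h + hook_sign \<Delta> j * of_nat j))\<^sup>2) = (\<Prod>a\<in>A. F a)"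
  proof (rule prod.reindex_bij_witness[of _ "\<lambda>a. nat \<bar>a - int h\<bar>" "\<lambda>j. if j \<in> \<Delta> then int h + int j else int h - int j"])
    fix j assume j: "j \<in> {1..h-1}"
    then have jh: "j \<noteq> h" "j < h" "j \<ge> 1" using h0 by auto
    show "nat \<bar>(if j \<in> \<Delta> then int h + int j else int h - int j) - int h\<bar> = j" by simp
    show "(if j \<in> \<Delta> then int h + int j else int h - int j) \<in> A"
    proof (cases "j \<in> \<Delta>")
      case True
      then show ?thesis using jh by (simp add: A_def \<Delta>_def mem)
    next
      case False
      then have "\<not> bead t m (int j)" using jh by (simp add: \<Delta>_def mem)
      then have "bead t m (- int j)" using bead_uminus[of "int j" t m] jh by simp
      then show ?thesis using False jh by (simp add: A_def)
    qed
    define a where "a = (if j \<in> \<Delta> then int h + int j else int h - int j)"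
    have a: "of_nat h + hook_sign \<Delta> j * of_nat j = (of_int a :: complex)" by (simp add: a_def hook_sign_def)
    have "a \<noteq> 0" using jh by (auto simp: a_def)
    then have "1 - (of_int N / of_int a)\<^sup>2 = (F a :: complex)"
      by (simp add: F_def power_divide diff_divide_distrib)
    moreover have "2 * of_nat t + 2 = (of_int N :: complex)" by (simp add: N_def)
    ultimately show "F (if j \<in> \<Delta> then int h + int j else int h - int j)
        = 1 - ((2 * of_nat t + 2) / (of_nat h + hook_sign \<Delta> j * of_nat j))\<^sup>2"
      by (simp only: a a_def[symmetric])
  next
    fix a assume "a \<in> A"
    then have a: "0 < a" "bead t m (a - int h)" by (auto simp: A_def)
    define s where "s = a - int h"
    have s: "s \<noteq> 0" "bead t m s" using a(2) not_bead_0[of t m] by (auto simp: s_def)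
    show "(if nat \<bar>a - int h\<bar> \<in> \<Delta> then int h + int (nat \<bar>a - int h\<bar>) else int h - int (nat \<bar>a - int h\<bar>)) = a"
      and "nat \<bar>a - int h\<bar> \<in> {1..h-1}"
    proof -
      show "(if nat \<bar>a - int h\<bar> \<in> \<Delta> then int h + int (nat \<bar>a - int h\<bar>) else int h - int (nat \<bar>a - int h\<bar>)) = a"
      proof (cases "s > 0")
        case True
        then have "nat \<bar>s\<bar> \<in> \<Delta>" using s by (simp add: \<Delta>_def mem)
        then show ?thesis using True by (simp add: s_def)
      next
        case False
        then have "\<not> bead t m (- s)" using bead_uminus[of s t m] s by simp
        then have "nat \<bar>s\<bar> \<notin> core_set t m" using False by (simp add: mem)
        moreover have "nat \<bar>s\<bar> \<noteq> h" using False a(1) s_def by auto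
        ultimately have "nat \<bar>s\<bar> \<notin> \<Delta>" by (simp add: \<Delta>_def)
        then show ?thesis using False by (simp add: s_def)
      qed
      show "nat \<bar>a - int h\<bar> \<in> {1..h-1}"
      proof (cases "s > 0")
        case True
        then have "nat s < h" using s h(2)[of "nat s"] by (simp add: mem)
        then show ?thesis using True by (auto simp: s_def)
      next
        case False
        then show ?thesis using a(1) s(1) by (auto simp: s_def)
      qed
    qed
  qed

  define e where "e \<rho> = (\<rho> - int h) mod N" for \<rho> :: int
  \<comment> \<open>Among the numbers a = \<rho> + N i, those with a - h a bead are exactly the ones
    with i < n \<rho>.\<close>
  define n where "n \<rho> = runner t m (e \<rho>) - (\<rho> - int h) div N" for \<rho> :: int
  have bead_n: "bead t m (\<rho> + N * i - int h) \<longleftrightarrow> i < n \<rho>" for \<rho> i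
  proof -
    have "\<rho> + N * i - int h = (\<rho> - int h) + i * N" by (simp add: algebra_simps)
    then have "(\<rho> + N * i - int h) div N = ((\<rho> - int h) + i * N) div N"
      "(\<rho> + N * i - int h) mod N = ((\<rho> - int h) + i * N) mod N" by (simp_all only:)
    then have "(\<rho> + N * i - int h) div N = (\<rho> - int h) div N + i" "(\<rho> + N * i - int h) mod N = e \<rho>"
      unfolding e_def using Nc(3) div_mult_self1[of N "\<rho> - int h" i] mod_mult_self1[of "\<rho> - int h" i N]
      by linarith+
    then show ?thesis unfolding bead_def N_def[symmetric] n_def by auto
  qed
  have e0: "e 0 = N - r"
    using r Nc by (simp add: e_def r_def zmod_zminus1_eq_if)
  have row_e0: "runner t m (N - r) = - q" using runner_reflect[of r t m] r row_r by (simp add: N_def q_def)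
  \<comment> \<open>In the class of 0 the topmost bead is at -h, that is a = 0, which is not
    positive; this class contributes no factor.\<close>
  have n0: "n 0 = 1"
  proof -
    have "(0 - int h) div N = - q - 1" using r Nc by (simp add: q_def r_def zdiv_zminus1_eq_if)
    then show ?thesis by (simp add: n_def e0 row_e0)
  qed
  \<comment> \<open>A negative value would leave -(h + N - \<rho>) without a bead and so put h + N -
    \<rho>, which exceeds h, into the core.\<close>
  have n_nonneg: "n \<rho> \<ge> 0" if "\<rho> \<in> {1..N-1}" for \<rho>
  proof (rule ccontr)
    assume "\<not> n \<rho> \<ge> 0"
    then have "\<not> bead t m (\<rho> + N * (-1) - int h)" by (simp only: bead_n)
    moreover have "\<rho> + N * (-1) - int h = - int (nat (int h + N - \<rho>))" using that by simp
    ultimately have "\<not> bead t m (- int (nat (int h + N - \<rho>)))" by simp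
    then have "bead t m (int (nat (int h + N - \<rho>)))"
      using bead_uminus[of "int (nat (int h + N - \<rho>))" t m] that h0 by auto
    then have "nat (int h + N - \<rho>) < h" using h(2) mem by blast
    then show False using that by auto
  qed
  have "(\<Prod>a\<in>A. F a) = (\<Prod>p\<in>(SIGMA \<rho>:{1..N-1}. {..<nat (n \<rho>)}). F (fst p + N * int (snd p)))"
  proof (rule prod.reindex_bij_witness[of _ "\<lambda>p. fst p + N * int (snd p)" "\<lambda>a. (a mod N, nat (a div N))"])
    fix a assume a: "a \<in> A"
    then have a0: "0 < a" by (simp add: A_def)
    have d0: "a div N \<ge> 0" using a0 Nc by (simp add: pos_imp_zdiv_nonneg_iff)
    show aa: "fst (a mod N, nat (a div N)) + N * int (snd (a mod N, nat (a div N))) = a" using d0 by simp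
    then show "F (fst (a mod N, nat (a div N)) + N * int (snd (a mod N, nat (a div N)))) = F a" by simp
    have "bead t m (a mod N + N * (a div N) - int h)" using a by (simp add: A_def)
    then have b: "a div N < n (a mod N)" by (simp only: bead_n)
    have "a mod N \<noteq> 0"
    proof
      assume z: "a mod N = 0"
      then have "a div N = 0" using b d0 n0 by simp
      then show False using z a0 by (metis div_mult_mod_eq add.right_neutral less_irrefl mult_zero_left)
    qed
    then show "(a mod N, nat (a div N)) \<in> (SIGMA \<rho>:{1..N-1}. {..<nat (n \<rho>)})"
      using b d0 pos_mod_sign[OF Nc(3), of a] pos_mod_bound[OF Nc(3), of a] by auto
  next
    fix p assume "p \<in> (SIGMA \<rho>:{1..N-1}. {..<nat (n \<rho>)})"
    then obtain \<rho> i where p: "p = (\<rho>, i)" "1 \<le> \<rho>" "\<rho> \<le> N - 1" "int i < n \<rho>" by (cases p) auto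
    have "(\<rho> + N * int i) mod N = \<rho>" "(\<rho> + N * int i) div N = int i" using p by simp_all
    then show "((fst p + N * int (snd p)) mod N, nat ((fst p + N * int (snd p)) div N)) = p" by (simp add: p(1))
    have "bead t m (\<rho> + N * int i - int h)" using p(4) by (simp only: bead_n)
    moreover have "0 < \<rho> + N * int i" using p Nc by (simp add: add_pos_nonneg)
    ultimately show "fst p + N * int (snd p) \<in> A" by (simp add: A_def p(1))
  qed
  also have "\<dots> = (\<Prod>\<rho>\<in>{1..N-1}. \<Prod>i<nat (n \<rho>). F (\<rho> + N * int i))"
    by (subst prod.Sigma) (auto simp: case_prod_beta)
  also have "\<dots> = (\<Prod>\<rho>\<in>{1..N-1}. (of_int (\<rho> - N) / of_int \<rho>) * (of_int (\<rho> + N * n \<rho>) / of_int (\<rho> + N * n \<rho> - N)))"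
  proof (intro prod.cong refl)
    fix \<rho> assume \<rho>: "\<rho> \<in> {1..N-1}"
    have nz: "of_int \<rho> + of_int N * of_nat i \<noteq> (0::complex)" for i
    proof -
      have "0 < \<rho> + N * int i" using \<rho> Nc by (simp add: add_pos_nonneg)
      then have "of_int (\<rho> + N * int i) \<noteq> (0::complex)" by (simp del: of_int_add of_int_diff of_int_mult)
      then show ?thesis by simp
    qed
    have nz2: "of_int \<rho> - of_int N \<noteq> (0::complex)"
    proof -
      have "of_int (\<rho> - N) \<noteq> (0::complex)" using \<rho> by (simp del: of_int_add of_int_diff of_int_mult)
      then show ?thesis by simp
    qed
    have "(\<Prod>i<nat (n \<rho>). F (\<rho> + N * int i)) = (\<Prod>i<nat (n \<rho>). ((of_int \<rho> + of_int N * of_nat i)\<^sup>2 - (of_int N)\<^sup>2) / (of_int \<rho> + of_int N * of_nat i)\<^sup>2)"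
      by (intro prod.cong refl) (simp add: F_def)
    also have "\<dots> = ((of_int \<rho> + of_int N * of_nat (nat (n \<rho>))) * (of_int \<rho> - of_int N)) / (of_int \<rho> * (of_int \<rho> + of_int N * of_nat (nat (n \<rho>)) - of_int N))"
      by (rule prod_telescope_step[OF nz nz2])
    also have "\<dots> = (of_int (\<rho> - N) / of_int \<rho>) * (of_int (\<rho> + N * n \<rho>) / of_int (\<rho> + N * n \<rho> - N))"
      using n_nonneg[OF \<rho>] by (simp add: mult.commute)
    finally show "(\<Prod>i<nat (n \<rho>). F (\<rho> + N * int i)) = (of_int (\<rho> - N) / of_int \<rho>) * (of_int (\<rho> + N * n \<rho>) / of_int (\<rho> + N * n \<rho> - N))" .
  qed
  also have "\<dots> = (\<Prod>\<rho>\<in>{1..N-1}. of_int (\<rho> - N) / of_int \<rho>) * (\<Prod>\<rho>\<in>{1..N-1}. of_int (\<rho> + N * n \<rho>) / of_int (\<rho> + N * n \<rho> - N))"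
    by (rule prod.distrib)
  also have "(\<Prod>\<rho>\<in>{1..N-1}. of_int (\<rho> - N) / of_int \<rho>) = (- 1 :: complex)"
  proof -
    define N' where "N' = 2 * (t + 1)"
    have NN: "N = int N'" by (simp add: N_def N'_def)
    have "(\<Prod>\<rho>\<in>{1..N-1}. of_int (\<rho> - N) / of_int \<rho>) = (\<Prod>\<rho>=1..N' - 1. (of_nat \<rho> - of_nat N') / of_nat \<rho> :: complex)"
      by (rule prod.reindex_bij_witness[of _ int nat]) (auto simp: NN)
    also have "\<dots> = (- 1) ^ (N' - 1)" by (rule prod_minus_reflect) (simp add: N'_def)
    also have "\<dots> = - 1" by (simp add: N'_def)
    finally show ?thesis .
  qed
  finally have step2: "(\<Prod>a\<in>A. F a) = - (\<Prod>\<rho>\<in>{1..N-1}. of_int (\<rho> + N * n \<rho>) / of_int (\<rho> + N * n \<rho> - N))" by simp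

  \<comment> \<open>N * runner + x is the first empty position on runner x; with c subtracted,
    opposite runners have opposite values.\<close>
  define U where "U x = N * runner t m x + x - c" for x
  define G where "G x = (of_int (int h + c + U x) / of_int (int h - c + U x) :: complex)" for x
  have Un: "\<rho> + N * n \<rho> = int h + c + U (e \<rho>)" for \<rho>
  proof -
    have "N * ((\<rho> - int h) div N) + e \<rho> = \<rho> - int h" by (simp add: e_def)
    then show ?thesis unfolding n_def U_def by (simp add: algebra_simps)
  qed
  have Un': "\<rho> + N * n \<rho> - N = int h - c + U (e \<rho>)" for \<rho>
    using Un[of \<rho>] Nc(1) by linarith
  have "(\<Prod>\<rho>\<in>{1..N-1}. of_int (\<rho> + N * n \<rho>) / of_int (\<rho> + N * n \<rho> - N)) = (\<Prod>\<rho>\<in>{1..N-1}. G (e \<rho>))"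
    by (intro prod.cong refl) (simp only: G_def Un[symmetric] Un'[symmetric])
  \<comment> \<open>The map e permutes the residues, and \<rho> = 0, which does not occur,
    corresponds to the residue N - r opposite to that of h.\<close>
  also have "\<dots> = (\<Prod>x\<in>{0..N-1} - {N - r}. G x)"
  proof (rule prod.reindex_bij_witness[of _ "\<lambda>x. (x + int h) mod N" e])
    fix \<rho> assume \<rho>: "\<rho> \<in> {1..N-1}"
    have "(e \<rho> + int h) mod N = \<rho> mod N" unfolding e_def by (simp add: mod_simps)
    then show b: "(e \<rho> + int h) mod N = \<rho>" using \<rho> by simp
    have "e \<rho> \<noteq> e 0"
    proof
      assume "e \<rho> = e 0"
      then have "(e 0 + int h) mod N = \<rho>" using b by simp
      moreover have "(e 0 + int h) mod N = 0" unfolding e_def by (simp add: mod_simps)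
      ultimately show False using \<rho> by simp
    qed
    then show "e \<rho> \<in> {0..N-1} - {N - r}" using pos_mod_sign[OF Nc(3), of "\<rho> - int h"] pos_mod_bound[OF Nc(3), of "\<rho> - int h"]
      unfolding e0 by (simp add: e_def)
  next
    fix x assume x: "x \<in> {0..N-1} - {N - r}"
    have "e ((x + int h) mod N) = x mod N" unfolding e_def by (simp add: mod_simps)
    then show ee: "e ((x + int h) mod N) = x" using x by simp
    have "(x + int h) mod N \<noteq> 0" using ee e0 x by auto
    then show "(x + int h) mod N \<in> {1..N-1}"
      using pos_mod_sign[OF Nc(3), of "x + int h"] pos_mod_bound[OF Nc(3), of "x + int h"] by auto
  qed simp
  also have "{0..N-1} - {N - r} = {0, c, r} \<union> ((\<lambda>l. c + (int l + 1)) ` ({..<t} - {k}) \<union> (\<lambda>l. c - (int l + 1)) ` ({..<t} - {k}))"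
  proof -
    have "x \<in> {0..N-1} - {N - r} \<longleftrightarrow> x \<in> {0, c, r} \<union> ((\<lambda>l. c + (int l + 1)) ` ({..<t} - {k}) \<union> (\<lambda>l. c - (int l + 1)) ` ({..<t} - {k}))" for x
    proof
      assume x: "x \<in> {0..N-1} - {N - r}"
      consider "x = 0" | "x = c" | "x = r" | "x > c" "x \<noteq> r" | "0 < x" "x < c" "x \<noteq> r" using x by force
      then show "x \<in> {0, c, r} \<union> ((\<lambda>l. c + (int l + 1)) ` ({..<t} - {k}) \<union> (\<lambda>l. c - (int l + 1)) ` ({..<t} - {k}))"
      proof cases
        case 4
        define l where "l = nat (x - c - 1)"
        have "x = c + (int l + 1)" using 4 by (simp add: l_def)
        moreover have "l < t"
        proof -
          have "int l = x - c - 1" "x \<le> N - 1" using x 4 by (simp_all add: l_def)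
          then have "int l < int t" unfolding N_def c_def by presburger
          then show ?thesis by simp
        qed
        moreover have "l \<noteq> k" using x 4 k(2) calculation(1) Nc by auto
        ultimately show ?thesis by blast
      next
        case 5
        define l where "l = nat (c - x - 1)"
        have "x = c - (int l + 1)" using 5 by (simp add: l_def)
        moreover have "l < t"
        proof -
          have "int l = c - x - 1" using 5 by (simp add: l_def)
          then have "int l < int t" using 5(1) unfolding c_def by linarith
          then show ?thesis by simp
        qed
        moreover have "l \<noteq> k" using x 5 k(2) calculation(1) Nc by auto
        ultimately show ?thesis by blast
      qed auto
    next
      assume x: "x \<in> {0, c, r} \<union> ((\<lambda>l. c + (int l + 1)) ` ({..<t} - {k}) \<union> (\<lambda>l. c - (int l + 1)) ` ({..<t} - {k}))"
      have "x \<in> {0..N-1}" using x r Nc k(1) by (auto simp: c_def N_def)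
      moreover have "x \<noteq> N - r" using x k Nc r by auto
      ultimately show "x \<in> {0..N-1} - {N - r}" by blast
    qed
    then show ?thesis by blast
  qed
  also have "(\<Prod>x\<in>{0, c, r} \<union> ((\<lambda>l. c + (int l + 1)) ` ({..<t} - {k}) \<union> (\<lambda>l. c - (int l + 1)) ` ({..<t} - {k})). G x)
    = (\<Prod>x\<in>{0, c, r}. G x) * ((\<Prod>x\<in>(\<lambda>l. c + (int l + 1)) ` ({..<t} - {k}). G x) * (\<Prod>x\<in>(\<lambda>l. c - (int l + 1)) ` ({..<t} - {k}). G x))"
  proof -
    have "{0, c, r} \<inter> ((\<lambda>l. c + (int l + 1)) ` ({..<t} - {k}) \<union> (\<lambda>l. c - (int l + 1)) ` ({..<t} - {k})) = {}"
      using k(2) Nc by (auto simp: c_def)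
    moreover have "(\<lambda>l. c + (int l + 1)) ` ({..<t} - {k}) \<inter> (\<lambda>l. c - (int l + 1)) ` ({..<t} - {k}) = {}" by auto
    ultimately show ?thesis by (simp only: prod.union_disjoint finite_Un finite_imageI finite_Diff finite_lessThan finite.intros simp_thms)
  qed
  also have "(\<Prod>x\<in>(\<lambda>l. c + (int l + 1)) ` ({..<t} - {k}). G x) = (\<Prod>l\<in>{..<t} - {k}. G (c + (int l + 1)))"
    by (subst prod.reindex) (auto simp: inj_on_def)
  also have "(\<Prod>x\<in>(\<lambda>l. c - (int l + 1)) ` ({..<t} - {k}). G x) = (\<Prod>l\<in>{..<t} - {k}. G (c - (int l + 1)))"
    by (subst prod.reindex) (auto simp: inj_on_def)
  also have "(\<Prod>l\<in>{..<t} - {k}. G (c + (int l + 1))) * (\<Prod>l\<in>{..<t} - {k}. G (c - (int l + 1)))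
    = (\<Prod>l\<in>{..<t} - {k}. of_int ((int h + c)\<^sup>2 - (residue_shift t m l)\<^sup>2) / of_int ((int h - c)\<^sup>2 - (residue_shift t m l)\<^sup>2))"
    unfolding prod.distrib[symmetric]
  proof (intro prod.cong refl)
    fix l assume "l \<in> {..<t} - {k}"
    then have l: "l < t" by simp
    define u where "u = residue_shift t m l"
    have "U (c + (int l + 1)) = u"
      unfolding U_def c_def runner_right[OF l] by (simp add: u_def residue_shift_def N_def)
    moreover have "U (c - (int l + 1)) = - u"
      unfolding U_def c_def runner_left[OF l] by (simp add: u_def residue_shift_def N_def)
    moreover have "(int h + c + u) * (int h + c + - u) = (int h + c)\<^sup>2 - u\<^sup>2"
      "(int h - c + u) * (int h - c + - u) = (int h - c)\<^sup>2 - u\<^sup>2" by (simp_all add: power2_eq_square algebra_simps)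
    ultimately show "G (c + (int l + 1)) * G (c - (int l + 1)) = of_int ((int h + c)\<^sup>2 - (residue_shift t m l)\<^sup>2) / of_int ((int h - c)\<^sup>2 - (residue_shift t m l)\<^sup>2)"
      unfolding G_def u_def[symmetric] by (simp only: times_divide_times_eq of_int_mult[symmetric])
  qed
  \<comment> \<open>Runner 0 gives h/(h - N) and the runner of h gives 2h/(2(h - c)). These cancel
    the leading factors 1 - N/h and 1 - c/h of the hook factor; only the contribution of runner c
    remains.\<close>
  also have "(\<Prod>x\<in>{0, c, r}. G x) = (of_nat h / of_int (int h - N)) * (of_int (int h + c) / of_int (int h - c)) * (of_nat h / of_int (int h - c))"
  proof -
    have "U 0 = - c" "U c = 0" by (simp_all add: U_def c_def)
    moreover have "U r = int h - c"
    proof -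
      have "U r = N * q + r - c" by (simp only: U_def row_r q_def)
      then show ?thesis by (simp only: hqr)
    qed
    ultimately have "G 0 = of_nat h / of_int (int h - N)" "G c = of_int (int h + c) / of_int (int h - c)"
      "G r = of_int (2 * int h) / of_int (2 * (int h - c))"
      using Nc by (simp_all add: G_def)
    moreover have "of_int (2 * int h) / of_int (2 * (int h - c)) = (of_nat h / of_int (int h - c) :: complex)"
      by (simp only: of_int_mult of_int_numeral mult_divide_mult_cancel_left_if) simp
    moreover have "(\<Prod>x\<in>{0, c, r}. G x) = G 0 * (G c * G r)" using Nc r by (subst prod.insert) auto
    ultimately show ?thesis by (simp only: mult.assoc)
  qed
  finally have step3: "(\<Prod>\<rho>\<in>{1..N-1}. of_int (\<rho> + N * n \<rho>) / of_int (\<rho> + N * n \<rho> - N)) =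
    (of_nat h / of_int (int h - N) :: complex) * (of_int (int h + c) / of_int (int h - c)) * (of_nat h / of_int (int h - c)) *
    (\<Prod>l\<in>{..<t} - {k}. of_int ((int h + c)\<^sup>2 - (residue_shift t m l)\<^sup>2) / of_int ((int h - c)\<^sup>2 - (residue_shift t m l)\<^sup>2))" .
  define Z where "Z = (\<Prod>l\<in>{..<t} - {k}. of_int ((int h + c)\<^sup>2 - (residue_shift t m l)\<^sup>2) / of_int ((int h - c)\<^sup>2 - (residue_shift t m l)\<^sup>2) :: complex)"
  have hN: "int h \<noteq> N" using r by (auto simp: r_def)
  have hc: "int h \<noteq> c"
  proof
    assume "int h = c"
    then have "r = c" using Nc by (simp add: r_def)
    then show False using r by simp
  qed
  define x y w where "x = (of_nat h :: complex)" and "y = (of_int c :: complex)" and "w = (of_int N :: complex)"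
  have nz: "x \<noteq> 0" "x - w \<noteq> 0" "x - y \<noteq> 0"
  proof -
    show "x \<noteq> 0" using h0 by (simp add: x_def)
    have "of_int (int h - N) \<noteq> (0 :: complex)" "of_int (int h - c) \<noteq> (0 :: complex)"
      using hN hc by (simp_all del: of_int_add of_int_diff of_int_mult)
    then show "x - w \<noteq> 0" "x - y \<noteq> 0" by (simp_all add: x_def w_def y_def)
  qed
  have "hook_factor (of_nat t) \<Delta> h = (1 - w / x) * (1 - y / x) * - ((x / (x - w)) * ((x + y) / (x - y)) * (x / (x - y)) * Z)"
  proof -
    have "2 * of_nat t + 2 = w" "of_nat t + 1 = y" by (simp_all add: w_def y_def N_def c_def)
    then show ?thesis
      unfolding hook_factor_def step1 step2 step3 Z_def[symmetric] by (simp add: x_def y_def w_def)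
  qed
  also have "\<dots> = - (((1 - w / x) * (x / (x - w))) * ((1 - y / x) * (x / (x - y))) * (((x + y) / (x - y)) * Z))"
    by (simp only: mult_minus_right mult_minus_left mult_ac)
  also have "(1 - w / x) * (x / (x - w)) = 1" using nz by (simp add: field_simps)
  also have "(1 - y / x) * (x / (x - y)) = 1" using nz by (simp add: field_simps)
  finally show ?thesis unfolding \<Delta>_def Z_def x_def y_def by simp
qed

lemma runner_update:
  assumes "k < t" "0 \<le> x" "x < 2 * (int t + 1)"
  shows "runner t (m(k := v)) x = (if x = int t + 1 + (int k + 1) then v
    else if x = int t + 1 - (int k + 1) then - v else runner t m x)"
  using assms by (auto simp: runner_def nat_eq_iff)

lemma residue_shift_update_other: "l \<noteq> k \<Longrightarrow> residue_shift t (m(k := v)) l = residue_shift t m l"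
  by (simp add: residue_shift_def)

lemma core_set_empty_iff: "core_set t m = {} \<longleftrightarrow> (\<forall>k<t. m k = 0)"
proof
  assume e: "core_set t m = {}"
  show "\<forall>k<t. m k = 0"
  proof (intro allI impI)
    fix k assume k: "k < t"
    have "\<not> bead t m (int x)" for x using e by (auto simp: core_set_def)
    from this[of "t + 1 + (k + 1)"] this[of "t + 1 - (k + 1)"]
    have "\<not> bead t m (int t + 1 + (int k + 1))" "\<not> bead t m (int t + 1 - (int k + 1))"
      using k by (simp_all add: of_nat_diff)
    then show "m k = 0" using k runner_right[OF k, of m] runner_left[OF k, of m] by (simp add: bead_def)
  qed
next
  assume m: "\<forall>k<t. m k = 0"
  have "runner t m x = 0" if "0 \<le> x" "x < 2 * (int t + 1)" for x
    using m that unfolding runner_def by (auto simp: nat_less_iff)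
  then have "\<not> bead t m (int x)" for x by (simp add: bead_def not_less pos_imp_zdiv_nonneg_iff)
  then show "core_set t m = {}" by (simp add: core_set_def)
qed

text \<open>As h + N lies outside the core, h is the last bead of its runner. Removing it lowers
  that runner by one and raises the opposite one, which is a change of one coordinate m k by 1;
  accordingly u_k moves by 2c towards 0, or past it when h < c.\<close>

lemma core_set_remove_Max:
  fixes t :: nat
  assumes ne: "core_set t m \<noteq> {}"
  defines "h \<equiv> Max (core_set t m)" and "c \<equiv> int t + 1" and "N \<equiv> 2 * (int t + 1)"
  shows "\<exists>k v. k < t \<and> core_set t (m(k := v)) = core_set t m - {h} \<and>
    (int h mod N = c + (int k + 1) \<or> int h mod N = c - (int k + 1)) \<and>
    runner t (m(k := v)) (int h mod N) = int h div N \<and>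
    (residue_shift t m k = int h + c \<and> v = m k - 1 \<or> residue_shift t m k = - (int h + c) \<and> v = m k + 1)"
proof -
  define r q where "r = int h mod N" and "q = int h div N"
  have N: "N > 0" "N = 2 * c" by (auto simp: N_def c_def)
  have h: "h \<in> core_set t m" "\<And>x. x \<in> core_set t m \<Longrightarrow> x \<le> h" using ne by (auto simp: h_def)
  have hqr: "int h = N * q + r" by (simp add: q_def r_def)
  have r: "0 \<le> r" "r < N" using N by (auto simp: r_def)
  have q0: "q \<ge> 0" unfolding q_def using N by (simp add: pos_imp_zdiv_nonneg_iff)
  have b: "q < runner t m r" using h(1) by (simp add: core_set_def bead_def q_def r_def N_def)
  have "h + nat N \<notin> core_set t m" using h(2)[of "h + nat N"] N by auto
  moreover have "int (h + nat N) = int h + N" using N by simp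
  ultimately have "\<not> bead t m (int h + N)" by (simp add: core_set_def)
  moreover have "(int h + N) div N = q + 1" "(int h + N) mod N = r" using N(1) by (simp_all add: q_def r_def)
  ultimately have "\<not> q + 1 < runner t m r" by (simp only: bead_def N_def[symmetric] simp_thms)
  then have row: "runner t m r = q + 1" using b by simp
  obtain k where k: "k < t" "r = c + (int k + 1) \<and> m k = q + 1 \<or> r = c - (int k + 1) \<and> m k = - (q + 1)"
  proof -
    have "r > c \<or> 0 < r \<and> r < c" using row q0 by (auto simp: runner_def c_def split: if_splits)
    then show thesis
    proof
      assume rc: "r > c"
      define k where "k = nat (r - c - 1)"
      have "r = c + (int k + 1)" "k < t" using rc r by (auto simp: k_def N_def c_def)
      then show thesis using that row runner_right[of k t m] by (simp add: c_def)
    next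
      assume rc: "0 < r \<and> r < c"
      define k where "k = nat (c - r - 1)"
      have "r = c - (int k + 1)" "k < t" using rc r by (auto simp: k_def N_def c_def)
      then show thesis using that[of k] row runner_left[of k t m] by (simp add: c_def)
    qed
  qed
  define v where "v = (if r = c + (int k + 1) then q else - q)"
  have row': "runner t (m(k := v)) x = (if x = r then q else if x = N - r then - q else runner t m x)"
    if "0 \<le> x" "x < N" for x
    using runner_update[OF k(1), of x m v] that k(2) N unfolding v_def c_def N_def by auto
  have rowN: "runner t m (N - r) = - (q + 1)"
    using runner_reflect[of r t m] row r k unfolding N_def c_def by auto
  have rNr: "r \<noteq> N - r" using k(2) N by auto
  have "core_set t (m(k := v)) = core_set t m - {h}"
  proof (rule Set.set_eqI)
    fix y
    define x where "x = int y mod N"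
    have x: "0 \<le> x" "x < N" using N by (auto simp: x_def)
    have y0: "int y div N \<ge> 0" using N by (simp add: pos_imp_zdiv_nonneg_iff)
    have B: "y \<in> core_set t m' \<longleftrightarrow> int y div N < runner t m' x" for m'
      by (simp add: core_set_def bead_def x_def N_def)
    have yh: "y = h \<longleftrightarrow> int y div N = q \<and> x = r"
    proof
      assume "int y div N = q \<and> x = r"
      then have "int y = N * q + r" by (auto simp: x_def)
      then show "y = h" using hqr by simp
    qed (simp add: q_def r_def x_def)
    show "y \<in> core_set t (m(k := v)) \<longleftrightarrow> y \<in> core_set t m - {h}"
    proof (cases "x = r")
      case True
      have "y \<in> core_set t (m(k := v)) \<longleftrightarrow> int y div N < q" using B row'[OF x] True by simp
      moreover have "y \<in> core_set t m \<longleftrightarrow> int y div N < q + 1" using B row True by simp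
      moreover have "y = h \<longleftrightarrow> int y div N = q" using yh True by blast
      ultimately show ?thesis unfolding Diff_iff singleton_iff by linarith
    next
      case False
      show ?thesis
      proof (cases "x = N - r")
        case True
        \<comment> \<open>Raising the opposite runner from -(q + 1) to -q concerns a negative
          position only, so the set of positive beads does not notice it.\<close>
        have "y \<in> core_set t (m(k := v)) \<longleftrightarrow> int y div N < - q" using B row'[OF x] True rNr by simp
        moreover have "y \<in> core_set t m \<longleftrightarrow> int y div N < - (q + 1)" using B rowN True by simp
        ultimately show ?thesis unfolding Diff_iff using y0 q0 by linarith
      next
        case nN: False
        have "y \<in> core_set t (m(k := v)) \<longleftrightarrow> y \<in> core_set t m" using B row'[OF x] False nN by simp
        then show ?thesis using yh False by blast
      qed
    qed
  qed
  moreover have "runner t (m(k := v)) r = q" using row'[OF r] by simp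
  moreover have "residue_shift t m k = int h + c \<and> v = m k - 1 \<or> residue_shift t m k = - (int h + c) \<and> v = m k + 1"
    using k(2)
  proof
    assume "r = c + (int k + 1) \<and> m k = q + 1"
    then show ?thesis using hqr by (simp add: residue_shift_def v_def c_def N_def algebra_simps)
  next
    assume a: "r = c - (int k + 1) \<and> m k = - (q + 1)"
    then have rr: "r = c - (int k + 1)" and mk: "m k = - (q + 1)" by auto
    have "r \<noteq> c + (int k + 1)" using rr by auto
    then have "v = m k + 1" by (simp add: v_def mk)
    moreover have "residue_shift t m k = - (int h + c)"
      unfolding residue_shift_def mk hqr rr N_def c_def by (simp add: algebra_simps)
    ultimately show ?thesis by blast
  qed
  ultimately show ?thesis using k unfolding r_def q_def by blast
qed

lemma shift_weight_update:
  assumes "k < t"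
  shows "shift_weight t m - shift_weight t (m(k := v)) =
    (int t + 1) * (m k)\<^sup>2 + (int k + 1) * m k - ((int t + 1) * v\<^sup>2 + (int k + 1) * v)"
proof -
  have "(\<Sum>l\<in>{..<t} - {k}. (int t + 1) * ((m(k := v)) l)\<^sup>2 + (int l + 1) * (m(k := v)) l)
    = (\<Sum>l\<in>{..<t} - {k}. (int t + 1) * (m l)\<^sup>2 + (int l + 1) * m l)"
    by (intro sum.cong) auto
  then show ?thesis unfolding shift_weight_def using assms
    by (simp add: sum.remove[of "{..<t}" k])
qed

lemma weyl_dim_id_nonzero: "weyl_dim t (\<lambda>i. int i + 1) \<noteq> 0"
proof -
  have *: "(int i + 1)\<^sup>2 - (int j + 1)\<^sup>2 \<noteq> 0" if "j < i" for i j
    using that power_strict_mono[of "int j + 1" "int i + 1" 2] by simp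
  then have "of_int ((int i + 1)\<^sup>2 - (int j + 1)\<^sup>2) \<noteq> (0 :: complex)" if "j < i" for i j
    using *[OF that] by (simp only: of_int_eq_0_iff simp_thms)
  moreover have "of_int (int i + 1) \<noteq> (0 :: complex)" for i
  proof -
    have "int i + 1 \<noteq> 0" by simp
    then show ?thesis by (simp only: of_int_eq_0_iff not_False_eq_True)
  qed
  ultimately show ?thesis unfolding weyl_dim_def by auto
qed

text \<open>Induction by removal of the largest hook h. One coordinate passes from h + c to h - c,
  or between their negatives, so the weight drops by h. The ratio of the two values of
  \<open>weyl_dim\<close> is minus the factor found in \<open>hook_factor_core_set\<close>, and that
  minus sign is the one contributed to \<open>hook_weight\<close> by the cardinality.\<close>

lemma core_set_weights:
  "int (\<Sum>(core_set t m)) = shift_weight t m \<and>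
   hook_weight (of_nat t) (core_set t m) * weyl_dim t (\<lambda>i. int i + 1) = weyl_dim t (residue_shift t m)"
proof (induction "card (core_set t m)" arbitrary: m rule: less_induct)
  case less
  show ?case
  proof (cases "core_set t m = {}")
    case True
    then have m0: "\<forall>k<t. m k = 0" by (simp add: core_set_empty_iff)
    then have "weyl_dim t (residue_shift t m) = weyl_dim t (\<lambda>i. int i + 1)"
      by (intro weyl_dim_cong) (simp add: residue_shift_def)
    moreover have "shift_weight t m = 0" using m0 by (simp add: shift_weight_def)
    ultimately show ?thesis using True by (simp add: hook_weight_def)
  next
    case False
    define h c N where "h = Max (core_set t m)" and "c = int t + 1" and "N = 2 * (int t + 1)"
    obtain k v where k: "k < t" and core: "core_set t (m(k := v)) = core_set t m - {h}"
      and r: "int h mod N = c + (int k + 1) \<or> int h mod N = c - (int k + 1)"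
      and row: "runner t (m(k := v)) (int h mod N) = int h div N"
      and u: "residue_shift t m k = int h + c \<and> v = m k - 1 \<or> residue_shift t m k = - (int h + c) \<and> v = m k + 1"
      using core_set_remove_Max[OF False] unfolding h_def c_def N_def by blast
    define m' where "m' = m(k := v)"
    have hin: "h \<in> core_set t m" using False by (simp add: h_def)
    have hmax: "x < h" if "x \<in> core_set t m'" for x
    proof -
      have "x \<le> h" "x \<noteq> h" using that core by (auto simp: m'_def h_def)
      then show ?thesis by simp
    qed
    have ins: "core_set t m = insert h (core_set t m')" using core hin by (auto simp: m'_def)
    have nin: "h \<notin> core_set t m'" using core by (simp add: m'_def)
    have "card (core_set t m') < card (core_set t m)" using ins nin by simp
    then have IH: "int (\<Sum>(core_set t m')) = shift_weight t m'"
      "hook_weight (of_nat t) (core_set t m') * weyl_dim t (\<lambda>i. int i + 1) = weyl_dim t (residue_shift t m')"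
      using less by auto
    have u': "residue_shift t m' k = int h - c \<and> residue_shift t m k = int h + c \<or>
       residue_shift t m' k = - (int h - c) \<and> residue_shift t m k = - (int h + c)"
    proof -
      have "residue_shift t m' k = residue_shift t m k - 2 * c" if "v = m k - 1"
        unfolding m'_def that by (simp add: residue_shift_def c_def algebra_simps)
      moreover have "residue_shift t m' k = residue_shift t m k + 2 * c" if "v = m k + 1"
        unfolding m'_def that by (simp add: residue_shift_def c_def algebra_simps)
      ultimately show ?thesis using u by auto
    qed
    have "shift_weight t m - shift_weight t m' = int h"
    proof -
      have "shift_weight t m - shift_weight t m' = c * (m k)\<^sup>2 + (int k + 1) * m k - (c * v\<^sup>2 + (int k + 1) * v)"
        using shift_weight_update[OF k, of m v] by (simp add: m'_def c_def)
      also have "\<dots> = int h"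
        using u
      proof
        assume a: "residue_shift t m k = int h + c \<and> v = m k - 1"
        then have "int h = 2 * c * m k + (int k + 1) - c" by (simp add: residue_shift_def c_def)
        then show ?thesis unfolding a[THEN conjunct2] by (simp add: power2_eq_square algebra_simps)
      next
        assume a: "residue_shift t m k = - (int h + c) \<and> v = m k + 1"
        then have "int h = - (2 * c * m k + (int k + 1)) - c" by (simp add: residue_shift_def c_def)
        then show ?thesis unfolding a[THEN conjunct2] by (simp add: power2_eq_square algebra_simps)
      qed
      finally show ?thesis .
    qed
    then have sw: "int (\<Sum>(core_set t m)) = shift_weight t m"
      using IH(1) ins nin by simp
    define D where "D x = (\<Prod>l\<in>{..<t} - {k}. of_int (x\<^sup>2 - (residue_shift t m l)\<^sup>2) :: complex)" for x
    obtain R where R: "\<And>x. weyl_dim t ((residue_shift t m)(k := x)) = R * (of_int x * D x)"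
      using weyl_dim_update[OF k, of "residue_shift t m"] unfolding D_def by blast
    have res': "residue_shift t m' = (residue_shift t m)(k := residue_shift t m' k)"
      by (rule ext) (simp add: m'_def residue_shift_update_other)
    have w: "weyl_dim t (residue_shift t m) = R * (of_int (residue_shift t m k) * D (residue_shift t m k))"
      using R[of "residue_shift t m k"] by simp
    have w': "weyl_dim t (residue_shift t m') = R * (of_int (residue_shift t m' k) * D (residue_shift t m' k))"
      using R[of "residue_shift t m' k"] res' by metis
    have Dm: "D (- x) = D x" for x by (simp add: D_def)
    have fac: "hook_factor (of_nat t) (core_set t m) h = - ((of_int (int h + c) / of_int (int h - c)) * (D (int h + c) / D (int h - c)))"
    proof -
      have "(\<Prod>l\<in>{..<t} - {k}. of_int ((int h + c)\<^sup>2 - (residue_shift t m' l)\<^sup>2) / of_int ((int h - c)\<^sup>2 - (residue_shift t m' l)\<^sup>2))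
        = D (int h + c) / D (int h - c)"
        unfolding D_def prod_dividef[symmetric] by (intro prod.cong refl) (simp add: m'_def residue_shift_update_other)
      then show ?thesis
        using hook_factor_core_set[of h t m' k, OF nin hmax] row r k unfolding ins c_def N_def m'_def by simp
    qed
    \<comment> \<open>Up to sign h - c is a coordinate of the smaller core; coordinates are nonzero
      and differ from all others and their negatives.\<close>
    have nz: "of_int (int h - c) \<noteq> (0::complex)" "D (int h - c) \<noteq> 0"
    proof -
      have "int h - c \<noteq> 0" using u' residue_shift_facts(1)[OF k, of m'] by auto
      then show "of_int (int h - c) \<noteq> (0::complex)" by (simp only: of_int_eq_0_iff not_False_eq_True)
      have "(int h - c)\<^sup>2 - (residue_shift t m l)\<^sup>2 \<noteq> 0" if "l \<in> {..<t} - {k}" for l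
      proof -
        have "l < t" "k \<noteq> l" using that by auto
        then have "residue_shift t m' k \<noteq> residue_shift t m l" "residue_shift t m' k \<noteq> - residue_shift t m l"
          using residue_shift_facts(2,3)[OF k, of l m'] by (auto simp: m'_def residue_shift_update_other)
        then have "(residue_shift t m' k)\<^sup>2 \<noteq> (residue_shift t m l)\<^sup>2" by (simp add: power2_eq_iff)
        moreover have "(residue_shift t m' k)\<^sup>2 = (int h - c)\<^sup>2"
          using u' by (metis power2_minus)
        ultimately show ?thesis by simp
      qed
      then show "D (int h - c) \<noteq> 0" by (simp add: D_def del: of_int_diff of_int_power)
    qed
    have "hook_weight (of_nat t) (core_set t m) = - hook_factor (of_nat t) (core_set t m) h * hook_weight (of_nat t) (core_set t m')"
      using hook_weight_remove_Max[OF finite_core_set False] core unfolding h_def m'_def by simp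
    then have "hook_weight (of_nat t) (core_set t m) * weyl_dim t (\<lambda>i. int i + 1)
      = (of_int (int h + c) / of_int (int h - c)) * (D (int h + c) / D (int h - c)) * weyl_dim t (residue_shift t m')"
      unfolding fac IH(2)[symmetric] by simp
    also have "\<dots> = weyl_dim t (residue_shift t m)"
      using u'
    proof
      assume "residue_shift t m' k = int h - c \<and> residue_shift t m k = int h + c"
      then show ?thesis unfolding w w' using nz by (simp del: of_int_diff of_int_add)
    next
      assume a: "residue_shift t m' k = - (int h - c) \<and> residue_shift t m k = - (int h + c)"
      show ?thesis unfolding w w' a[THEN conjunct1] a[THEN conjunct2] Dm of_int_minus
        using nz by (simp del: of_int_diff of_int_add)
    qed
    finally show ?thesis using sw by blast
  qed
qed

text \<open>A positive m k is visible as elements on its own runner, a negative one only on the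
  opposite runner; hence the two comparisons.\<close>

lemma core_set_inj:
  assumes "core_set t m = core_set t m'" "k < t"
  shows "m k = m' k"
proof -
  have b: "bead t m (int x) \<longleftrightarrow> bead t m' (int x)" for x using assms(1) by (auto simp: core_set_def)
  define N where "N = 2 * (int t + 1)"
  have rows: "i < runner t m r \<longleftrightarrow> i < runner t m' r" if "0 \<le> i" "0 \<le> r" "r < N" for i r
  proof -
    have "N * i + r = int (nat (N * i + r))" using that by (simp add: N_def)
    then have "bead t m (N * i + r) \<longleftrightarrow> bead t m' (N * i + r)" using b by metis
    moreover have "(N * i + r) div N = i" "(N * i + r) mod N = r" using that by simp_all
    ultimately show ?thesis by (simp only: bead_def N_def[symmetric])
  qed
  have right: "i < m k \<longleftrightarrow> i < m' k" if "0 \<le> i" for i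
    using rows[OF that, of "int t + 1 + (int k + 1)"] assms(2)
    by (simp only: runner_right) (simp add: N_def)
  have left: "i < - m k \<longleftrightarrow> i < - m' k" if "0 \<le> i" for i
    using rows[OF that, of "int t + 1 - (int k + 1)"] assms(2)
    by (simp only: runner_left) (simp add: N_def)
  show ?thesis
    using right[of "max 0 (m k)"] right[of "max 0 (m' k)"] left[of "max 0 (- m k)"] left[of "max 0 (- m' k)"] by linarith
qed

text \<open>Each conclusion excludes one way for a hook factor to vanish: the two leading factors,
  and a number h + \<tau>_j j equal to 2t + 2 with j outside \<Delta> (difference) or inside
  \<Delta> (sum).\<close>

lemma hook_weight_nonzeroD:
  fixes t :: nat
  assumes \<Delta>: "finite \<Delta>" "0 \<notin> \<Delta>" "hook_weight (of_nat t) \<Delta> \<noteq> 0"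
  shows "t + 1 \<notin> \<Delta>" "2 * (t + 1) \<notin> \<Delta>"
    and "\<And>h. h \<in> \<Delta> \<Longrightarrow> h > 2 * (t + 1) \<Longrightarrow> h - 2 * (t + 1) \<in> \<Delta>"
    and "\<And>h j. h \<in> \<Delta> \<Longrightarrow> j \<in> \<Delta> \<Longrightarrow> j < h \<Longrightarrow> h + j \<noteq> 2 * (t + 1)"
proof -
  have f: "hook_factor (of_nat t) \<Delta> h \<noteq> 0" if "h \<in> \<Delta>" for h
    using \<Delta> that unfolding hook_weight_def by auto
  have c0: "of_nat t + 1 \<noteq> (0 :: complex)" by (metis of_nat_Suc of_nat_eq_0_iff nat.distinct(1) add.commute)
  have N: "2 * of_nat t + 2 = (of_nat (2 * (t + 1)) :: complex)" by simp
  have N0: "(of_nat (2 * (t + 1)) :: complex) \<noteq> 0" by (simp only: of_nat_eq_0_iff) simp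
  show "t + 1 \<notin> \<Delta>"
  proof
    assume "t + 1 \<in> \<Delta>"
    moreover have "hook_factor (of_nat t) \<Delta> (t + 1) = 0"
      using c0 unfolding hook_factor_def by (simp add: add.commute)
    ultimately show False using f by blast
  qed
  show "2 * (t + 1) \<notin> \<Delta>"
  proof
    assume "2 * (t + 1) \<in> \<Delta>"
    moreover have "hook_factor (of_nat t) \<Delta> (2 * (t + 1)) = 0"
      unfolding hook_factor_def N using N0 by (simp del: of_nat_mult of_nat_add of_nat_Suc)
    ultimately show False using f by blast
  qed
  have zero: "hook_factor (of_nat t) \<Delta> h = 0"
    if "1 \<le> j" "j < h" "of_nat h + hook_sign \<Delta> j * of_nat j = (of_nat (2 * (t + 1)) :: complex)" for h j
  proof -
    have "(\<Prod>j=1..h - 1. 1 - ((2 * of_nat t + 2) / (of_nat h + hook_sign \<Delta> j * of_nat j))\<^sup>2) = (0 :: complex)"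
    proof (rule prod_zero)
      show "\<exists>j\<in>{1..h - 1}. 1 - ((2 * of_nat t + 2) / (of_nat h + hook_sign \<Delta> j * of_nat j))\<^sup>2 = (0 :: complex)"
      proof
        show "j \<in> {1..h - 1}" using that by auto
        show "1 - ((2 * of_nat t + 2) / (of_nat h + hook_sign \<Delta> j * of_nat j))\<^sup>2 = (0 :: complex)"
          unfolding N that(3) using N0 by (simp del: of_nat_mult of_nat_add of_nat_Suc)
      qed
    qed simp
    then show ?thesis by (simp add: hook_factor_def)
  qed
  show "h - 2 * (t + 1) \<in> \<Delta>" if "h \<in> \<Delta>" "h > 2 * (t + 1)" for h
  proof (rule ccontr)
    assume n: "h - 2 * (t + 1) \<notin> \<Delta>"
    have "of_nat h + hook_sign \<Delta> (h - 2 * (t + 1)) * of_nat (h - 2 * (t + 1)) = (of_nat (2 * (t + 1)) :: complex)"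
      using n that by (simp add: hook_sign_def of_nat_diff)
    then have "hook_factor (of_nat t) \<Delta> h = 0" using that by (intro zero[of "h - 2 * (t + 1)"]) auto
    then show False using f that by blast
  qed
  show "h + j \<noteq> 2 * (t + 1)" if "h \<in> \<Delta>" "j \<in> \<Delta>" "j < h" for h j
  proof
    assume e: "h + j = 2 * (t + 1)"
    have "of_nat h + hook_sign \<Delta> j * of_nat j = (of_nat (h + j) :: complex)" using that by (simp add: hook_sign_def)
    moreover have "j \<ge> 1" using that \<Delta>(2) by (cases j) auto
    ultimately have "hook_factor (of_nat t) \<Delta> h = 0" unfolding e using that by (intro zero) auto
    then show False using f that by blast
  qed
qed

text \<open>Closure under subtraction of 2t + 2 makes \<Delta> an initial segment on every residue
  class. The classes of 0 and t + 1 are empty, and opposite classes are not both occupied, so the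
  heights combine to one integer for each opposite pair.\<close>

lemma core_set_surj:
  assumes \<Delta>: "finite \<Delta>" "0 \<notin> \<Delta>" "hook_weight (of_nat t) \<Delta> \<noteq> 0"
  shows "\<exists>m. m \<in> extensional {..<t} \<and> core_set t m = \<Delta>"
proof -
  note cond = hook_weight_nonzeroD[OF \<Delta>]
  define N where "N = 2 * (t + 1)"
  \<comment> \<open>The first gap on the class of r, which exists because \<Delta> is finite; below
    it every number of the class belongs to \<Delta>.\<close>
  define n where "n r = (LEAST i. N * i + r \<notin> \<Delta>)" for r
  have ex: "\<exists>i. N * i + r \<notin> \<Delta>" for r
  proof (rule ccontr)
    assume "\<not> ?thesis"
    then have "(\<lambda>i. N * i + r) ` UNIV \<subseteq> \<Delta>" by auto
    then have "finite ((\<lambda>i. N * i + r) ` UNIV)" using \<Delta>(1) finite_subset by blast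
    moreover have "N > 0" by (simp add: N_def)
    then have "inj (\<lambda>i. N * i + r)" by (auto simp: inj_on_def)
    ultimately have "finite (UNIV :: nat set)" by (rule finite_imageD)
    then show False by simp
  qed
  have mem: "N * i + r \<in> \<Delta> \<longleftrightarrow> i < n r" for i r
  proof
    show "i < n r \<Longrightarrow> N * i + r \<in> \<Delta>" unfolding n_def using not_less_Least by blast
    have "N * (n r + j) + r \<notin> \<Delta>" for j
    proof (induction j)
      case 0
      show ?case using LeastI_ex[OF ex[of r]] by (simp add: n_def)
    next
      case (Suc j)
      show ?case
      proof
        assume a: "N * (n r + Suc j) + r \<in> \<Delta>"
        have e: "N * (n r + Suc j) + r = (N * (n r + j) + r) + N" by simp
        \<comment> \<open>If this number were 0, the next one in the class would be 2t + 2, which is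
          excluded separately, as closure under subtraction speaks only of larger elements.\<close>
        have "N * (n r + j) + r \<noteq> 0" using a cond(2) unfolding e by (auto simp: N_def)
        then have "N * (n r + Suc j) + r > N" unfolding e by simp
        then have "N * (n r + Suc j) + r - N \<in> \<Delta>" using cond(3)[OF a] by (simp only: N_def)
        then show False using Suc unfolding e by simp
      qed
    qed
    then show "N * i + r \<in> \<Delta> \<Longrightarrow> i < n r" by (metis le_add_diff_inverse not_less)
  qed
  have n0: "n 0 = 0" "n (t + 1) = 0" using mem[of 0 0] mem[of 0 "t + 1"] \<Delta>(2) cond(1) by auto
  \<comment> \<open>If opposite classes were both occupied, their smallest elements t + 2 + k and t
    - k would lie in \<Delta>, and these add up to 2t + 2.\<close>
  have nn: "n (t + 1 + (k + 1)) = 0 \<or> n (t - k) = 0" if "k < t" for k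
  proof (rule ccontr)
    assume "\<not> ?thesis"
    then have "t + 1 + (k + 1) \<in> \<Delta>" "t - k \<in> \<Delta>" using mem[of 0 "t + 1 + (k + 1)"] mem[of 0 "t - k"] by auto
    then have "t + 1 + (k + 1) + (t - k) \<noteq> 2 * (t + 1)" using that by (intro cond(4)) auto
    then show False using that by simp
  qed
  define m where "m = restrict (\<lambda>k. if n (t + 1 + (k + 1)) > 0 then int (n (t + 1 + (k + 1))) else - int (n (t - k))) {..<t}"
  have "core_set t m = \<Delta>"
  proof (rule Set.set_eqI)
    fix y
    define i r where "i = y div N" and "r = y mod N"
    have y: "y = N * i + r" by (simp add: i_def r_def)
    have r: "r < N" by (simp add: r_def N_def)
    have "y \<in> core_set t m \<longleftrightarrow> int i < runner t m (int r)"
    proof -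
      have "int y div (2 * (int t + 1)) = int i" "int y mod (2 * (int t + 1)) = int r"
      proof -
        have "2 * (int t + 1) = int N" by (simp add: N_def)
        then show "int y div (2 * (int t + 1)) = int i" "int y mod (2 * (int t + 1)) = int r"
          by (simp_all only: i_def r_def zdiv_int zmod_int)
      qed
      then show ?thesis by (simp add: core_set_def bead_def)
    qed
    also have "\<dots> \<longleftrightarrow> i < n r"
    proof -
      consider "r = 0" | "r = t + 1" | "r > t + 1" | "0 < r" "r < t + 1" by linarith
      then show ?thesis
      proof cases
        case 1
        then show ?thesis using n0 by simp
      next
        case 2
        then have "runner t m (int r) = 0" using runner_zero(2)[of t m] by (simp add: add.commute)
        then show ?thesis using 2 n0 by simp
      next
        case 3
        define k where "k = r - t - 2"
        have k: "k < t" "r = t + 1 + (k + 1)" using 3 r by (auto simp: k_def N_def)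
        have "runner t m (int r) = m k" using runner_right[OF k(1), of m] by (simp add: k(2) algebra_simps)
        then show ?thesis using k by (auto simp: m_def)
      next
        case 4
        define k where "k = t - r"
        have k: "k < t" "r = t - k" using 4 by (auto simp: k_def)
        have "int r = int t + 1 - (int k + 1)" using k by simp
        then have "runner t m (int r) = - m k" using runner_left[OF k(1), of m] by simp
        then show ?thesis using k nn[OF k(1)] by (auto simp: m_def)
      qed
    qed
    also have "\<dots> \<longleftrightarrow> y \<in> \<Delta>" using mem by (simp add: y)
    finally show "y \<in> core_set t m \<longleftrightarrow> y \<in> \<Delta>" .
  qed
  moreover have "m \<in> extensional {..<t}" by (simp add: m_def)
  ultimately show ?thesis by blast
qed

definition hook_sets :: "nat \<Rightarrow> nat set set" where
  "hook_sets K = {\<Delta>. finite \<Delta> \<and> 0 \<notin> \<Delta> \<and> \<Sum>\<Delta> = K}"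

lemma finite_hook_sets [simp]: "finite (hook_sets K)"
proof (rule finite_subset)
  show "hook_sets K \<subseteq> Pow {..K}"
    by (auto simp: hook_sets_def member_le_sum[of _ _ "\<lambda>x. x"])
qed simp

theorem sum_hook_weight_nat:
  assumes t: "t \<ge> 1"
  shows "(\<Sum>\<Delta>\<in>hook_sets K. hook_weight (of_nat t) \<Delta>) = fps_nth (euler_prod ^ (2 * t\<^sup>2 + t)) K"
proof -
  have inj: "inj_on (core_set t) (shift_vectors t K)"
  proof (rule inj_onI)
    fix m m' assume "m \<in> shift_vectors t K" "m' \<in> shift_vectors t K" "core_set t m = core_set t m'"
    then show "m = m'"
      using core_set_inj[of t m m'] by (intro extensionalityI[of _ "{..<t}"]) (auto simp: shift_vectors_def PiE_def)
  qed
  have "(\<Sum>\<Delta>\<in>hook_sets K. hook_weight (of_nat t) \<Delta>) = (\<Sum>\<Delta>\<in>core_set t ` shift_vectors t K. hook_weight (of_nat t) \<Delta>)"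
  proof (rule sum.mono_neutral_right)
    show "core_set t ` shift_vectors t K \<subseteq> hook_sets K"
    proof
      fix \<Delta> assume "\<Delta> \<in> core_set t ` shift_vectors t K"
      then obtain m where m: "\<Delta> = core_set t m" "shift_weight t m = int K" by (auto simp: shift_vectors_def)
      then have "int (\<Sum>\<Delta>) = int K" using core_set_weights[of t m] by simp
      then have "\<Sum>\<Delta> = K" by (simp only: of_nat_eq_iff)
      then show "\<Delta> \<in> hook_sets K" using m by (simp add: hook_sets_def)
    qed
    show "\<forall>\<Delta>\<in>hook_sets K - core_set t ` shift_vectors t K. hook_weight (of_nat t) \<Delta> = 0"
    proof (intro ballI, rule ccontr)
      fix \<Delta> assume \<Delta>: "\<Delta> \<in> hook_sets K - core_set t ` shift_vectors t K" and w: "hook_weight (of_nat t) \<Delta> \<noteq> 0"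
      then obtain m where m: "m \<in> extensional {..<t}" "core_set t m = \<Delta>"
        using core_set_surj[of \<Delta> t] by (auto simp: hook_sets_def)
      have "\<Sum>\<Delta> = K" using \<Delta> by (simp add: hook_sets_def)
      then have sw: "shift_weight t m = int K" using core_set_weights[of t m] unfolding m(2) by metis
      \<comment> \<open>A core of weight K has to be found inside the box of
        \<open>shift_vectors\<close>: each summand of the weight is nonnegative and bounds |m
        k|.\<close>
      have ge: "\<bar>m k\<bar> \<le> (int t + 1) * (m k)\<^sup>2 + (int k + 1) * m k" if "k < t" for k
        using that by (intro quadratic_ge) auto
      have "\<bar>m k\<bar> \<le> int K" if k: "k < t" for k
      proof -
        have "(int t + 1) * (m k)\<^sup>2 + (int k + 1) * m k \<le> shift_weight t m"
          unfolding shift_weight_def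
          by (rule member_le_sum[of k "{..<t}" "\<lambda>k. (int t + 1) * (m k)\<^sup>2 + (int k + 1) * m k"])
             (use k ge in \<open>force intro: order_trans[OF abs_ge_zero]\<close>)+
        then show ?thesis using ge[OF k] sw by linarith
      qed
      then have "m \<in> shift_vectors t K" using m(1) sw by (auto simp: shift_vectors_def PiE_def abs_le_iff minus_le_iff)
      then show False using \<Delta> m(2) by blast
    qed
  qed simp
  also have "\<dots> = (\<Sum>m\<in>shift_vectors t K. hook_weight (of_nat t) (core_set t m))"
    by (rule sum.reindex_cong[OF inj]) auto
  finally have "(\<Sum>\<Delta>\<in>hook_sets K. hook_weight (of_nat t) \<Delta>) * weyl_dim t (\<lambda>i. int i + 1)
    = (\<Sum>m\<in>shift_vectors t K. weyl_dim t (residue_shift t m))"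
    using core_set_weights[of t] by (simp add: sum_distrib_right)
  also have "\<dots> = fps_nth (euler_prod ^ (2 * t\<^sup>2 + t)) K * weyl_dim t (\<lambda>i. int i + 1)"
    using macdonald_type_C[OF t] by (simp add: mult.commute)
  finally show ?thesis using weyl_dim_id_nonzero[of t] mult_right_cancel by blast
qed

subsection \<open>Powers of the Euler product\<close>

text \<open>The summand with index k has coefficient 1/k at each positive multiple of k. Convergence
  is X-adic, so a single coefficient is eventually constant along the finite partial sums and can be
  read off there.\<close>

lemma euler_log_series_nth:
  "fps_nth euler_log_series n = (\<Sum>k\<in>{k\<in>{1..n}. k dvd n}. 1 / of_nat k)"
proof (cases "n = 0")
  case False
  define f where "f k = (fps_X ^ k / (of_nat k * (1 - fps_X ^ k)) :: complex fps)" for k :: nat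
  have f: "fps_nth (f k) n = (if k dvd n then 1 / of_nat k else 0)" if k: "k \<ge> 1" for k
  proof -
    have u: "fps_nth (of_nat k * (1 - fps_X ^ k) :: complex fps) 0 \<noteq> 0"
      using k by (simp add: fps_mult_nth)
    define g where "g = (Abs_fps (\<lambda>n. if n > 0 \<and> k dvd n then 1 / of_nat k else 0) :: complex fps)"
    have "(of_nat k * (1 - fps_X ^ k)) * g = fps_X ^ k"
    proof (rule fps_ext)
      fix j
      have "of_nat k * (1 - fps_X ^ k) * g = fps_const (of_nat k) * (g - fps_X ^ k * g)"
        by (simp add: fps_of_nat algebra_simps)
      then have "fps_nth (of_nat k * (1 - fps_X ^ k) * g) j = of_nat k * (fps_nth g j - (if j < k then 0 else fps_nth g (j - k)))"
        by (simp add: fps_X_power_mult_nth)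
      also have "\<dots> = fps_nth (fps_X ^ k) j"
      proof -
        consider "j < k" | "j = k" | "j > k" by linarith
        then show ?thesis
        proof cases
          case 1
          then have "\<not> (j > 0 \<and> k dvd j)" using nat_dvd_not_less by blast
          then show ?thesis using 1 by (auto simp: g_def)
        next
          case 2 then show ?thesis using k by (simp add: g_def)
        next
          case 3 then show ?thesis by (simp add: g_def dvd_minus_self)
        qed
      qed
      finally show "fps_nth (of_nat k * (1 - fps_X ^ k) * g) j = fps_nth (fps_X ^ k) j" .
    qed
    then have "f k = (of_nat k * (1 - fps_X ^ k)) * g * inverse (of_nat k * (1 - fps_X ^ k))"
      unfolding f_def fps_divide_unit[OF u] by simp
    also have "\<dots> = (inverse (of_nat k * (1 - fps_X ^ k)) * (of_nat k * (1 - fps_X ^ k))) * g"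
      by (simp only: mult_ac)
    also have "\<dots> = g" unfolding inverse_mult_eq_1[OF u] by simp
    finally have "f k = g" .
    then show ?thesis using False by (simp add: g_def)
  qed
  have "\<forall>\<^sub>F A in finite_subsets_at_top {1::nat..}. fps_nth (\<Sum>k\<in>A. f k) n = fps_nth euler_log_series n"
    using euler_log_series_has_sum unfolding has_sum_def tendsto_fps_iff f_def by blast
  moreover have "\<forall>\<^sub>F A in finite_subsets_at_top {1::nat..}. fps_nth (\<Sum>k\<in>A. f k) n = (\<Sum>k\<in>{k\<in>{1..n}. k dvd n}. 1 / of_nat k)"
    unfolding eventually_finite_subsets_at_top
  proof (intro exI[of _ "{1..n}"] conjI allI impI)
    fix A assume A: "finite A \<and> {1..n} \<subseteq> A \<and> A \<subseteq> {1..}"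
    have "fps_nth (\<Sum>k\<in>A. f k) n = (\<Sum>k\<in>A. if k dvd n then 1 / of_nat k else 0)"
      unfolding fps_sum_nth using A f by (intro sum.cong) auto
    also have "\<dots> = (\<Sum>k\<in>{k\<in>{1..n}. k dvd n}. 1 / of_nat k)"
    proof (rule sum.mono_neutral_cong_right)
      show "\<forall>k\<in>A - {k \<in> {1..n}. k dvd n}. (if k dvd n then 1 / of_nat k else 0) = (0::complex)"
        using A False dvd_imp_le[of _ n] by auto
    qed (use A in auto)
    finally show "fps_nth (\<Sum>k\<in>A. f k) n = (\<Sum>k\<in>{k\<in>{1..n}. k dvd n}. 1 / of_nat k)" .
  qed auto
  ultimately have "\<forall>\<^sub>F A in finite_subsets_at_top {1::nat..}.
      fps_nth euler_log_series n = (\<Sum>k\<in>{k\<in>{1..n}. k dvd n}. 1 / of_nat k)"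
    by eventually_elim simp
  then show ?thesis by (simp add: eventually_const)
next
  case True
  have "\<forall>\<^sub>F A in finite_subsets_at_top {1::nat..}.
     fps_nth (\<Sum>k\<in>A. fps_X ^ k / (of_nat k * (1 - fps_X ^ k)) :: complex fps) 0 = fps_nth euler_log_series 0"
    using euler_log_series_has_sum unfolding has_sum_def tendsto_fps_iff by blast
  moreover have "\<forall>\<^sub>F A in finite_subsets_at_top {1::nat..}.
     fps_nth (\<Sum>k\<in>A. fps_X ^ k / (of_nat k * (1 - fps_X ^ k)) :: complex fps) 0 = 0"
    unfolding eventually_finite_subsets_at_top
  proof (intro exI[of _ "{}"] conjI allI impI)
    fix A :: "nat set" assume A: "finite A \<and> {} \<subseteq> A \<and> A \<subseteq> {1..}"
    have "fps_nth (fps_X ^ k / (of_nat k * (1 - fps_X ^ k)) :: complex fps) 0 = 0" if "k \<in> A" for k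
    proof -
      have k: "k \<ge> 1" using A that by auto
      then have "fps_nth (of_nat k * (1 - fps_X ^ k) :: complex fps) 0 \<noteq> 0" by (simp add: fps_mult_nth)
      then show ?thesis using k by (simp add: fps_divide_unit fps_mult_nth)
    qed
    then show "fps_nth (\<Sum>k\<in>A. fps_X ^ k / (of_nat k * (1 - fps_X ^ k)) :: complex fps) 0 = 0"
      by (simp add: fps_sum_nth)
  qed auto
  ultimately have "\<forall>\<^sub>F A in finite_subsets_at_top {1::nat..}. fps_nth euler_log_series 0 = 0"
    by eventually_elim simp
  then show ?thesis using True by (simp add: eventually_const)
qed

text \<open>The logarithmic derivative. Multiplied by X, that of 1 - X^m has the coefficient -m at
  every positive multiple of m. The divisor sums agree through k = n/m: the sum of m over m | n is n
  times the sum of 1/k over k | n.\<close>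

lemma euler_prod_deriv: "fps_deriv euler_prod = - fps_deriv euler_log_series * euler_prod"
proof -
  define g where "g m = (Abs_fps (\<lambda>n. if n > 0 \<and> m dvd n then of_nat m else 0) :: complex fps)" for m :: nat
  have g: "(1 - fps_X ^ m) * g m = of_nat m * fps_X ^ m" if m: "m \<ge> 1" for m
  proof (rule fps_ext)
    fix j
    have "(1 - fps_X ^ m) * g m = g m - fps_X ^ m * g m" by (simp add: algebra_simps)
    then have "fps_nth ((1 - fps_X ^ m) * g m) j = fps_nth (g m) j - (if j < m then 0 else fps_nth (g m) (j - m))"
      by (simp add: fps_X_power_mult_nth)
    also have "\<dots> = fps_nth (fps_const (of_nat m) * fps_X ^ m) j"
    proof -
      consider "j < m" | "j = m" | "j > m" by linarith
      then show ?thesis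
      proof cases
        case 1
        then have "\<not> (j > 0 \<and> m dvd j)" using nat_dvd_not_less by blast
        then show ?thesis using 1 by (auto simp: g_def)
      next
        case 2 then show ?thesis using m by (simp add: g_def)
      next
        case 3 then show ?thesis by (simp add: g_def dvd_minus_self)
      qed
    qed
    finally show "fps_nth ((1 - fps_X ^ m) * g m) j = fps_nth (of_nat m * fps_X ^ m) j" by (simp add: fps_of_nat)
  qed
  have X: "fps_nth (fps_X * fps_deriv F) n = of_nat n * fps_nth F n" for F :: "complex fps" and n
    by (cases n) auto
  define P where "P M = (\<Prod>m=1..M. 1 - fps_X ^ m :: complex fps)" for M :: nat
  have deriv: "fps_X * fps_deriv (P M) = - (\<Sum>m=1..M. g m) * P M" for M
  proof (induction M)
    case (Suc M)
    have P: "P (Suc M) = P M * (1 - fps_X ^ Suc M)" by (simp add: P_def)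
    have "fps_X * fps_deriv (1 - fps_X ^ Suc M) = - (of_nat (Suc M) * fps_X ^ Suc M :: complex fps)"
      by (rule fps_ext) (auto simp: X simp flip: fps_of_nat simp del: power_Suc of_nat_Suc)
    then have d: "fps_X * fps_deriv (1 - fps_X ^ Suc M) = - ((1 - fps_X ^ Suc M) * g (Suc M))" using g[of "Suc M"] by simp
    have "fps_X * fps_deriv (P (Suc M)) = (fps_X * fps_deriv (P M)) * (1 - fps_X ^ Suc M) + P M * (fps_X * fps_deriv (1 - fps_X ^ Suc M))"
      unfolding P fps_deriv_mult by (simp add: algebra_simps del: power_Suc)
    also have "\<dots> = - (\<Sum>m=1..Suc M. g m) * P (Suc M)"
      unfolding Suc d P by (simp add: algebra_simps del: power_Suc)
    finally show ?case .
  qed (simp add: P_def)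
  have "fps_X * fps_deriv euler_prod = - (fps_X * fps_deriv euler_log_series) * euler_prod"
  proof (rule fps_eqI_cong_below)
    fix K
    have PK: "fps_cong_below (Suc K) euler_prod (P K)"
      unfolding euler_prod_def P_def by (rule iprod_cong_below[OF tame_one_minus_X]) simp
    have "fps_cong_below (Suc K) (fps_X * fps_deriv euler_prod) (fps_X * fps_deriv (P K))"
      using PK unfolding fps_cong_below_def X by simp
    also have "fps_X * fps_deriv (P K) = - (\<Sum>m=1..K. g m) * P K" by (rule deriv)
    also have "fps_cong_below (Suc K) (- (\<Sum>m=1..K. g m) * P K) (- (fps_X * fps_deriv euler_log_series) * euler_prod)"
    proof (intro fps_cong_below_mult fps_cong_below_sym[OF PK])
      show "fps_cong_below (Suc K) (- (\<Sum>m=1..K. g m)) (- (fps_X * fps_deriv euler_log_series))"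
        unfolding fps_cong_below_def
      proof (intro allI impI)
        fix n assume n: "n < Suc K"
        have "fps_nth (\<Sum>m=1..K. g m) n = (\<Sum>m=1..K. if n > 0 \<and> m dvd n then of_nat m else 0)"
          by (simp add: fps_sum_nth g_def)
        also have "\<dots> = (\<Sum>m\<in>{m\<in>{1..n}. m dvd n}. of_nat m)"
        proof (rule sum.mono_neutral_cong_right)
          show "{m \<in> {1..n}. m dvd n} \<subseteq> {1..K}" using n by auto
          show "\<forall>m\<in>{1..K} - {m \<in> {1..n}. m dvd n}. (if n > 0 \<and> m dvd n then of_nat m else 0) = (0::complex)"
            using dvd_imp_le[of _ n] by auto
        qed auto
        also have "\<dots> = (\<Sum>k\<in>{k\<in>{1..n}. k dvd n}. of_nat n * (1 / of_nat k))"
        proof (rule sum.reindex_bij_witness[of _ "\<lambda>k. n div k" "\<lambda>m. n div m"])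
          fix m assume "m \<in> {m\<in>{1..n}. m dvd n}"
          then have m: "m dvd n" "m \<ge> 1" "m \<le> n" by auto
          then obtain l where l: "n = m * l" by blast
          then have l1: "l \<ge> 1" using m by (cases l) auto
          show "n div (n div m) = m" "n div m \<in> {k\<in>{1..n}. k dvd n}" using l l1 m by auto
          show "of_nat n * (1 / of_nat (n div m)) = (of_nat m :: complex)" using l l1 m by simp
        next
          fix k assume "k \<in> {k\<in>{1..n}. k dvd n}"
          then have k: "k dvd n" "k \<ge> 1" "k \<le> n" by auto
          then obtain l where l: "n = k * l" by blast
          then have l1: "l \<ge> 1" using k by (cases l) auto
          show "n div (n div k) = k" "n div k \<in> {m\<in>{1..n}. m dvd n}" using l l1 k by auto
        qed
        also have "\<dots> = fps_nth (fps_X * fps_deriv euler_log_series) n"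
          unfolding X euler_log_series_nth by (simp add: sum_distrib_left)
        finally show "fps_nth (- (\<Sum>m=1..K. g m)) n = fps_nth (- (fps_X * fps_deriv euler_log_series)) n" by simp
      qed
    qed
    finally show "fps_cong_below K (fps_X * fps_deriv euler_prod) (- (fps_X * fps_deriv euler_log_series) * euler_prod)"
      by (simp add: fps_cong_below_def)
  qed
  then have "fps_X * fps_deriv euler_prod = fps_X * (- fps_deriv euler_log_series * euler_prod)" by (simp add: mult_ac)
  moreover have "fps_X \<noteq> (0 :: complex fps)" by simp
  ultimately show ?thesis using mult_left_cancel by blast
qed

lemma fps_linear_ode_unique:
  fixes F G H :: "complex fps"
  assumes "fps_deriv F = H * F" "fps_deriv G = H * G" "fps_nth F 0 = fps_nth G 0"
  shows "F = G"
proof (rule fps_ext)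
  fix n
  show "fps_nth F n = fps_nth G n"
  proof (induction n rule: less_induct)
    case (less n)
    show ?case
    proof (cases n)
      case (Suc k)
      have "of_nat (Suc k) * fps_nth F (Suc k) = fps_nth (H * F) k" using assms(1) by (metis fps_deriv_nth Suc_eq_plus1)
      also have "\<dots> = fps_nth (H * G) k" unfolding fps_mult_nth using less Suc by (intro sum.cong) auto
      also have "\<dots> = of_nat (Suc k) * fps_nth G (Suc k)" using assms(2) by (metis fps_deriv_nth Suc_eq_plus1)
      finally show ?thesis using Suc by (simp del: of_nat_Suc)
    qed (use assms(3) in simp)
  qed
qed

text \<open>Both sides solve the same first-order linear differential equation and have constant
  coefficient 1.\<close>

lemma euler_power_of_nat: "euler_power (of_nat n) = euler_prod ^ n"
proof (rule fps_linear_ode_unique[where H = "fps_const (- of_nat n) * fps_deriv euler_log_series"])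
  have L0: "fps_nth (fps_const (- of_nat n) * euler_log_series) 0 = 0" by (simp add: euler_log_series_nth)
  show "fps_deriv (euler_power (of_nat n)) = fps_const (- of_nat n) * fps_deriv euler_log_series * euler_power (of_nat n)"
    unfolding euler_power_def fps_compose_deriv[OF L0] by (simp add: mult_ac)
  show "fps_deriv (euler_prod ^ n) = fps_const (- of_nat n) * fps_deriv euler_log_series * euler_prod ^ n"
  proof (cases n)
    case (Suc k)
    have neg: "fps_const (- of_nat (Suc k)) = - fps_const (of_nat (Suc k) :: complex)" by (simp only: fps_const_neg)
    show ?thesis unfolding fps_deriv_power euler_prod_deriv Suc neg
      by (simp add: mult_ac del: of_nat_Suc fps_const_neg)
  qed simp
  show "fps_nth (euler_power (of_nat n)) 0 = fps_nth (euler_prod ^ n) 0"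
    by (simp add: euler_power_def euler_prod_def fps_nth_power_0 fps_nth_iprod_0)
qed

section \<open>From positive integers to complex t\<close>

definition poly_fun :: "(complex \<Rightarrow> complex) \<Rightarrow> bool" where
  "poly_fun f \<longleftrightarrow> (\<exists>p. \<forall>t. f t = poly p t)"

lemma poly_fun_const: "poly_fun (\<lambda>t. a)"
  unfolding poly_fun_def by (rule exI[of _ "[:a:]"]) simp

lemma poly_fun_id: "poly_fun (\<lambda>t. t)"
  unfolding poly_fun_def by (rule exI[of _ "[:0, 1:]"]) simp

lemma poly_fun_add: "poly_fun f \<Longrightarrow> poly_fun g \<Longrightarrow> poly_fun (\<lambda>t. f t + g t)"
  unfolding poly_fun_def by (metis poly_add)

lemma poly_fun_diff: "poly_fun f \<Longrightarrow> poly_fun g \<Longrightarrow> poly_fun (\<lambda>t. f t - g t)"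
  unfolding poly_fun_def by (metis poly_diff)

lemma poly_fun_minus: "poly_fun f \<Longrightarrow> poly_fun (\<lambda>t. - f t)"
  unfolding poly_fun_def by (metis poly_minus)

lemma poly_fun_mult: "poly_fun f \<Longrightarrow> poly_fun g \<Longrightarrow> poly_fun (\<lambda>t. f t * g t)"
  unfolding poly_fun_def by (metis poly_mult)

lemma poly_fun_divide_const: "poly_fun f \<Longrightarrow> poly_fun (\<lambda>t. f t / a)"
  using poly_fun_mult[OF _ poly_fun_const[of "inverse a"]] by (simp add: divide_inverse)

lemma poly_fun_power: "poly_fun f \<Longrightarrow> poly_fun (\<lambda>t. f t ^ n)"
  by (induction n) (simp_all add: poly_fun_const poly_fun_mult)

lemma poly_fun_sum: "(\<And>i. i \<in> A \<Longrightarrow> poly_fun (f i)) \<Longrightarrow> poly_fun (\<lambda>t. \<Sum>i\<in>A. f i t)"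
  by (induction A rule: infinite_finite_induct) (simp_all add: poly_fun_const poly_fun_add)

lemma poly_fun_prod: "(\<And>i. i \<in> A \<Longrightarrow> poly_fun (f i)) \<Longrightarrow> poly_fun (\<lambda>t. \<Prod>i\<in>A. f i t)"
  by (induction A rule: infinite_finite_induct) (simp_all add: poly_fun_const poly_fun_mult)

lemmas poly_fun_intros = poly_fun_const poly_fun_id poly_fun_add poly_fun_diff poly_fun_minus poly_fun_mult
  poly_fun_divide_const poly_fun_power poly_fun_sum poly_fun_prod

lemma poly_fun_eqI:
  assumes "poly_fun f" "poly_fun g" "\<And>n :: nat. n \<ge> 1 \<Longrightarrow> f (of_nat n) = g (of_nat n)"
  shows "f t = g t"
proof -
  obtain p q where pq: "\<And>t. f t = poly p t" "\<And>t. g t = poly q t" using assms(1,2) unfolding poly_fun_def by metis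
  have "(of_nat :: nat \<Rightarrow> complex) ` {1..} \<subseteq> {t. poly (p - q) t = 0}" using assms(3) pq by auto
  moreover have "infinite ((of_nat :: nat \<Rightarrow> complex) ` {1..})"
    by (subst finite_image_iff) (auto simp: inj_on_def infinite_Ici)
  ultimately have "infinite {t. poly (p - q) t = 0}" using finite_subset by blast
  then have "p - q = 0" using poly_roots_finite by blast
  then show ?thesis using pq by simp
qed

theorem sum_hook_weight:
  "(\<Sum>\<Delta>\<in>hook_sets K. hook_weight t \<Delta>) = fps_nth (euler_power (2 * t\<^sup>2 + t)) K"
proof (rule poly_fun_eqI[of "\<lambda>t. \<Sum>\<Delta>\<in>hook_sets K. hook_weight t \<Delta>" "\<lambda>t. fps_nth (euler_power (2 * t\<^sup>2 + t)) K"])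
  show "poly_fun (\<lambda>t. \<Sum>\<Delta>\<in>hook_sets K. hook_weight t \<Delta>)"
    unfolding hook_weight_def hook_factor_def by (intro poly_fun_intros)
  \<comment> \<open>Coefficient K of the composition involves only the terms i \<le> K of the
    exponential series, hence is polynomial in the exponent c.\<close>
  have "fps_nth (euler_power c) K = (\<Sum>i=0..K. fps_nth (fps_exp 1) i * ((- c) ^ i * fps_nth (euler_log_series ^ i) K))" for c
    unfolding euler_power_def fps_compose_nth by (simp add: power_mult_distrib fps_const_power)
  then show "poly_fun (\<lambda>t. fps_nth (euler_power (2 * t\<^sup>2 + t)) K)"
    by (simp only:) (intro poly_fun_intros)
  fix n :: nat assume n: "n \<ge> 1"
  have "2 * (of_nat n)\<^sup>2 + of_nat n = (of_nat (2 * n\<^sup>2 + n) :: complex)" by simp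
  then show "(\<Sum>\<Delta>\<in>hook_sets K. hook_weight (of_nat n) \<Delta>) = fps_nth (euler_power (2 * (of_nat n)\<^sup>2 + of_nat n)) K"
    using sum_hook_weight_nat[OF n] by (simp only: euler_power_of_nat)
qed

subsection \<open>Partitions and their principal hooks\<close>

lemma part_antimono:
  assumes "is_partition l" "1 \<le> i" "i \<le> j" shows "part l j \<le> part l i"
proof (cases "j \<le> length l")
  case True
  then show ?thesis
    using assms sorted_wrt_nth_less[of "(\<ge>)" l "i - 1" "j - 1"]
    by (cases "i = j") (auto simp: is_partition_def part_def)
qed (simp add: part_def)

lemma part_pos_iff:
  assumes "is_partition l" "1 \<le> i" shows "part l i > 0 \<longleftrightarrow> i \<le> length l"
proof -
  have "l ! (i - 1) \<in> set l" if "i \<le> length l" using that assms(2) by (intro nth_mem) auto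
  then have "l ! (i - 1) \<noteq> 0" if "i \<le> length l" using that assms(1) by (metis is_partition_def)
  then show ?thesis using assms(2) by (auto simp: part_def)
qed

lemma partition_eqI:
  assumes l: "is_partition l" and l': "is_partition l'" and e: "\<And>i. 1 \<le> i \<Longrightarrow> part l i = part l' i"
  shows "l = l'"
proof (rule nth_equalityI)
  have "i \<le> length l \<longleftrightarrow> i \<le> length l'" if "1 \<le> i" for i
    using part_pos_iff[OF l that] part_pos_iff[OF l' that] e[OF that] by simp
  from this[of "length l"] this[of "length l'"]
  show len: "length l = length l'" by (cases "length l"; cases "length l'") auto
  fix i assume "i < length l"
  then show "l ! i = l' ! i" using e[of "Suc i"] len by (simp add: part_def)
qed

lemma le_card_initial_segment:
  fixes D :: "nat set"
  assumes "finite D" "0 \<notin> D" "\<And>i j. j \<in> D \<Longrightarrow> 1 \<le> i \<Longrightarrow> i \<le> j \<Longrightarrow> i \<in> D" "1 \<le> i"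
  shows "i \<le> card D \<longleftrightarrow> i \<in> D"
proof
  assume "i \<in> D"
  then have "{1..i} \<subseteq> D" using assms by auto
  then have "card {1..i} \<le> card D" using assms(1) by (intro card_mono) auto
  then show "i \<le> card D" by simp
next
  assume "i \<le> card D"
  show "i \<in> D"
  proof (rule ccontr)
    assume "i \<notin> D"
    have "x \<in> {1..<i}" if "x \<in> D" for x
    proof -
      have "x \<ge> 1" using that assms(2) by (cases x) auto
      moreover have "\<not> i \<le> x" using assms(3)[OF that assms(4)] \<open>i \<notin> D\<close> by blast
      ultimately show ?thesis by simp
    qed
    then have "D \<subseteq> {1..<i}" by blast
    then have "card D \<le> card {1..<i}" by (intro card_mono) auto
    then show False using \<open>i \<le> card D\<close> assms(4) by simp
  qed
qed

lemma length_conjugate [simp]: "length (conjugate_partition l) = part l 1"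
  by (simp add: conjugate_partition_def)

lemma part_conjugate:
  assumes l: "is_partition l" and j: "1 \<le> j"
  shows "part (conjugate_partition l) j = card {i \<in> {1..length l}. j \<le> part l i}"
proof (cases "j \<le> part l 1")
  case True
  then have "part (conjugate_partition l) j = conjugate_partition l ! (j - 1)"
    using j by (simp add: part_def[of "conjugate_partition l"])
  moreover have "[1..<Suc (part l 1)] ! (j - 1) = j" using True j by (subst nth_upt) auto
  ultimately show ?thesis using True j unfolding conjugate_partition_def by (simp del: upt_Suc)
next
  case False
  have "\<not> j \<le> part l i" if "1 \<le> i" for i using False part_antimono[of l 1 i] l that by simp
  then have "{i \<in> {1..length l}. j \<le> part l i} = {}" by auto
  then show ?thesis using False unfolding conjugate_partition_def part_def by simp
qed

text \<open>Both sides say that (i, j) is a cell of the diagram. Together with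
  \<open>nat_eqI_le\<close> this reduces equations between parts to statements about cells.\<close>

lemma le_part_conjugate_iff:
  assumes l: "is_partition l" and "1 \<le> i" "1 \<le> j"
  shows "i \<le> part (conjugate_partition l) j \<longleftrightarrow> j \<le> part l i"
proof -
  have "i \<le> part (conjugate_partition l) j \<longleftrightarrow> i \<in> {i \<in> {1..length l}. j \<le> part l i}"
    unfolding part_conjugate[OF assms(1,3)]
    using assms(2) part_antimono[OF l] by (intro le_card_initial_segment) (auto intro: order_trans)
  also have "\<dots> \<longleftrightarrow> j \<le> part l i" using part_pos_iff[OF l assms(2)] assms by auto
  finally show ?thesis .
qed

lemma nat_eqI_le: "(\<And>n :: nat. 1 \<le> n \<Longrightarrow> n \<le> a \<longleftrightarrow> n \<le> b) \<Longrightarrow> a = b"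
proof -
  assume *: "\<And>n :: nat. 1 \<le> n \<Longrightarrow> n \<le> a \<longleftrightarrow> n \<le> b"
  show "a = b" using *[of a] *[of b] by (cases a; cases b) auto
qed

lemma is_partition_conjugate:
  assumes l: "is_partition l" shows "is_partition (conjugate_partition l)"
proof -
  have p: "part (conjugate_partition l) (Suc i) = conjugate_partition l ! i" if "i < part l 1" for i
    using that by (simp add: part_def)
  have "0 \<notin> set (conjugate_partition l)"
  proof
    assume "0 \<in> set (conjugate_partition l)"
    then obtain i where i: "i < part l 1" "conjugate_partition l ! i = 0" by (auto simp: in_set_conv_nth)
    have "1 \<le> part (conjugate_partition l) (Suc i)"
      using i by (subst le_part_conjugate_iff[OF l]) auto
    then show False using i p by simp
  qed
  moreover have "sorted_wrt (\<ge>) (conjugate_partition l)"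
    unfolding sorted_wrt_iff_nth_less
  proof (intro allI impI)
    fix i j assume ij: "i < j" "j < length (conjugate_partition l)"
    have "part (conjugate_partition l) (Suc j) \<le> part (conjugate_partition l) (Suc i)"
      unfolding part_conjugate[OF l, of "Suc i", simplified] part_conjugate[OF l, of "Suc j", simplified]
      using ij by (intro card_mono) auto
    then show "conjugate_partition l ! j \<le> conjugate_partition l ! i" using ij p by simp
  qed
  ultimately show ?thesis by (simp add: is_partition_def)
qed

lemma part_conjugate_conjugate:
  assumes l: "is_partition l" and j: "1 \<le> j"
  shows "part (conjugate_partition (conjugate_partition l)) j = part l j"
  by (rule nat_eqI_le) (use j in \<open>simp add: le_part_conjugate_iff l is_partition_conjugate\<close>)

lemma diagonal_indices_eq:
  assumes l: "is_partition l" shows "diagonal_indices l = {1..diagonal_size l}"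
proof -
  have fin: "finite (diagonal_indices l)"
  proof (rule finite_subset)
    show "diagonal_indices l \<subseteq> {1..length l}"
    proof
      fix i assume "i \<in> diagonal_indices l"
      then have "1 \<le> i" "i \<le> part l i" by (auto simp: diagonal_indices_def)
      then show "i \<in> {1..length l}" using part_pos_iff[OF l, of i] by simp
    qed
  qed simp
  have "i \<le> diagonal_size l \<longleftrightarrow> i \<in> diagonal_indices l" if "1 \<le> i" for i
    unfolding diagonal_size_def
  proof (rule le_card_initial_segment[OF fin _ _ that])
    fix i j assume "j \<in> diagonal_indices l" "1 \<le> i" "i \<le> j"
    then show "i \<in> diagonal_indices l" using part_antimono[OF l, of i j] by (auto simp: diagonal_indices_def)
  qed (simp add: diagonal_indices_def)
  then show ?thesis by (auto simp: diagonal_indices_def)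
qed

text \<open>Let d be the size of the diagonal. The first d rows are given. A lower row has its cells
  in the first d columns, since a cell (i, j) with both indices beyond d would force a further
  diagonal cell; those columns are given as well.\<close>

lemma partition_eqI_frobenius:
  assumes l: "is_partition l" and l': "is_partition l'" and d: "diagonal_size l = diagonal_size l'"
    and arm: "\<And>i. 1 \<le> i \<Longrightarrow> i \<le> diagonal_size l \<Longrightarrow> part l i = part l' i"
    and leg: "\<And>i. 1 \<le> i \<Longrightarrow> i \<le> diagonal_size l \<Longrightarrow> part (conjugate_partition l) i = part (conjugate_partition l') i"
  shows "l = l'"
proof (rule partition_eqI[OF l l'])
  fix i :: nat assume i: "1 \<le> i"
  have out: "\<not> j \<le> part m i" if m: "is_partition m" "diagonal_size m = diagonal_size l"
    and "i > diagonal_size l" "j > diagonal_size l" for j m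
  proof
    assume j: "j \<le> part m i"
    have x: "1 \<le> min i j" using that by auto
    have "min i j \<le> part m (min i j)" using j part_antimono[OF m(1) x, of i] by simp
    then have "min i j \<in> diagonal_indices m" using x by (simp add: diagonal_indices_def)
    then show False using that by (auto simp: diagonal_indices_eq)
  qed
  show "part l i = part l' i"
  proof (cases "i \<le> diagonal_size l")
    case False
    show ?thesis
    proof (rule nat_eqI_le)
      fix j :: nat assume j: "1 \<le> j"
      show "j \<le> part l i \<longleftrightarrow> j \<le> part l' i"
      proof (cases "j \<le> diagonal_size l")
        case True
        then show ?thesis using leg[OF j True] le_part_conjugate_iff[OF l i j] le_part_conjugate_iff[OF l' i j] by simp
      next
        case False': False
        then show ?thesis using out[OF l refl, of j] out[OF l' d[symmetric], of j] False by simp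
      qed
    qed
  qed (use arm i in simp)
qed

text \<open>Wraps a hook with arm a and leg b around the diagram: in Frobenius coordinates, (a | b)
  is prepended.\<close>

definition add_hook :: "nat \<Rightarrow> nat \<Rightarrow> nat list \<Rightarrow> nat list" where
  "add_hook a b l = Suc a # map Suc l @ replicate (b - length l) 1"

lemma add_hook:
  assumes l: "is_partition l" and b: "length l \<le> b" and a: "part l 1 \<le> a"
  shows "is_partition (add_hook a b l)" "length (add_hook a b l) = Suc b"
    "part (add_hook a b l) 1 = Suc a"
    "\<And>i. 1 \<le> i \<Longrightarrow> part (add_hook a b l) (Suc i) = (if i \<le> b then Suc (part l i) else 0)"
    "part (conjugate_partition (add_hook a b l)) 1 = Suc b"
    "\<And>j. 1 \<le> j \<Longrightarrow> j \<le> a \<Longrightarrow> part (conjugate_partition (add_hook a b l)) (Suc j) = Suc (part (conjugate_partition l) j)"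
    "diagonal_size (add_hook a b l) = Suc (diagonal_size l)"
    "weight (add_hook a b l) = Suc (a + b) + weight l"
proof -
  show len: "length (add_hook a b l) = Suc b" using b by (simp add: add_hook_def)
  show p1: "part (add_hook a b l) 1 = Suc a" by (simp add: add_hook_def part_def)
  show pS: "part (add_hook a b l) (Suc i) = (if i \<le> b then Suc (part l i) else 0)" if i1: "1 \<le> i" for i
  proof -
    obtain i' where i': "i = Suc i'" using i1 by (cases i) auto
    show ?thesis using b by (auto simp: i' part_def add_hook_def nth_append)
  qed
  have "x \<le> Suc a" if x: "x \<in> set l" for x
  proof -
    obtain i where i: "i < length l" "x = l ! i" using x by (auto simp: in_set_conv_nth)
    then have "x = part l (Suc i)" by (simp add: part_def)
    then show ?thesis using part_antimono[OF l, of 1 "Suc i"] a by simp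
  qed
  moreover have "sorted_wrt (\<ge>) (map Suc l @ replicate (b - length l) 1)"
  proof -
    have "sorted_wrt (\<ge>) (replicate n (1 :: nat))" for n by (induction n) auto
    moreover have "sorted_wrt (\<lambda>x y. Suc y \<le> Suc x) l" using l by (simp add: is_partition_def)
    ultimately show ?thesis by (auto simp: sorted_wrt_append sorted_wrt_map)
  qed
  moreover have "x \<le> a" if x: "x \<in> set l" for x
  proof -
    obtain i where i: "i < length l" "x = l ! i" using x by (auto simp: in_set_conv_nth)
    then have "x = part l (Suc i)" by (simp add: part_def)
    then show ?thesis using part_antimono[OF l, of 1 "Suc i"] a by simp
  qed
  ultimately show L: "is_partition (add_hook a b l)"
    by (auto simp: is_partition_def add_hook_def)
  show "weight (add_hook a b l) = Suc (a + b) + weight l"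
  proof -
    have "sum_list (map Suc l) = sum_list l + length l" by (induction l) auto
    then show ?thesis using b by (simp add: weight_def add_hook_def sum_list_replicate)
  qed
  have pos: "i \<le> b" if "1 \<le> i" "i \<le> part (conjugate_partition l) j" "1 \<le> j" for i j
  proof -
    have "j \<le> part l i" using that le_part_conjugate_iff[OF l] by simp
    then have "i \<le> length l" using part_pos_iff[OF l that(1)] that(3) by simp
    then show ?thesis using b by simp
  qed
  show "part (conjugate_partition (add_hook a b l)) 1 = Suc b"
  proof (rule nat_eqI_le)
    fix n :: nat assume n: "1 \<le> n"
    show "n \<le> part (conjugate_partition (add_hook a b l)) 1 \<longleftrightarrow> n \<le> Suc b"
      using le_part_conjugate_iff[OF L n, of 1] part_pos_iff[OF L n] len by (simp add: Suc_le_eq)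
  qed
  show "part (conjugate_partition (add_hook a b l)) (Suc j) = Suc (part (conjugate_partition l) j)"
    if j: "1 \<le> j" "j \<le> a" for j
  proof (rule nat_eqI_le)
    fix n :: nat assume n: "1 \<le> n"
    have "n \<le> part (conjugate_partition (add_hook a b l)) (Suc j) \<longleftrightarrow> Suc j \<le> part (add_hook a b l) n"
      by (rule le_part_conjugate_iff[OF L n]) simp
    also have "\<dots> \<longleftrightarrow> n \<le> Suc (part (conjugate_partition l) j)"
    proof (cases "n = 1")
      case True then show ?thesis using p1 j by simp
    next
      case False
      then obtain i where i: "n = Suc i" "1 \<le> i" using n by (cases n) auto
      show ?thesis using pS[OF i(2)] i le_part_conjugate_iff[OF l i(2) j(1)] pos[OF i(2) _ j(1)] by auto
    qed
    finally show "n \<le> part (conjugate_partition (add_hook a b l)) (Suc j) \<longleftrightarrow> n \<le> Suc (part (conjugate_partition l) j)" .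
  qed
  have "diagonal_indices (add_hook a b l) = insert 1 (Suc ` diagonal_indices l)"
  proof (rule Set.set_eqI)
    fix i
    show "i \<in> diagonal_indices (add_hook a b l) \<longleftrightarrow> i \<in> insert 1 (Suc ` diagonal_indices l)"
    proof (cases "i \<le> 1")
      case True
      then have "i = 0 \<or> i = 1" by auto
      then show ?thesis using p1 by (auto simp: diagonal_indices_def)
    next
      case False
      then obtain k where k: "i = Suc k" "1 \<le> k" by (cases i) auto
      have "k \<le> b" if "k \<le> part l k" using part_pos_iff[OF l k(2)] that k(2) b by simp
      then show ?thesis using pS[OF k(2)] k by (auto simp: diagonal_indices_def)
    qed
  qed
  moreover have "finite (diagonal_indices l)" "1 \<notin> Suc ` diagonal_indices l"
    unfolding diagonal_indices_eq[OF l] by auto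
  ultimately show "diagonal_size (add_hook a b l) = Suc (diagonal_size l)"
    by (simp add: diagonal_size_def card_image)
qed

text \<open>The partition with Frobenius coordinates \<open>(a | a - e)\<close>: self-conjugate for \<open>e = 0\<close>,
  doubled distinct for \<open>e = 1\<close>.\<close>

fun frobenius_partition :: "nat \<Rightarrow> nat list \<Rightarrow> nat list" where
  "frobenius_partition e [] = []"
| "frobenius_partition e (a # as) = add_hook a (a - e) (frobenius_partition e as)"

text \<open>The bound e \<le> a keeps the legs a - e from being truncated; for e = 1 it is the
  condition that the integers defining a doubled distinct partition are positive.\<close>

definition arm_list :: "nat \<Rightarrow> nat list \<Rightarrow> bool" where
  "arm_list e as \<longleftrightarrow> sorted_wrt (>) as \<and> (\<forall>a\<in>set as. e \<le> a)"

text \<open>Length and first part belong to the induction hypothesis because \<open>add_hook\<close>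
  requires the next hook to enclose the diagram in both directions.\<close>

lemma frobenius_partition:
  assumes "arm_list e as" "e \<le> 1"
  shows "is_partition (frobenius_partition e as) \<and>
    length (frobenius_partition e as) = (if as = [] then 0 else Suc (hd as - e)) \<and>
    part (frobenius_partition e as) 1 = (if as = [] then 0 else Suc (hd as)) \<and>
    diagonal_size (frobenius_partition e as) = length as \<and>
    weight (frobenius_partition e as) = (\<Sum>a\<leftarrow>as. 2 * a + 1 - e) \<and>
    (\<forall>i<length as. part (frobenius_partition e as) (Suc i) = as ! i + Suc i \<and>
      part (conjugate_partition (frobenius_partition e as)) (Suc i) = (as ! i - e) + Suc i)"
  using assms(1)
proof (induction as)
  case Nil
  show ?case by (auto simp: is_partition_def weight_def diagonal_size_def diagonal_indices_def part_def)
next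
  case (Cons a as)
  define l where "l = frobenius_partition e as"
  have as: "arm_list e as" "e \<le> a" "\<And>x. x \<in> set as \<Longrightarrow> x < a \<and> e \<le> x" using Cons.prems by (auto simp: arm_list_def)
  note IH = Cons.IH[OF as(1), folded l_def]
  have hd: "as \<noteq> [] \<Longrightarrow> hd as < a \<and> e \<le> hd as" using as(3) by simp
  have len: "length l \<le> a - e" and p1: "part l 1 \<le> a" using IH hd by (auto split: if_splits)
  note h = add_hook[of l "a - e" a, OF _ len p1]
  have l: "is_partition l" using IH by blast
  have bound: "Suc i \<le> length l" if "i < length as" for i
  proof -
    have "part l (Suc i) > 0" using IH that by simp
    then show ?thesis using part_pos_iff[OF l, of "Suc i"] by simp
  qed
  have "part (add_hook a (a - e) l) (Suc i) = (a # as) ! i + Suc i \<and>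
      part (conjugate_partition (add_hook a (a - e) l)) (Suc i) = ((a # as) ! i - e) + Suc i"
    if i: "i < length (a # as)" for i
  proof (cases i)
    case 0
    then show ?thesis using h(3,5)[OF l] by simp
  next
    case (Suc k)
    then have k: "k < length as" using i by simp
    have b: "Suc k \<le> a - e" "Suc k \<le> a" using bound[OF k] len by auto
    then show ?thesis using h(4)[OF l, of "Suc k"] h(6)[OF l, of "Suc k"] IH k Suc by simp
  qed
  moreover have "Suc (a + (a - e)) = 2 * a + 1 - e" using as(2) by simp
  ultimately show ?case using h(1,2,3,7,8)[OF l] IH by (simp add: l_def[symmetric])
qed

text \<open>Arm a, leg a - e and the corner add up to 2a + 1 - e, so e decides the parity of all
  principal hooks.\<close>

lemma frobenius_principal_hooks:
  assumes "arm_list e as" "e \<le> 1"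
  shows "principal_hooks (frobenius_partition e as) = (\<lambda>a. 2 * a + 1 - e) ` set as"
proof -
  define l where "l = frobenius_partition e as"
  note f = frobenius_partition[OF assms, folded l_def]
  have "diagonal_indices l = Suc ` {..<length as}"
    using f diagonal_indices_eq[of l] by (simp add: image_Suc_lessThan)
  then have "principal_hooks l = (\<lambda>i. hook_length l (Suc i) (Suc i)) ` {..<length as}"
    by (simp add: principal_hooks_def image_image)
  also have "\<dots> = (\<lambda>i. 2 * (as ! i) + 1 - e) ` {..<length as}"
  proof (intro image_cong refl)
    fix i assume i: "i \<in> {..<length as}"
    then have "e \<le> as ! i" using assms(1) by (simp add: arm_list_def)
    then show "hook_length l (Suc i) (Suc i) = 2 * (as ! i) + 1 - e"
      using f i by (simp add: hook_length_def)
  qed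
  also have "\<dots> = (\<lambda>a. 2 * a + 1 - e) ` set as"
  proof -
    have "set as = (!) as ` {..<length as}" by (auto simp: set_conv_nth)
    then show ?thesis by (simp add: image_image)
  qed
  finally show ?thesis by (simp add: l_def)
qed

lemma partition_eq_frobenius:
  assumes l: "is_partition l" and e: "e \<le> 1"
    and a: "\<And>i. i < diagonal_size l \<Longrightarrow> e \<le> a i \<and> part l (Suc i) = a i + Suc i \<and>
      part (conjugate_partition l) (Suc i) = (a i - e) + Suc i"
  defines "as \<equiv> map a [0..<diagonal_size l]"
  shows "arm_list e as" "l = frobenius_partition e as"
proof -
  have "a j < a i" if "i < j" "j < diagonal_size l" for i j
    using a[of i] a[of j] part_antimono[OF l, of "Suc i" "Suc j"] that by simp
  then show as: "arm_list e as"
    using a by (auto simp: arm_list_def as_def sorted_wrt_iff_nth_less)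
  note f = frobenius_partition[OF as e]
  show "l = frobenius_partition e as"
  proof (rule partition_eqI_frobenius[OF l])
    show "is_partition (frobenius_partition e as)" "diagonal_size l = diagonal_size (frobenius_partition e as)"
      using f by (simp_all add: as_def)
    fix i assume i: "1 \<le> i" "i \<le> diagonal_size l"
    then obtain k where k: "i = Suc k" "k < diagonal_size l" by (cases i) auto
    have "k < length as" "as ! k = a k" using k by (simp_all add: as_def)
    then show "part l i = part (frobenius_partition e as) i"
      "part (conjugate_partition l) i = part (conjugate_partition (frobenius_partition e as)) i"
      using f a[OF k(2)] k(1) by simp_all
  qed
qed

lemma self_conjugate_iff: "self_conjugate l \<longleftrightarrow> (\<exists>as. arm_list 0 as \<and> l = frobenius_partition 0 as)"
proof
  assume sc: "self_conjugate l"
  then have l: "is_partition l" "conjugate_partition l = l" by (auto simp: self_conjugate_def)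
  have "part l (Suc i) = (part l (Suc i) - Suc i) + Suc i" if "i < diagonal_size l" for i
  proof -
    have "Suc i \<in> diagonal_indices l" using that diagonal_indices_eq[OF l(1)] by simp
    then show ?thesis by (simp add: diagonal_indices_def)
  qed
  then show "\<exists>as. arm_list 0 as \<and> l = frobenius_partition 0 as"
    using partition_eq_frobenius[OF l(1), of 0 "\<lambda>i. part l (Suc i) - Suc i"] l(2) by (simp add: exI)
next
  assume "\<exists>as. arm_list 0 as \<and> l = frobenius_partition 0 as"
  then obtain as where as: "arm_list 0 as" "l = frobenius_partition 0 as" by blast
  note f = frobenius_partition[OF as(1), of, folded as(2), simplified]
  have l: "is_partition l" using f by blast
  have "conjugate_partition l = l"
  proof (rule partition_eqI_frobenius[OF is_partition_conjugate[OF l] l])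
    have "diagonal_indices (conjugate_partition l) = diagonal_indices l"
      using le_part_conjugate_iff[OF l] by (auto simp: diagonal_indices_def)
    then show d: "diagonal_size (conjugate_partition l) = diagonal_size l" by (simp add: diagonal_size_def)
    fix i assume i: "1 \<le> i" "i \<le> diagonal_size (conjugate_partition l)"
    then obtain k where k: "i = Suc k" "k < length as" using f d by (cases i) auto
    then show e: "part (conjugate_partition l) i = part l i" using f by simp
    show "part (conjugate_partition (conjugate_partition l)) i = part (conjugate_partition l) i"
      using part_conjugate_conjugate[OF l i(1)] e by simp
  qed
  then show "self_conjugate l" using l by (simp add: self_conjugate_def)
qed

lemma doubled_distinct_iff: "doubled_distinct l \<longleftrightarrow> (\<exists>as. arm_list 1 as \<and> l = frobenius_partition 1 as)"
proof
  assume dd: "doubled_distinct l"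
  then have l: "is_partition l" by (simp add: doubled_distinct_def)
  show "\<exists>as. arm_list 1 as \<and> l = frobenius_partition 1 as"
  proof (cases "l = []")
    case True
    then show ?thesis by (intro exI[of _ "[]"]) (simp add: arm_list_def)
  next
    case False
    then obtain a :: "nat \<Rightarrow> int" where a: "\<forall>i\<in>{1..diagonal_size l}. 1 \<le> a i"
      "\<forall>i\<in>{1..diagonal_size l}. int (part l i) - int i = a i \<and> int (part (conjugate_partition l) i) - int i = a i - 1"
      using dd by (auto simp: doubled_distinct_def)
    have "1 \<le> nat (a (Suc i)) \<and> part l (Suc i) = nat (a (Suc i)) + Suc i \<and>
      part (conjugate_partition l) (Suc i) = (nat (a (Suc i)) - 1) + Suc i" if "i < diagonal_size l" for i
    proof -
      have "Suc i \<in> {1..diagonal_size l}" using that by simp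
      then have "1 \<le> a (Suc i)" "int (part l (Suc i)) - int (Suc i) = a (Suc i)"
        "int (part (conjugate_partition l) (Suc i)) - int (Suc i) = a (Suc i) - 1" using a by blast+
      then show ?thesis by linarith
    qed
    then show ?thesis using partition_eq_frobenius[OF l, of 1 "\<lambda>i. nat (a (Suc i))"] by blast
  qed
next
  assume "\<exists>as. arm_list 1 as \<and> l = frobenius_partition 1 as"
  then obtain as where as: "arm_list 1 as" "l = frobenius_partition 1 as" by blast
  note f = frobenius_partition[OF as(1) order_refl, folded as(2)]
  show "doubled_distinct l"
  proof (cases "as = []")
    case True
    then show ?thesis using as by (simp add: doubled_distinct_def is_partition_def)
  next
    case False
    define a where "a i = int (as ! (i - 1))" for i
    have "\<forall>i\<in>{1..length as}. 1 \<le> a i"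
      using as(1) by (auto simp: arm_list_def a_def)
    moreover have "\<forall>i\<in>{1..length as}. \<forall>j\<in>{1..length as}. i < j \<longrightarrow> a j < a i"
      using as(1) by (auto simp: arm_list_def a_def sorted_wrt_iff_nth_less)
    moreover have "\<forall>i\<in>{1..length as}. int (part l i) - int i = a i \<and> int (part (conjugate_partition l) i) - int i = a i - 1"
    proof
      fix i assume i: "i \<in> {1..length as}"
      then obtain k where k: "i = Suc k" "k < length as" by (cases i) auto
      have "1 \<le> as ! k" using as(1) k by (simp add: arm_list_def)
      then show "int (part l i) - int i = a i \<and> int (part (conjugate_partition l) i) - int i = a i - 1"
        using f k by (simp add: a_def of_nat_diff)
    qed
    moreover have "1 \<le> length as" using False by (cases as) auto
    ultimately show ?thesis using f unfolding doubled_distinct_def by blast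
  qed
qed

section \<open>Pairs of partitions and sets of hooks\<close>

lemma arm_list_unique:
  assumes "arm_list e as" "arm_list e bs" "set as = set bs" shows "as = bs"
proof -
  have "sorted_wrt (<) (rev as)" "sorted_wrt (<) (rev bs)"
    using assms(1,2) by (simp_all add: arm_list_def sorted_wrt_rev)
  then have "rev as = rev bs" using assms(3) by (intro strict_sorted_equal) auto
  then show ?thesis by simp
qed

lemma arm_list_exists:
  assumes "finite S" "\<And>a. a \<in> S \<Longrightarrow> e \<le> a" shows "\<exists>as. arm_list e as \<and> set as = S"
  using assms strict_sorted_list_of_set[of S]
  by (intro exI[of _ "rev (sorted_list_of_set S)"]) (auto simp: arm_list_def sorted_wrt_rev)

lemma arm_list_distinct: "arm_list e as \<Longrightarrow> distinct as"
  by (induction as) (auto simp: arm_list_def)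

definition hook_set_pairs :: "(nat list \<times> nat list) set" where
  "hook_set_pairs = {(l, m). self_conjugate l \<and> doubled_distinct m}"

lemma pair_hooks_frobenius:
  assumes as: "arm_list 0 as" and bs: "arm_list 1 bs"
  defines "l \<equiv> frobenius_partition 0 as" and "m \<equiv> frobenius_partition 1 bs"
  shows "pair_hooks l m = (\<lambda>a. 2 * a + 1) ` set as \<union> (\<lambda>b. 2 * b) ` set bs"
    "weight l + weight m = \<Sum>(pair_hooks l m)"
    "partition_sign l * partition_sign m = (- 1) ^ card (pair_hooks l m)"
    "0 \<notin> pair_hooks l m"
proof -
  show P: "pair_hooks l m = (\<lambda>a. 2 * a + 1) ` set as \<union> (\<lambda>b. 2 * b) ` set bs"
    using frobenius_principal_hooks[OF as] frobenius_principal_hooks[OF bs]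
    by (simp add: pair_hooks_def l_def m_def)
  have disj: "(\<lambda>a. 2 * a + 1) ` set as \<inter> (\<lambda>b. 2 * b) ` set bs = {}"
  proof -
    have "2 * a + 1 \<noteq> 2 * b" for a b :: nat by presburger
    then show ?thesis by blast
  qed
  have inj: "inj_on (\<lambda>a. 2 * a + 1) (set as)" "inj_on (\<lambda>b. 2 * b) (set bs)" by (auto simp: inj_on_def)
  have "\<Sum>(pair_hooks l m) = (\<Sum>a\<in>set as. 2 * a + 1) + (\<Sum>b\<in>set bs. 2 * b)"
    unfolding P using disj by (simp add: sum.union_disjoint sum.reindex inj del: One_nat_def)
  also have "\<dots> = (\<Sum>a\<leftarrow>as. 2 * a + 1) + (\<Sum>b\<leftarrow>bs. 2 * b)"
    by (simp only: sum.distinct_set_conv_list arm_list_distinct[OF as] arm_list_distinct[OF bs])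
  finally show "weight l + weight m = \<Sum>(pair_hooks l m)"
    using frobenius_partition[OF as] frobenius_partition[OF bs] by (simp add: l_def m_def)
  have "card (pair_hooks l m) = length as + length bs"
    unfolding P using disj arm_list_distinct[OF as] arm_list_distinct[OF bs]
    by (simp add: card_Un_disjoint card_image inj distinct_card del: One_nat_def)
  then show "partition_sign l * partition_sign m = (- 1) ^ card (pair_hooks l m)"
    using frobenius_partition[OF as] frobenius_partition[OF bs]
    by (simp add: partition_sign_def l_def m_def power_add)
  show "0 \<notin> pair_hooks l m" unfolding P using bs by (auto simp: arm_list_def)
qed

lemma hook_set_pairs_cases:
  assumes "(l, m) \<in> hook_set_pairs"
  obtains as bs where "arm_list 0 as" "arm_list 1 bs" "l = frobenius_partition 0 as" "m = frobenius_partition 1 bs"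
  using assms unfolding hook_set_pairs_def self_conjugate_iff doubled_distinct_iff by auto

lemma finite_pair_hooks:
  assumes "(l, m) \<in> hook_set_pairs" shows "finite (pair_hooks l m)"
proof (rule hook_set_pairs_cases[OF assms])
  fix as bs assume "arm_list 0 as" "arm_list 1 bs" "l = frobenius_partition 0 as" "m = frobenius_partition 1 bs"
  then show ?thesis using pair_hooks_frobenius(1)[of as bs] by simp
qed

text \<open>An odd hook h gives the arm (h - 1)/2 of the self-conjugate partition, an even one the
  arm h/2 of the doubled distinct partition. As the two parities cannot mix in the union, both arm
  sets can be recovered, and 0 is excluded exactly by the bound in
  \<open>arm_list 1\<close>.\<close>

lemma pair_hooks_bij: "bij_betw (\<lambda>(l, m). pair_hooks l m) hook_set_pairs {\<Delta>. finite \<Delta> \<and> 0 \<notin> \<Delta>}"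
  unfolding bij_betw_def
proof
  have odd: "{a. 2 * a + 1 \<in> (\<lambda>a. 2 * a + 1) ` A \<union> (\<lambda>b. 2 * b) ` B} = A"
    and even: "{b. 2 * b \<in> (\<lambda>a. 2 * a + 1) ` A \<union> (\<lambda>b. 2 * b) ` B} = B" for A B :: "nat set"
  proof -
    have "2 * a + 1 \<noteq> 2 * b" "2 * b \<noteq> 2 * a + 1" for a b :: nat by presburger+
    then show "{a. 2 * a + 1 \<in> (\<lambda>a. 2 * a + 1) ` A \<union> (\<lambda>b. 2 * b) ` B} = A"
      "{b. 2 * b \<in> (\<lambda>a. 2 * a + 1) ` A \<union> (\<lambda>b. 2 * b) ` B} = B" by auto
  qed
  show "inj_on (\<lambda>(l, m). pair_hooks l m) hook_set_pairs"
  proof (rule inj_onI)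
    fix p p' assume p: "p \<in> hook_set_pairs" and p': "p' \<in> hook_set_pairs"
      and e: "(\<lambda>(l, m). pair_hooks l m) p = (\<lambda>(l, m). pair_hooks l m) p'"
    obtain l m l' m' where lm: "p = (l, m)" "p' = (l', m')" by (cases p, cases p')
    obtain as bs where as: "arm_list 0 as" "arm_list 1 bs" "l = frobenius_partition 0 as" "m = frobenius_partition 1 bs"
      using p unfolding lm by (rule hook_set_pairs_cases)
    obtain as' bs' where as': "arm_list 0 as'" "arm_list 1 bs'" "l' = frobenius_partition 0 as'" "m' = frobenius_partition 1 bs'"
      using p' unfolding lm by (rule hook_set_pairs_cases)
    have P: "(\<lambda>a. 2 * a + 1) ` set as \<union> (\<lambda>b. 2 * b) ` set bs = (\<lambda>a. 2 * a + 1) ` set as' \<union> (\<lambda>b. 2 * b) ` set bs'"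
      using e pair_hooks_frobenius(1)[OF as(1,2)] pair_hooks_frobenius(1)[OF as'(1,2)]
      unfolding lm as(3,4) as'(3,4) by simp
    have "set as = set as'" using odd[of "set as" "set bs"] odd[of "set as'" "set bs'"] unfolding P by blast
    moreover have "set bs = set bs'" using even[of "set as" "set bs"] even[of "set as'" "set bs'"] unfolding P by blast
    ultimately show "p = p'"
      using arm_list_unique[OF as(1) as'(1)] arm_list_unique[OF as(2) as'(2)] by (simp add: lm as(3,4) as'(3,4))
  qed
  show "(\<lambda>(l, m). pair_hooks l m) ` hook_set_pairs = {\<Delta>. finite \<Delta> \<and> 0 \<notin> \<Delta>}"
  proof
    show "(\<lambda>(l, m). pair_hooks l m) ` hook_set_pairs \<subseteq> {\<Delta>. finite \<Delta> \<and> 0 \<notin> \<Delta>}"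
    proof
      fix \<Delta> assume "\<Delta> \<in> (\<lambda>(l, m). pair_hooks l m) ` hook_set_pairs"
      then obtain l m where lm: "(l, m) \<in> hook_set_pairs" "\<Delta> = pair_hooks l m" by auto
      obtain as bs where as: "arm_list 0 as" "arm_list 1 bs" "l = frobenius_partition 0 as" "m = frobenius_partition 1 bs"
        using lm(1) by (rule hook_set_pairs_cases)
      then show "\<Delta> \<in> {\<Delta>. finite \<Delta> \<and> 0 \<notin> \<Delta>}"
        using finite_pair_hooks[OF lm(1)] pair_hooks_frobenius(4)[OF as(1,2)] by (simp add: lm(2))
    qed
    show "{\<Delta>. finite \<Delta> \<and> 0 \<notin> \<Delta>} \<subseteq> (\<lambda>(l, m). pair_hooks l m) ` hook_set_pairs"
    proof
      fix \<Delta> :: "nat set" assume \<Delta>: "\<Delta> \<in> {\<Delta>. finite \<Delta> \<and> 0 \<notin> \<Delta>}"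
      have "finite {a. 2 * a + 1 \<in> \<Delta>}" "finite {b. 2 * b \<in> \<Delta>}"
        using \<Delta> finite_vimageI[of \<Delta> "\<lambda>a. 2 * a + 1"] finite_vimageI[of \<Delta> "\<lambda>a. 2 * a"]
        by (auto simp: inj_on_def vimage_def)
      moreover have "1 \<le> b" if "b \<in> {b. 2 * b \<in> \<Delta>}" for b using that \<Delta> by (cases b) auto
      ultimately obtain as bs where as: "arm_list 0 as" "set as = {a. 2 * a + 1 \<in> \<Delta>}"
        and bs: "arm_list 1 bs" "set bs = {b. 2 * b \<in> \<Delta>}"
        using arm_list_exists[of "{a. 2 * a + 1 \<in> \<Delta>}" 0] arm_list_exists[of "{b. 2 * b \<in> \<Delta>}" 1]
        by (meson le0)
      have "x \<in> (\<lambda>a. 2 * a + 1) ` set as \<union> (\<lambda>b. 2 * b) ` set bs \<longleftrightarrow> x \<in> \<Delta>" for x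
        unfolding as bs by (cases "even x") (auto elim!: evenE oddE)
      then have "pair_hooks (frobenius_partition 0 as) (frobenius_partition 1 bs) = \<Delta>"
        unfolding pair_hooks_frobenius(1)[OF as(1) bs(1)] by blast
      moreover have "(frobenius_partition 0 as, frobenius_partition 1 bs) \<in> hook_set_pairs"
        using as(1) bs(1) unfolding hook_set_pairs_def self_conjugate_iff doubled_distinct_iff by blast
      ultimately show "\<Delta> \<in> (\<lambda>(l, m). pair_hooks l m) ` hook_set_pairs" by (force intro!: image_eqI)
    qed
  qed
qed

theorem theorem3p9:
  fixes t :: complex
  shows "((\<lambda>(l, m).
            fps_const
              (partition_sign l * partition_sign m *
               (\<Prod>h\<in>pair_hooks l m.
                  (1 - (2 * t + 2) / of_nat h) * (1 - (t + 1) / of_nat h) *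
                  (\<Prod>j=1..h - 1.
                     1 - ((2 * t + 2) / (of_nat h + hook_sign (pair_hooks l m) j * of_nat j))\<^sup>2)))
            * fps_X ^ (weight l + weight m))
          has_sum euler_power (2 * t\<^sup>2 + t))
         {(l, m). self_conjugate l \<and> doubled_distinct m}"
proof -
  \<comment> \<open>The summand depends on the pair only through its hook set; writing it this way
    allows reindexing along \<open>pair_hooks_bij\<close>.\<close>
  define f where "f p = fps_const (hook_weight t (pair_hooks (fst p) (snd p))) * fps_X ^ \<Sum>(pair_hooks (fst p) (snd p))"
    for p :: "nat list \<times> nat list"
  have sum_f: "(f has_sum euler_power (2 * t\<^sup>2 + t)) hook_set_pairs"
    unfolding has_sum_def
  proof (rule tendsto_fpsI)
    fix K
    \<comment> \<open>The finitely many pairs that contribute to x^K. Every finite set of pairs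
      containing B has the right coefficient at K, which is X-adic convergence.\<close>
    define B where "B = {p \<in> hook_set_pairs. \<Sum>(pair_hooks (fst p) (snd p)) = K}"
    have bij: "bij_betw (\<lambda>p. pair_hooks (fst p) (snd p)) B (hook_sets K)"
    proof -
      define g where "g p = pair_hooks (fst p) (snd p)" for p :: "nat list \<times> nat list"
      have g: "bij_betw g hook_set_pairs {\<Delta>. finite \<Delta> \<and> 0 \<notin> \<Delta>}"
        using pair_hooks_bij by (simp add: case_prod_beta' g_def[abs_def])
      have B: "B = {p \<in> hook_set_pairs. \<Sum>(g p) = K}" by (simp add: B_def g_def)
      have "g ` B = hook_sets K"
      proof
        show "g ` B \<subseteq> hook_sets K"
          using bij_betwE[OF g] by (auto simp: B hook_sets_def)
        show "hook_sets K \<subseteq> g ` B"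
        proof
          fix \<Delta> assume \<Delta>: "\<Delta> \<in> hook_sets K"
          then have "\<Delta> \<in> g ` hook_set_pairs"
            unfolding bij_betw_imp_surj_on[OF g] by (simp add: hook_sets_def)
          then show "\<Delta> \<in> g ` B" using \<Delta> by (auto simp: B hook_sets_def)
        qed
      qed
      moreover have "B \<subseteq> hook_set_pairs" by (auto simp: B)
      ultimately have "bij_betw g B (hook_sets K)" using bij_betw_subset[OF g] by blast
      then show ?thesis by (simp add: g_def[abs_def])
    qed
    then have finB: "finite B" using bij_betw_finite finite_hook_sets by blast
    have "(\<Sum>p\<in>B. hook_weight t (pair_hooks (fst p) (snd p))) = (\<Sum>\<Delta>\<in>hook_sets K. hook_weight t \<Delta>)"
      by (rule sum.reindex_bij_betw[OF bij])
    then have sumB: "(\<Sum>p\<in>B. hook_weight t (pair_hooks (fst p) (snd p))) = fps_nth (euler_power (2 * t\<^sup>2 + t)) K"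
      by (simp only: sum_hook_weight)
    show "\<forall>\<^sub>F A in finite_subsets_at_top hook_set_pairs. fps_nth (sum f A) K = fps_nth (euler_power (2 * t\<^sup>2 + t)) K"
      unfolding eventually_finite_subsets_at_top
    proof (intro exI[of _ B] conjI allI impI)
      fix A assume A: "finite A \<and> B \<subseteq> A \<and> A \<subseteq> hook_set_pairs"
      have "fps_nth (sum f A) K = (\<Sum>p\<in>A. if \<Sum>(pair_hooks (fst p) (snd p)) = K then hook_weight t (pair_hooks (fst p) (snd p)) else 0)"
        unfolding fps_sum_nth f_def by (intro sum.cong refl) auto
      also have "\<dots> = (\<Sum>p\<in>B. hook_weight t (pair_hooks (fst p) (snd p)))"
        by (rule sum.mono_neutral_cong_right) (use A in \<open>auto simp: B_def\<close>)
      finally show "fps_nth (sum f A) K = fps_nth (euler_power (2 * t\<^sup>2 + t)) K" by (simp only: sumB)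
    qed (use finB in \<open>auto simp: B_def\<close>)
  qed
  have eq_f: "f p = (case p of (l, m) \<Rightarrow>
            fps_const
              (partition_sign l * partition_sign m *
               (\<Prod>h\<in>pair_hooks l m.
                  (1 - (2 * t + 2) / of_nat h) * (1 - (t + 1) / of_nat h) *
                  (\<Prod>j=1..h - 1.
                     1 - ((2 * t + 2) / (of_nat h + hook_sign (pair_hooks l m) j * of_nat j))\<^sup>2)))
            * fps_X ^ (weight l + weight m))" if p: "p \<in> hook_set_pairs" for p
  proof -
    obtain l m where lm: "p = (l, m)" by (cases p)
    have "(l, m) \<in> hook_set_pairs" using p lm by simp
    then obtain as bs where as: "arm_list 0 as" "arm_list 1 bs" "l = frobenius_partition 0 as" "m = frobenius_partition 1 bs"
      by (rule hook_set_pairs_cases)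
    have w: "\<Sum>(pair_hooks l m) = weight l + weight m"
      and s: "(- 1) ^ card (pair_hooks l m) = partition_sign l * partition_sign m"
      using pair_hooks_frobenius(2,3)[OF as(1,2)] by (simp_all only: as(3,4))
    show ?thesis
      unfolding f_def lm fst_conv snd_conv prod.case hook_weight_def hook_factor_def w s ..
  qed
  show ?thesis
    unfolding hook_set_pairs_def[symmetric] by (rule has_sum_cong[THEN iffD1, OF eq_f sum_f])
qed

end
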